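(* Let $f$ be a meromorphic function on $\mathbb{C}$ of finite order, with convergence exponent $d\ge1$ and with its divisor contained in a left half plane. Let $W(f)$ be its Newton-Cramer distribution and let $P_f(s)=c_0+c_1s+\dots+c_{g-1}s^{g-1}$ be its discrepancy polynomial. Then, in $\mathbb{R}$, $$W(f)=\sum_{j=0}^{g-1}c_j\,\delta_0^{(j)}+\mathcal{L}^{-1}(f'/f),$$ or, equivalently, $$\mathcal{L}(W(f))(s)=\langle W(f),e^{-st}\rangle_{\mathbb{R}_+}=\frac{f'(s)}{f(s)}+P_f(s).$$
   Context: $\rho$ runs over zeros and poles of $f$, with multiplicity $n_\rho\in\mathbb{Z}$ (positive for zeros, negative for poles; $n_\rho=0$ if $\rho$ is neither). The convergence exponent $d$ is the least integer $d\geq 0$ with $\sum_{\rho\ne0}|n_\rho||\rho|^{-d}<\infty$. $\sigma_1=\sup_\rho\Re\rho<\infty$. Newton-Cramer distribution: with $\mathbf{1}_{\mathbb{R}_+}$ the indicator of $[0,\infty)$, $$K_d(t)=\Big(n_{\sigma_1}\frac{t^d}{d!}+\sum_{\rho\ne\sigma_1}\frac{n_\rho}{(\rho-\sigma_1)^d}e^{(\rho-\sigma_1)t}\Big)\mathbf{1}_{\mathbb{R}_+},\qquad W(f)=e^{\sigma_1t}\frac{D^d}{Dt^d}\big((K_d(t)-K_d(0))\mathbf{1}_{\mathbb{R}_+}\big),$$ with $D/Dt$ the distributional derivative on $\mathbb{R}$. Discrepancy: $G(s)=\frac{n_{\sigma_1}}{s-\sigma_1}+\sum_{\rho\ne\sigma_1}n_\rho\frac{(s-\sigma_1)^{d-1}}{(\rho-\sigma_1)^{d-1}}\frac1{s-\rho}$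 and $P_f=G-f'/f$, a polynomial of degree at most $g-1$, where $g=\max(\deg Q_f,d-1)$ is the genus and $Q_f$ is the polynomial in the Hadamard factorization $f(s)=s^{n_0}e^{Q_f(s)}\prod_{\rho\ne0}E_{d-1}(s/\rho)^{n_\rho}$, $E_m(z)=(1-z)e^{z+z^2/2+\dots+z^m/m}$. Laplace transform $\mathcal{L}$ of a distribution supported in $[0,\infty)$: pairing with $e^{-st}$ for $\Re s$ large. Inverse Laplace transform: for $F$ holomorphic with polynomial growth on a half plane $\Re s\ge c$ (with $c>\max(\sigma_1,0)$), take an integer $m$ at least two more than the order of growth of $F$, put $L(t)=\int_{-\infty}^{+\infty}\frac{F(c+iu)}{(c+iu)^m}e^{(c+iu)t}\frac{du}{2\pi}$ (a continuous function vanishing on $(-\infty,0]$, independent of $c$) and $\mathcal{L}^{-1}(F)=\frac{D^m}{Dt^m}L$. For $f$ as in the claim, $F=f'/f$ has such polynomial growth. *)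

theory Defs
  imports "HOL-Complex_Analysis.Complex_Analysis" "HOL-Computational_Algebra.Polynomial"
begin

section \<open>Distributions on the real line\<close>

definition tderiv :: "(real \<Rightarrow> complex) \<Rightarrow> real \<Rightarrow> complex" where
  "tderiv \<phi> t = vector_derivative \<phi> (at t)"

definition test_function :: "(real \<Rightarrow> complex) \<Rightarrow> bool" where
  "test_function \<phi> \<longleftrightarrow>
     (\<forall>n t. (tderiv ^^ n) \<phi> differentiable (at t)) \<and> compact (closure {t. \<phi> t \<noteq> 0})"

text \<open>
  A distribution is represented by its pairing with functions; only the values on test functions
  are significant, so equality of distributions is \<open>distr_eq\<close>, not equality of functionals.
\<close>
type_synonym distr = "(real \<Rightarrow> complex) \<Rightarrow> complex"

definition distr_eq :: "distr \<Rightarrow> distr \<Rightarrow> bool" where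
  "distr_eq S T \<longleftrightarrow> (\<forall>\<phi>. test_function \<phi> \<longrightarrow> S \<phi> = T \<phi>)"

definition distr_of_fun :: "(real \<Rightarrow> complex) \<Rightarrow> distr" where
  "distr_of_fun u = (\<lambda>\<phi>. LBINT t. u t * \<phi> t)"

definition distr_deriv :: "distr \<Rightarrow> distr" where
  "distr_deriv T = (\<lambda>\<phi>. - T (tderiv \<phi>))"

definition distr_mult :: "(real \<Rightarrow> complex) \<Rightarrow> distr \<Rightarrow> distr" where
  "distr_mult a T = (\<lambda>\<phi>. T (\<lambda>t. a t * \<phi> t))"

definition dirac0 :: distr where
  "dirac0 = (\<lambda>\<phi>. \<phi> 0)"

definition supported_nonneg :: "distr \<Rightarrow> bool" where
  "supported_nonneg T \<longleftrightarrow>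
     (\<forall>\<phi>. test_function \<phi> \<and> closure {t. \<phi> t \<noteq> 0} \<subseteq> {..<0} \<longrightarrow> T \<phi> = 0)"


section \<open>Laplace transform and inverse Laplace transform\<close>

text \<open>
  The function \<open>t \<mapsto> exp (-s t)\<close> is not compactly supported, so its pairing with a distribution is
  defined by dilated cut-offs, and has to be independent of the cut-off.  Since \<open>T\<close> is supported
  in the nonnegative half-line, the growth of \<open>exp (-s t)\<close> at minus infinity is irrelevant.
\<close>
definition pairing_exp :: "distr \<Rightarrow> complex \<Rightarrow> complex \<Rightarrow> bool" where
  "pairing_exp T s v \<longleftrightarrow>
     (\<forall>\<eta>. test_function \<eta> \<and> (\<forall>\<^sub>F t in nhds 0. \<eta> t = 1) \<longrightarrow>
        ((\<lambda>R. T (\<lambda>t. \<eta> (t / R) * exp (- s * complex_of_real t))) \<longlongrightarrow> v) at_top)"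

definition has_laplace_transform :: "distr \<Rightarrow> (complex \<Rightarrow> complex) \<Rightarrow> bool" where
  "has_laplace_transform T F \<longleftrightarrow>
     supported_nonneg T \<and> (\<exists>a. \<forall>s. Re s > a \<longrightarrow> pairing_exp T s (F s))"

definition polynomial_growth :: "(complex \<Rightarrow> complex) \<Rightarrow> real \<Rightarrow> nat \<Rightarrow> bool" where
  "polynomial_growth F c k \<longleftrightarrow>
     F holomorphic_on {s. Re s \<ge> c} \<and>
     (\<exists>C. \<forall>s. Re s \<ge> c \<longrightarrow> norm (F s) \<le> C * (1 + norm s) ^ k)"

text \<open>
  Meaningful if \<open>c > 0\<close>, \<open>polynomial_growth F c k\<close> and \<open>m \<ge> k + 2\<close> for some \<open>k\<close>.
\<close>
definition inverse_laplace :: "real \<Rightarrow> nat \<Rightarrow> (complex \<Rightarrow> complex) \<Rightarrow> distr" where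
  "inverse_laplace c m F =
     (distr_deriv ^^ m) (distr_of_fun (\<lambda>t.
        LBINT u. F (Complex c u) / Complex c u ^ m * exp (Complex c u * complex_of_real t)
                   / complex_of_real (2 * pi)))"


section \<open>Meromorphic functions of finite order\<close>

definition entire_finite_order :: "(complex \<Rightarrow> complex) \<Rightarrow> bool" where
  "entire_finite_order g \<longleftrightarrow>
     g holomorphic_on UNIV \<and>
     (\<exists>r. \<forall>\<^sub>F z in at_infinity. norm (g z) \<le> exp (norm z powr r))"

text \<open>
  A meromorphic function has finite order if it is a quotient of entire functions of finite order
  (the numerator and the denominator may have common zeros).
\<close>
definition finite_order :: "(complex \<Rightarrow> complex) \<Rightarrow> bool" where
  "finite_order f \<longleftrightarrow>
     (\<exists>g h. entire_finite_order g \<and> entire_finite_order h \<and> (\<exists>z. h z \<noteq> 0) \<and>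
            (\<forall>z. h z \<noteq> 0 \<longrightarrow> f z = g z / h z))"

text \<open>
  The multiplicity \<open>n\<^sub>\<rho>\<close> is \<open>zorder f \<rho>\<close>; for a meromorphic function that does not vanish identically
  it is positive at zeros, negative at poles and \<open>0\<close> elsewhere.
\<close>
definition zeros_poles :: "(complex \<Rightarrow> complex) \<Rightarrow> complex set" where
  "zeros_poles f = {\<rho>. isolated_zero f \<rho> \<or> is_pole f \<rho>}"

definition convergence_exponent :: "(complex \<Rightarrow> complex) \<Rightarrow> nat" where
  "convergence_exponent f =
     (LEAST d. (\<lambda>\<rho>. \<bar>real_of_int (zorder f \<rho>)\<bar> / norm \<rho> ^ d) summable_on (zeros_poles f - {0}))"

definition sigma1 :: "(complex \<Rightarrow> complex) \<Rightarrow> real" where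
  "sigma1 f = (SUP \<rho>\<in>zeros_poles f. Re \<rho>)"


section \<open>Genus and discrepancy\<close>

text \<open>
  The library's \<open>weierstrass_factor m\<close> is \<open>E\<^sub>m\<close>.  The product is taken over the net of finite
  subsets.  At poles the identity is not required, as \<open>f\<close> has no value there.
\<close>
definition hadamard_factorization :: "(complex \<Rightarrow> complex) \<Rightarrow> complex poly \<Rightarrow> bool" where
  "hadamard_factorization f Q \<longleftrightarrow>
     (\<forall>s. \<not> is_pole f s \<longrightarrow>
        (\<exists>p. ((\<lambda>X. \<Prod>\<rho>\<in>X. weierstrass_factor (convergence_exponent f - 1) (s / \<rho>) powi zorder f \<rho>)
                \<longlongrightarrow> p) (finite_subsets_at_top (zeros_poles f - {0})) \<and>
             f s = s powi zorder f 0 * exp (poly Q s) * p))"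

text \<open>
  The polynomial in the Hadamard factorization is unique only up to an integer multiple of \<open>2\<pi>\<i>\<close>, which does
  not affect its degree.
\<close>
definition hadamard_poly :: "(complex \<Rightarrow> complex) \<Rightarrow> complex poly" where
  "hadamard_poly f = (SOME Q. hadamard_factorization f Q)"

definition genus :: "(complex \<Rightarrow> complex) \<Rightarrow> nat" where
  "genus f = max (degree (hadamard_poly f)) (convergence_exponent f - 1)"

definition discrepancy_G :: "(complex \<Rightarrow> complex) \<Rightarrow> complex \<Rightarrow> complex" where
  "discrepancy_G f s =
     (let d = convergence_exponent f; \<sigma> = complex_of_real (sigma1 f) in
        of_int (zorder f \<sigma>) / (s - \<sigma>) +
        (\<Sum>\<^sub>\<infinity>\<rho>\<in>zeros_poles f - {\<sigma>}.
           of_int (zorder f \<rho>) * ((s - \<sigma>) ^ (d - 1) / (\<rho> - \<sigma>) ^ (d - 1)) * (1 / (s - \<rho>))))"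

definition discrepancy_poly :: "(complex \<Rightarrow> complex) \<Rightarrow> complex poly" where
  "discrepancy_poly f =
     (THE P. \<forall>s. s \<notin> zeros_poles f \<and> s \<noteq> complex_of_real (sigma1 f) \<longrightarrow>
               poly P s = discrepancy_G f s - deriv f s / f s)"


section \<open>The Newton-Cramer distribution\<close>

definition newton_cramer_K :: "(complex \<Rightarrow> complex) \<Rightarrow> real \<Rightarrow> complex" where
  "newton_cramer_K f t =
     (let d = convergence_exponent f; \<sigma> = complex_of_real (sigma1 f) in
        (of_int (zorder f \<sigma>) * (complex_of_real t ^ d / fact d) +
         (\<Sum>\<^sub>\<infinity>\<rho>\<in>zeros_poles f - {\<sigma>}.
            of_int (zorder f \<rho>) / (\<rho> - \<sigma>) ^ d * exp ((\<rho> - \<sigma>) * complex_of_real t)))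
        * indicator {0..} t)"

definition newton_cramer :: "(complex \<Rightarrow> complex) \<Rightarrow> distr" where
  "newton_cramer f =
     distr_mult (\<lambda>t. exp (complex_of_real (sigma1 f * t)))
       ((distr_deriv ^^ convergence_exponent f)
         (distr_of_fun (\<lambda>t. (newton_cramer_K f t - newton_cramer_K f 0) * indicator {0..} t)))"

end

theory Submission
  imports Defs "HOL-Probability.Characteristic_Functions" "HOL-Probability.Sinc_Integral"
begin

text \<open>
  Both assertions express one identity: on \<open>Re s > sigma1 f\<close> the Laplace transform of the
  Newton-Cramer distribution is the partial fraction series \<open>G\<close> of the discrepancy, and \<open>G\<close> is \<open>f'/f\<close>
  plus a polynomial of degree less than the genus.

  The distribution is \<open>exp (\<sigma> t)\<close> times the \<open>d\<close>-th derivative of a continuous function \<open>u\<close> on the half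
  line, so its transform is \<open>(s - \<sigma>) ^ d\<close> times that of \<open>u\<close>.  Integrating \<open>u\<close> term by term, the summand of
  \<open>\<rho>\<close> contributes a multiple of \<open>1 / (s - \<rho>) - 1 / (s - \<sigma>)\<close>, and the factor \<open>(s - \<sigma>) ^ d\<close> turns it into
  the summand of \<open>\<rho>\<close> in \<open>G\<close> (\<open>W_laplace_eq\<close>).  In the pairing with \<open>exp (- s t)\<close> through dilated cut-offs
  every derivative that falls on the cut-off brings a factor \<open>1 / R\<close> (\<open>W_pairing_exp\<close>).  For the inverse
  Laplace transform, let \<open>\<Phi>\<close> be the two-sided Laplace transform of a test function.  Fourier inversion
  and Fubini write the pairings of that test function with the distribution, with the derivatives of
  Dirac's measure and with the inverse Laplace transform of \<open>F\<close> as integrals over one vertical line of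
  \<open>G \<Phi>\<close>, of a polynomial times \<open>\<Phi>\<close>, and of \<open>F \<Phi>\<close> (\<open>W_parseval\<close>, \<open>polynomial_delta_pairing\<close>,
  \<open>inverse_laplace_pairing\<close>); so the formula is the identity \<open>G = f'/f + P\<close> integrated against \<open>\<Phi>\<close>.

  The identity itself uses finite order.  Write \<open>f\<close> as a quotient of entire functions and divide each
  of them by its zeros in the disc of radius \<open>R\<close>.  The maximum principle on the circle of radius \<open>3 R\<close>
  bounds the quotient by \<open>exp (K R ^ m)\<close> times its value at the origin and, at the origin, bounds the
  number of zeros by \<open>K R ^ m\<close> (\<open>strip_growth\<close>); the latter makes the convergence exponent finite.  As the quotient has no zeros, a
  Borel-Caratheodory argument for its logarithm shows that its logarithmic derivative is a
  polynomial of degree less than \<open>m\<close> up to an error that tends to \<open>0\<close> (\<open>log_derivative_taylor_bound\<close>).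
  Hence \<open>f'/f\<close> is a limit of finite sums of \<open>n / (z - \<rho>)\<close> plus polynomials of bounded degree.  Replacing
  these sums by partial sums of a convergent series changes the polynomials only, and a pointwise limit of
  polynomials of bounded degree is again such a polynomial (\<open>log_derivative_poly\<close>).

  The series may be expanded about any base point; changing the base point adds a polynomial of degree
  less than \<open>d - 1\<close> (\<open>coeff_base_change\<close>).  With base point \<open>0\<close> the summands are the logarithmic derivatives of
  the factors of the Hadamard product, so integration yields the factorization, and \<open>Q'\<close> is the
  negative of the polynomial for base point \<open>0\<close> (\<open>hadamard_factorization_exists\<close>).  So the discrepancy is
  \<open>- Q'\<close> plus a polynomial of degree less than \<open>d - 1\<close>, which gives the bound by the genus
  (\<open>discrepancy_poly\<close>).
\<close>

section \<open>Polynomials and logarithmic derivatives\<close>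

text \<open>
  By Lagrange interpolation the values at \<open>N\<close> points determine such a polynomial linearly, so
  convergence at \<open>N\<close> points of \<open>S\<close> already gives convergence of the polynomials.
\<close>
lemma polynomial_pointwise_limit:
  fixes p :: "'i \<Rightarrow> complex poly"
  assumes S: "infinite S" and F: "F \<noteq> bot"
    and deg: "\<And>i j. N \<le> j \<Longrightarrow> coeff (p i) j = 0"
    and lim: "\<And>z. z \<in> S \<Longrightarrow> ((\<lambda>i. poly (p i) z) \<longlongrightarrow> v z) F"
  obtains q where "\<And>j. N \<le> j \<Longrightarrow> coeff q j = 0" "\<And>z. z \<in> S \<Longrightarrow> v z = poly q z"
proof (cases "N = 0")
  case True
  then have "p i = 0" for i
    using deg by (intro poly_eqI) auto
  then have "v z = poly 0 z" if "z \<in> S" for z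
    using tendsto_unique[OF F lim[OF that]] by simp
  then show ?thesis using that[of 0] by simp
next
  case False
  obtain X where X: "X \<subseteq> S" "card X = N" "finite X"
    using infinite_arbitrarily_large[OF S] by blast
  define l where "l x = (\<Prod>y\<in>X - {x}. smult (1 / (x - y)) [:- y, 1:])" for x
  have lx: "poly (l x) y = (if x = y then 1 else 0)" if "x \<in> X" "y \<in> X" for x y
  proof (cases "x = y")
    case True
    have "1 / (x - w) * (x - w) = 1" if "w \<in> X - {x}" for w
      using that by auto
    then show ?thesis
      using True unfolding l_def poly_prod by (auto intro!: prod.neutral simp: diff_divide_distrib[symmetric])
  next
    case False
    then have "poly (l x) y = 0"
      unfolding l_def poly_prod by (rule_tac prod_zero) (use that X in auto)
    then show ?thesis using False by simp
  qed
  have degl: "degree (l x) < N" if "x \<in> X" for x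
  proof -
    have "degree (l x) \<le> (\<Sum>y\<in>X - {x}. degree (smult (1 / (x - y)) [:- y, 1:]))"
        using degree_prod_sum_le[of "X - {x}" "\<lambda>y. smult (1 / (x - y)) [:- y, 1:]"] X
      by (simp add: l_def o_def)
    also have "\<dots> \<le> (\<Sum>y\<in>X - {x}. 1)"
      by (intro sum_mono) auto
    also have "\<dots> = N - 1" using X that by simp
    finally show ?thesis using False by simp
  qed
  have degs: "degree (\<Sum>x\<in>X. smult (c x) (l x)) < N" for c
    by (rule degree_sum_less) (use degl False in \<open>auto intro: le_less_trans[OF degree_smult_le]\<close>)
  have interp: "p i = (\<Sum>x\<in>X. smult (poly (p i) x) (l x))" for i
  proof (rule poly_eqI_degree[of X])
    show "poly (p i) x = poly (\<Sum>x\<in>X. smult (poly (p i) x) (l x)) x" if "x \<in> X" for x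
      using that X by (simp add: poly_sum lx sum.delta if_distrib[of "(*) _"] cong: if_cong)
    show "degree (p i) < card X"
      unfolding X(2) by (rule degree_lessI) (use deg[of _ i] False in auto)
    show "degree (\<Sum>x\<in>X. smult (poly (p i) x) (l x)) < card X"
      using degs X by simp
  qed
  define q where "q = (\<Sum>x\<in>X. smult (v x) (l x))"
  show ?thesis
  proof (rule that[of q])
    show "coeff q j = 0" if "N \<le> j" for j
      using that degs[of v] by (simp add: q_def coeff_eq_0)
    show "v z = poly q z" if "z \<in> S" for z
    proof (rule tendsto_unique[OF F lim[OF that]])
      have "((\<lambda>i. \<Sum>x\<in>X. poly (p i) x * poly (l x) z) \<longlongrightarrow> (\<Sum>x\<in>X. v x * poly (l x) z)) F"
        using X by (intro tendsto_intros lim) auto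
      then show "((\<lambda>i. poly (p i) z) \<longlongrightarrow> poly q z) F"
        unfolding q_def by (subst interp) (simp add: poly_sum)
    qed
  qed
qed

lemma pderiv_sum: "pderiv (\<Sum>i\<in>A. p i) = (\<Sum>i\<in>A. pderiv (p i))"
  by (induction A rule: infinite_finite_induct) (auto simp: pderiv_add)

lemma poly_antiderivative: "\<exists>Q. pderiv Q = (p :: complex poly)"
proof -
  define Q where "Q = (\<Sum>i\<le>degree p. monom (coeff p i / of_nat (i + 1)) (i + 1))"
  have *: "pderiv (monom (coeff p i / of_nat (i + 1)) (i + 1)) = monom (coeff p i) i" for i
    unfolding pderiv_monom using of_nat_neq_0[of i, where 'a=complex] by simp
  have "pderiv Q = (\<Sum>i\<le>degree p. monom (coeff p i) i)"
    unfolding Q_def by (simp only: pderiv_sum *)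
  then show ?thesis using poly_as_sum_of_monoms[of p] by metis
qed

lemma poly_eq_on_infinite:
  fixes p q :: "complex poly"
  assumes "infinite S" "\<And>z. z \<in> S \<Longrightarrow> poly p z = poly q z"
  shows "p = q"
proof (rule ccontr)
  assume "p \<noteq> q"
  then have "finite {z. poly (p - q) z = 0}" by (intro poly_roots_finite) auto
  moreover have "S \<subseteq> {z. poly (p - q) z = 0}" using assms(2) by auto
  ultimately show False using assms(1) finite_subset by blast
qed

text \<open>
  Derivatives are kept in the form \<open>u z * l\<close>, in which logarithmic derivatives add up even where some
  of the factors vanish.
\<close>
lemma has_field_derivative_prod_logarithmic:
  fixes u :: "'a \<Rightarrow> complex \<Rightarrow> complex"
  assumes "\<And>a. a \<in> A \<Longrightarrow> (u a has_field_derivative u a z * l a) (at z)"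
  shows "((\<lambda>w. \<Prod>a\<in>A. u a w) has_field_derivative (\<Prod>a\<in>A. u a z) * (\<Sum>a\<in>A. l a)) (at z)"
  using assms
proof (induction A rule: infinite_finite_induct)
  case (insert a A)
  then show ?case
    by (auto intro!: derivative_eq_intros simp: algebra_simps)
qed auto

lemma has_field_derivative_powi_logarithmic:
  assumes "(u has_field_derivative u z * l) (at z)" "u z \<noteq> 0 \<or> n = 0"
  shows "((\<lambda>w. u w powi n) has_field_derivative u z powi n * (of_int n * l)) (at z)"
proof (cases "n = 0")
  case False
  then have "u z powi (n - 1) * u z = u z powi n"
    using assms(2) by (simp add: power_int_diff)
  then show ?thesis using assms False
    by (auto intro!: derivative_eq_intros simp: algebra_simps)
qed simp

lemma has_derivative_logarithmic:
  assumes "k analytic_on {z}" "k z \<noteq> 0"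
  shows "(k has_field_derivative k z * (deriv k z / k z)) (at z)"
  using assms analytic_on_imp_differentiable_at[of k "{z}" z] 
  by (simp add: DERIV_deriv_iff_field_differentiable)

lemma eventually_not_in_finite: "finite A \<Longrightarrow> \<forall>\<^sub>F w in at z. w \<notin> (A :: complex set)"
  using islimpt_finite[of A z] unfolding islimpt_conv_frequently_at frequently_def by simp

section \<open>Dividing out a finite part of the divisor\<close>
locale nonzero_meromorphic =
  fixes f :: "complex \<Rightarrow> complex"
  assumes mero: "f nicely_meromorphic_on UNIV" and nz: "\<exists>z. f z \<noteq> 0"
begin

lemma meromorphic: "f meromorphic_on A"
  using mero meromorphic_on_subset unfolding nicely_meromorphic_on_def by blast

lemma eventually_nonzero: "\<forall>\<^sub>F w in at z. f w \<noteq> 0"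
  using nicely_meromorphic_imp_constant_or_avoid[OF mero, of 0] nz
  by (auto simp: eventually_cosparse_open_eq)

lemma analytic_at: "\<not> is_pole f z \<Longrightarrow> f analytic_on {z}"
  using nicely_meromorphic_on_imp_analytic_at[OF mero] by blast

lemma zeros_poles_iff: "z \<in> zeros_poles f \<longleftrightarrow> f z = 0"
proof
  assume "z \<in> zeros_poles f"
  then show "f z = 0"
    unfolding zeros_poles_def
    using is_pole_zero_at_nicely_mero[OF mero, of z] nicely_meromorphic_on_subset[OF mero, of "{z}"]
      zero_isolated_zero_nicely_meromorphic[of f z] by auto
next
  assume "f z = 0"
  then show "z \<in> zeros_poles f"
    unfolding zeros_poles_def using zero_or_pole[OF mero _ _ eventually_nonzero, of z] by auto
qed

lemma analytic_off_zeros_poles: "z \<notin> zeros_poles f \<Longrightarrow> f analytic_on {z}"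
  using analytic_at[of z] by (simp add: zeros_poles_def)

lemma zorder_zero_iff: "zorder f z = 0 \<longleftrightarrow> z \<notin> zeros_poles f"
proof
  assume 0: "zorder f z = 0"
  have "isolated_singularity_at f z"
    using meromorphic[of "{z}"] meromorphic_at_iff by simp
  then have "\<not> is_pole f z"
    using isolated_pole_imp_neg_zorder[of f z] 0 by auto
  moreover have "\<exists>\<^sub>F w in at z. f w \<noteq> 0"
    by (intro eventually_frequently at_neq_bot eventually_nonzero)
  ultimately have "f z \<noteq> 0"
    using 0 analytic_at zorder_eq_0_iff by simp
  then show "z \<notin> zeros_poles f"
    using zeros_poles_iff by simp
next
  assume "z \<notin> zeros_poles f"
  then show "zorder f z = 0"
    using analytic_off_zeros_poles[of z] zeros_poles_iff[of z] by (intro zorder_eq_0I) auto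
qed

lemma not_islimpt_zeros_poles: "\<not> z islimpt zeros_poles f"
proof -
  have "\<forall>\<^sub>F w in at z. w \<notin> zeros_poles f"
    using eventually_nonzero by eventually_elim (simp add: zeros_poles_iff)
  then show ?thesis by (auto simp: islimpt_conv_frequently_at frequently_def)
qed

lemma finite_zeros_poles: "compact K \<Longrightarrow> finite (zeros_poles f \<inter> K)"
  by (subst Int_commute, rule finite_not_islimpt_in_compact) (use not_islimpt_zeros_poles in auto)

lemma closed_zeros_poles: "closed (zeros_poles f)"
  using not_islimpt_zeros_poles by (auto simp: closed_limpt)

definition divisor_prod :: "complex set \<Rightarrow> complex \<Rightarrow> complex" where
  "divisor_prod A w = (\<Prod>a\<in>A. (w - a) powi zorder f a)"

text \<open>
  The function \<open>f\<close> with its zeros and poles in \<open>A\<close> divided out.  Removing singularities supplies its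
  values on \<open>A\<close>.
\<close>
definition strip :: "complex set \<Rightarrow> complex \<Rightarrow> complex" where
  "strip A = remove_sings (\<lambda>w. f w / divisor_prod A w)"

lemma divisor_prod_nonzero:
  assumes "finite A" "z \<notin> A \<inter> zeros_poles f"
  shows "divisor_prod A z \<noteq> 0"
proof -
  have "(z - a) powi zorder f a \<noteq> 0" if "a \<in> A" for a
    using assms that zorder_zero_iff[of a] by (cases "a = z") auto
  then show ?thesis
    using assms(1) by (simp add: divisor_prod_def)
qed

lemma divisor_prod_meromorphic: "divisor_prod A meromorphic_on B"
  unfolding divisor_prod_def by (intro meromorphic_intros)

lemma divisor_prod_analytic: "z \<notin> A \<inter> zeros_poles f \<Longrightarrow> divisor_prod A analytic_on {z}"
  unfolding divisor_prod_def
proof (rule analytic_on_prod)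
  fix a assume "a \<in> A" "z \<notin> A \<inter> zeros_poles f"
  then have "zorder f a = 0 \<or> z \<noteq> a" using zorder_zero_iff[of a] by auto
  then show "(\<lambda>w. (w - a) powi zorder f a) analytic_on {z}"
    by (auto intro!: analytic_intros)
qed

lemma eventually_divisor_prod_nonzero:
  assumes "finite A"
  shows "\<forall>\<^sub>F w in at z. divisor_prod A w \<noteq> 0"
  using eventually_not_in_finite[OF assms, of z] by eventually_elim (use assms divisor_prod_nonzero in blast)

lemma zorder_divisor_prod:
  assumes "finite A"
  shows "zorder (divisor_prod A) z = (if z \<in> A then zorder f z else 0)"
proof -
  have 1: "zorder (\<lambda>w. w - a) z = (if z = a then 1 else 0)" for a
  proof (cases "z = a")
    case True
    then show ?thesis
      by (auto intro!: zorder_eqI[of UNIV _ "\<lambda>_. 1"])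
  next
    case False
    then show ?thesis by (auto intro!: zorder_eq_0I analytic_intros)
  qed
  have "\<forall>\<^sub>F w in at z. w - a \<noteq> 0" for a
    using eventually_not_in_finite[of "{a}" z] by simp
  then have 2: "zorder (\<lambda>w. (w - a) powi zorder f a) z = (if z = a then zorder f a else 0)" for a
    by (subst zorder_power_int) (auto intro!: meromorphic_intros eventually_frequently simp: 1)
  have "zorder (divisor_prod A) z = (\<Sum>a\<in>A. zorder (\<lambda>w. (w - a) powi zorder f a) z)"
    unfolding divisor_prod_def
    by (rule zorder_prod)
      (use eventually_divisor_prod_nonzero[OF assms] in \<open>auto intro!: meromorphic_intros simp: divisor_prod_def\<close>)
  then show ?thesis using assms unfolding 2 by (simp add: sum.delta)
qed

lemma quotient_meromorphic: "(\<lambda>w. f w / divisor_prod A w) meromorphic_on B"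
  by (intro meromorphic_intros meromorphic divisor_prod_meromorphic)

lemma strip_nicely: "strip A nicely_meromorphic_on UNIV"
  unfolding strip_def by (intro remove_sings_nicely_meromorphic quotient_meromorphic)

lemma strip_eq:
  assumes "finite A" "f analytic_on {z}" "z \<notin> A \<inter> zeros_poles f"
  shows "f z = divisor_prod A z * strip A z"
proof -
  have "(\<lambda>w. f w / divisor_prod A w) analytic_on {z}"
    using assms divisor_prod_nonzero by (auto intro!: analytic_intros divisor_prod_analytic)
  then have "strip A z = f z / divisor_prod A z"
    unfolding strip_def by simp
  then show ?thesis using divisor_prod_nonzero assms by simp
qed

lemma eventually_strip_eq:
  assumes "finite A"
  shows "\<forall>\<^sub>F w in at z. f w = divisor_prod A w * strip A w \<and> strip A w \<noteq> 0 \<and> divisor_prod A w \<noteq> 0"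
  using eventually_nonzero[of z] eventually_divisor_prod_nonzero[OF assms, of z]
proof eventually_elim
  case (elim w)
  then have "f w = divisor_prod A w * strip A w" 
    using assms zeros_poles_iff by (intro strip_eq analytic_off_zeros_poles) auto
  then show ?case using elim by auto
qed

text \<open>
  At a point of \<open>A\<close> the orders of \<open>f\<close> and of the product cancel; a meromorphic function of order \<open>0\<close>
  is analytic and does not vanish once its singularity is removed.
\<close>
lemma strip_analytic:
  assumes "finite A" "z \<in> A \<or> z \<notin> zeros_poles f"
  shows "strip A analytic_on {z}" "strip A z \<noteq> 0"
proof -
  have iso: "isolated_singularity_at (\<lambda>w. f w / divisor_prod A w) z"
    "not_essential (\<lambda>w. f w / divisor_prod A w) z"
    using quotient_meromorphic meromorphic_at_iff by blast+
  have ev: "\<exists>\<^sub>F w in at z. strip A w \<noteq> 0"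
    using eventually_strip_eq[OF assms(1), of z]
    by (intro eventually_frequently) (auto elim: eventually_mono)
  have "zorder (strip A) z = zorder (\<lambda>w. f w / divisor_prod A w) z"
    unfolding strip_def using iso by simp
  also have "\<dots> = zorder f z - zorder (divisor_prod A) z"
    using eventually_nonzero eventually_divisor_prod_nonzero[OF assms(1)]
    by (intro zorder_divide meromorphic divisor_prod_meromorphic eventually_frequently) auto
  also have "\<dots> = 0"
    using assms zorder_zero_iff by (auto simp: zorder_divisor_prod)
  finally have 0: "zorder (strip A) z = 0" .
  have "isolated_singularity_at (strip A) z"
    using strip_nicely meromorphic_on_isolated_singularity meromorphic_on_subset 
    unfolding nicely_meromorphic_on_def by blast
  then have "\<not> is_pole (strip A) z"
    using 0 isolated_pole_imp_neg_zorder by fastforce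
  then show *: "strip A analytic_on {z}"
    using nicely_meromorphic_on_imp_analytic_at[OF strip_nicely] by blast
  show "strip A z \<noteq> 0"
    using zorder_eq_0_iff[OF * ev] 0 by simp
qed

lemma strip_analytic_entire:
  assumes "finite A" "f analytic_on UNIV"
  shows "strip A analytic_on B"
proof -
  have "strip A analytic_on {z}" for z
  proof (cases "z \<in> A")
    case True
    then show ?thesis using strip_analytic assms by blast
  next
    case False
    have "(\<lambda>w. f w / divisor_prod A w) analytic_on {z}"
      using False assms divisor_prod_nonzero 
      by (auto intro!: analytic_intros divisor_prod_analytic intro: analytic_on_subset)
    then show ?thesis unfolding strip_def by (rule remove_sings_analytic_on)
  qed
  then show ?thesis using analytic_on_analytic_at by blast
qed

lemma has_derivative_divisor_prod:
  assumes "z \<notin> A \<inter> zeros_poles f"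
  shows "(divisor_prod A has_field_derivative divisor_prod A z * (\<Sum>a\<in>A. of_int (zorder f a) / (z - a))) (at z)"
proof -
  have "((\<lambda>w. (w - a) powi zorder f a) has_field_derivative
      (z - a) powi zorder f a * (of_int (zorder f a) / (z - a))) (at z)" if "a \<in> A" for a
  proof (cases "z = a")
    case False
    then have "((\<lambda>w. (w - a) powi zorder f a) has_field_derivative
      (z - a) powi zorder f a * (of_int (zorder f a) * (1 / (z - a)))) (at z)"
      by (intro has_field_derivative_powi_logarithmic) (auto intro!: derivative_eq_intros)
    then show ?thesis by simp
  next
    case True
    then have "zorder f a = 0" using assms that zorder_zero_iff by auto
    then show ?thesis by simp
  qed
  then show ?thesis
    unfolding divisor_prod_def by (rule has_field_derivative_prod_logarithmic)
qed

lemma logarithmic_derivative_strip: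
  assumes "finite A" "z \<notin> zeros_poles f"
  shows "deriv f z / f z = (\<Sum>a\<in>A. of_int (zorder f a) / (z - a)) + deriv (strip A) z / strip A z"
proof -
  have "((\<lambda>w. divisor_prod A w * strip A w) has_field_derivative
     divisor_prod A z * strip A z * ((\<Sum>a\<in>A. of_int (zorder f a) / (z - a)) + deriv (strip A) z / strip A z)) (at z)"
    using assms strip_analytic[OF assms(1), of z]
    by (auto intro!: derivative_eq_intros has_derivative_divisor_prod has_derivative_logarithmic simp: algebra_simps)
  moreover have ev: "\<forall>\<^sub>F w in nhds z. f w = divisor_prod A w * strip A w"
  proof -
    have "\<forall>\<^sub>F w in nhds z. w \<notin> zeros_poles f"
      using assms closed_zeros_poles eventually_nhds_in_open[of "- zeros_poles f" z] by auto
    then show ?thesis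
      by eventually_elim (use assms in \<open>auto intro: strip_eq analytic_off_zeros_poles\<close>)
  qed
  ultimately have "(f has_field_derivative
     divisor_prod A z * strip A z * ((\<Sum>a\<in>A. of_int (zorder f a) / (z - a)) + deriv (strip A) z / strip A z)) (at z)"
    using DERIV_cong_ev[OF refl ev refl] by blast
  moreover have "f z = divisor_prod A z * strip A z" "f z \<noteq> 0"
    using assms strip_eq analytic_off_zeros_poles zeros_poles_iff by auto
  ultimately show ?thesis by (simp add: DERIV_imp_deriv)
qed

text \<open>
  This makes the normalization at the origin independent of \<open>A\<close>: the constant \<open>strip {0} 0\<close> serves for all
  radii, both in the growth estimates and in the Hadamard product.
\<close>
lemma strip_at_base:
  assumes "finite A" "0 \<in> A"
  shows "strip {0} 0 = (\<Prod>a\<in>A - {0}. (- a) powi zorder f a) * strip A 0"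
proof -
  have ev: "\<forall>\<^sub>F w in at 0. strip {0} w = (\<Prod>a\<in>A - {0}. (w - a) powi zorder f a) * strip A w"
    using eventually_strip_eq[OF assms(1), of 0] eventually_strip_eq[of "{0}" 0, simplified]
    by eventually_elim (use assms in \<open>auto simp: divisor_prod_def prod.remove\<close>)
  have "((\<lambda>w. strip {0} w) \<longlongrightarrow> strip {0} 0) (at 0)"
    using strip_analytic[of "{0}" 0] analytic_at_imp_isCont isContD by blast
  then have "((\<lambda>w. (\<Prod>a\<in>A - {0}. (w - a) powi zorder f a) * strip A w) \<longlongrightarrow> strip {0} 0) (at 0)"
    using tendsto_cong[OF ev] by blast
  moreover have "((\<lambda>w. (\<Prod>a\<in>A - {0}. (w - a) powi zorder f a) * strip A w) \<longlongrightarrow>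
     (\<Prod>a\<in>A - {0}. (0 - a) powi zorder f a) * strip A 0) (at 0)"
    using strip_analytic[of A 0] assms analytic_at_imp_isCont isContD
    by (intro tendsto_intros) auto
  ultimately show ?thesis
    using tendsto_unique[OF at_neq_bot] by fastforce
qed

end

section \<open>Growth of entire functions and their logarithmic derivatives\<close>

text \<open>
  Borel-Caratheodory: \<open>p = log k - log (k 0)\<close> has real part less than \<open>B\<close>, so \<open>p / (2 B - p)\<close> maps the
  disc into the unit disc and fixes \<open>0\<close>, and Schwarz's lemma gives \<open>\<bar>p\<bar> \<le> 2 B\<close> on the disc of radius
  \<open>R / 2\<close>.  The polynomial \<open>T\<close> is the Taylor polynomial of the derivative of \<open>p\<close>, whose remainder is
  estimated by Cauchy's inequalities.
\<close>
lemma log_derivative_taylor_bound: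
  assumes R: "R > 0" and B: "B > 0" and hol: "k holomorphic_on ball 0 R"
    and nonz: "\<And>z. z \<in> ball 0 R \<Longrightarrow> k z \<noteq> 0"
    and bd: "\<And>z. z \<in> ball 0 R \<Longrightarrow> norm (k z) < norm (k 0) * exp B"
  obtains T :: "complex poly" where "\<And>j. M \<le> j \<Longrightarrow> coeff T j = 0"
    "\<And>z. norm z \<le> R / 8 \<Longrightarrow> norm (deriv k z / k z - poly T z) \<le> 8 * B / R * (4 * norm z / R) ^ M"
proof -
  have "contractible (ball (0::complex) R)"
    by (intro convex_imp_contractible) auto
  then obtain g where g: "g holomorphic_on ball 0 R" "\<And>z. z \<in> ball 0 R \<Longrightarrow> k z = exp (g z)"
    using contractible_imp_holomorphic_log[OF hol _ nonz] by blast
  define p where "p z = g z - g 0" for z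
  have p: "p holomorphic_on ball 0 R" "p 0 = 0"
    unfolding p_def by (auto intro!: holomorphic_intros g)
  have Re_p: "Re (p z) < B" if "z \<in> ball 0 R" for z
  proof -
    have "exp (Re (g z)) < exp (Re (g 0)) * exp B"
      using bd[OF that] g(2)[OF that] g(2)[of 0] R by simp
    then show ?thesis
      by (simp add: p_def flip: exp_add)
  qed
  have sq: "norm (p z) < norm (2 * of_real B - p z)" if "z \<in> ball 0 R" for z
  proof -
    have "B * Re (p z) < B * B"
      using Re_p[OF that] B by (intro mult_strict_left_mono)
    moreover have "(2 * B - Re (p z))\<^sup>2 = 4 * (B * B) - 4 * (B * Re (p z)) + (Re (p z))\<^sup>2"
      by (simp add: power2_eq_square left_diff_distrib right_diff_distrib)
    moreover have "(norm (2 * of_real B - p z))\<^sup>2 = (2 * B - Re (p z))\<^sup>2 + (Im (p z))\<^sup>2"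
      by (simp add: cmod_power2)
    moreover have "(norm (p z))\<^sup>2 = (Re (p z))\<^sup>2 + (Im (p z))\<^sup>2"
      by (rule cmod_power2)
    ultimately have "(norm (p z))\<^sup>2 < (norm (2 * of_real B - p z))\<^sup>2"
      by linarith
    then show ?thesis by (rule power2_less_imp_less) simp
  qed
  \<comment> \<open>Schwarz's lemma, after rescaling the disc to radius \<open>1\<close>\<close>
  have p_le: "norm (p z) \<le> 2 * B" if z: "norm z \<le> R / 2" for z
  proof -
    define u where "u w = p (of_real R * w) / (2 * of_real B - p (of_real R * w))" for w
    have in_ball: "of_real R * w \<in> ball 0 R" if "w \<in> ball 0 1" for w :: complex
      using that R by (simp add: norm_mult)
    have den: "2 * of_real B - p w \<noteq> 0" if "w \<in> ball 0 R" for w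
      using sq[OF that] by auto
    have "norm (u (z / of_real R)) \<le> norm (z / of_real R)"
    proof (rule Schwarz_Lemma(1))
      have "(p \<circ> (\<lambda>w. of_real R * w)) holomorphic_on ball 0 1"
        using in_ball by (intro holomorphic_on_compose_gen[OF _ p(1)] holomorphic_intros) auto
      then show "u holomorphic_on ball 0 1"
        unfolding u_def using den in_ball by (auto intro!: holomorphic_intros simp: o_def)
      show "u 0 = 0" using p by (simp add: u_def)
      show "norm (u w) < 1" if "norm w < 1" for w
        using sq[OF in_ball] den[OF in_ball] that by (simp add: u_def norm_divide)
      show "norm (z / of_real R) < 1" using z R by (simp add: norm_divide)
    qed
    then have *: "norm (p z) / norm (2 * of_real B - p z) \<le> norm z / R"
      using R by (simp add: u_def norm_divide)
    also have "\<dots> \<le> 1 / 2" using z R by (simp add: field_simps)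
    finally have "norm (p z) \<le> norm (2 * of_real B - p z) / 2"
      using den[of z] z R by (simp add: field_simps)
    also have "\<dots> \<le> (2 * B + norm (p z)) / 2"
      using norm_triangle_ineq4[of "2 * of_real B" "p z"] B by (simp add: norm_mult)
    finally show ?thesis by simp
  qed
  have coeff_le: "norm ((deriv ^^ n) p 0) \<le> fact n * (2 * B) / (R / 2) ^ n" for n
  proof (rule Cauchy_inequality)
    show "p holomorphic_on ball 0 (R / 2)"
      using R by (intro holomorphic_on_subset[OF p(1)]) auto
    show "continuous_on (cball 0 (R / 2)) p"
      using R by (intro continuous_on_subset[OF holomorphic_on_imp_continuous_on[OF p(1)]]) auto
  qed (use R p_le in auto)
  define c where "c n = (deriv ^^ n) (deriv p) 0 / fact n" for n
  have c_le: "norm (c n) \<le> 4 * B / R * (4 / R) ^ n" for n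
  proof -
    have "norm (c n) \<le> fact (Suc n) * (2 * B) / (R / 2) ^ Suc n / fact n"
      using divide_right_mono[OF coeff_le[of "Suc n"], of "fact n"]
      unfolding c_def by (simp only: norm_divide funpow_Suc_right o_def norm_fact fact_ge_zero)
    also have "\<dots> = of_nat (Suc n) * (4 * B / R * (2 / R) ^ n)"
      using R by (simp add: field_simps)
    also have "\<dots> \<le> 2 ^ n * (4 * B / R * (2 / R) ^ n)"
    proof (intro mult_right_mono)
      show "real (Suc n) \<le> 2 ^ n" using of_nat_mono[OF Suc_leI[OF less_exp[of n]], where 'a = real] by simp
    qed (use R B in auto)
    also have "\<dots> = 4 * B / R * (4 / R) ^ n"
      by (simp add: power_divide flip: power_mult_distrib)
    finally show ?thesis .
  qed
  define T where "T = (\<Sum>n<M. monom (c n) n)"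
  show ?thesis
  proof (rule that[of T])
    show "coeff T j = 0" if "M \<le> j" for j
      using that by (simp add: T_def coeff_sum)
    fix z :: complex assume z: "norm z \<le> R / 8"
    then have zb: "z \<in> ball 0 R" using R by simp
    have dp: "deriv p z = deriv k z / k z"
    proof -
      have "(p has_field_derivative deriv g z) (at z)"
        unfolding p_def using holomorphic_derivI[OF g(1) _ zb] by (auto intro!: derivative_eq_intros)
      moreover have "((\<lambda>z. exp (g z)) has_field_derivative exp (g z) * deriv g z) (at z)"
        using holomorphic_derivI[OF g(1) _ zb] by (auto intro!: derivative_eq_intros)
      then have "(k has_field_derivative exp (g z) * deriv g z) (at z)"
        by (rule has_field_derivative_transform_within_open[of _ _ _ "ball 0 R"]) (use zb g in auto)
      ultimately show ?thesis using g(2)[OF zb] by (simp add: DERIV_imp_deriv)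
    qed
    have "(\<lambda>n. c n * z ^ n) sums deriv p z"
      using holomorphic_power_series[of "deriv p" 0 R z] zb p(1) by (simp add: c_def holomorphic_deriv)
    then have ser: "(\<lambda>n. c (n + M) * z ^ (n + M)) sums (deriv p z - poly T z)"
      using sums_split_initial_segment[of _ _ M] by (simp add: T_def poly_sum poly_monom)
    define q where "q = 4 * norm z / R"
    have q: "0 \<le> q" "q \<le> 1 / 2" using z R by (auto simp: q_def field_simps)
    have geo: "(\<lambda>n. 4 * B / R * q ^ M * q ^ n) sums (4 * B / R * q ^ M * (1 / (1 - q)))"
      using q by (intro sums_mult geometric_sums) auto
    have tail: "norm (c (n + M) * z ^ (n + M)) \<le> 4 * B / R * q ^ M * q ^ n" for n
    proof -
      have "norm (c (n + M) * z ^ (n + M)) \<le> (4 * B / R * (4 / R) ^ (n + M)) * norm z ^ (n + M)"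
        unfolding norm_mult norm_power by (intro mult_right_mono c_le) auto
      also have "\<dots> = 4 * B / R * q ^ (n + M)"
        unfolding q_def by (simp add: power_divide power_mult_distrib)
      finally show ?thesis by (simp add: power_add algebra_simps)
    qed
    have "norm (deriv k z / k z - poly T z) \<le> 4 * B / R * q ^ M * (1 / (1 - q))"
      unfolding dp[symmetric] by (rule norm_sums_le[OF ser geo tail])
    also have "\<dots> \<le> 4 * B / R * q ^ M * 2"
      using q R B by (intro mult_left_mono) (auto simp: field_simps)
    finally show "norm (deriv k z / k z - poly T z) \<le> 8 * B / R * (4 * norm z / R) ^ M"
      by (simp add: q_def)
  qed
qed

context nonzero_meromorphic
begin

lemma zorder_nonneg: "f analytic_on UNIV \<Longrightarrow> zorder f z \<ge> 0"
  by (intro zorder_ge_0 eventually_frequently eventually_nonzero) (auto intro: analytic_on_subset)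

text \<open>
  On the circle of radius \<open>3 * R\<close> a point has distance at least \<open>2 * R\<close>, hence at least twice the modulus
  of \<open>a\<close>, from each \<open>a\<close> in \<open>A\<close>.  So dividing out the zeros gains a factor \<open>2\<close> for each of them.  The
  maximum principle carries the bound into the disc; at the origin it is a bound for the number of
  zeros, which replaces Jensen's formula.
\<close>
lemma strip_growth:
  assumes ana: "f analytic_on UNIV" and R: "R \<ge> 1" and A: "finite A" "0 \<in> A" "A \<subseteq> cball 0 R"
    and bound: "\<And>z. norm z = 3 * R \<Longrightarrow> norm (f z) \<le> exp B"
    and z: "norm z \<le> 3 * R"
  shows "norm (strip A z) * 2 powr (\<Sum>a\<in>A - {0}. of_int (zorder f a)) * norm (strip {0} 0)
    \<le> norm (strip A 0) * exp B"
proof -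
  define N where "N = (\<Sum>a\<in>A - {0}. real_of_int (zorder f a))"
  have s0: "norm (strip {0} 0) > 0" "norm (strip A 0) > 0"
    using strip_analytic[of "{0}" 0] strip_analytic[of A 0] A by auto
  have "norm (strip A z) \<le> exp B * norm (strip A 0) / (2 powr N * norm (strip {0} 0))"
  proof (rule maximum_modulus_frontier[of "strip A" "cball 0 (3 * R)"])
    have entire: "strip A holomorphic_on UNIV"
      using strip_analytic_entire[OF A(1) ana] analytic_imp_holomorphic by blast
    show "strip A holomorphic_on interior (cball 0 (3 * R))"
      by (rule holomorphic_on_subset[OF entire]) simp
    show "continuous_on (closure (cball 0 (3 * R))) (strip A)"
      by (rule continuous_on_subset[OF holomorphic_on_imp_continuous_on[OF entire]]) simp
    fix w :: complex assume "w \<in> frontier (cball 0 (3 * R))"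
    then have w: "norm w = 3 * R" using R by simp
    have far: "norm (w - a) \<ge> 2 * norm a" if "a \<in> A" for a
      using norm_triangle_ineq2[of w a] that A(3) w by auto
    have wA: "w \<notin> A" using A(3) w R by auto
    have "f w = divisor_prod A w * strip A w"
      using ana wA A by (intro strip_eq) (auto intro: analytic_on_subset)
    then have eq: "norm (divisor_prod A w) * norm (strip A w) \<le> exp B"
      using bound[OF w] by (simp add: norm_mult)
    have "2 powr N * norm (strip {0} 0) = 2 powr N * (\<Prod>a\<in>A - {0}. norm a powi zorder f a) * norm (strip A 0)"
      using strip_at_base[OF A(1,2)] by (simp add: norm_mult norm_power_int flip: prod_norm)
    also have "2 powr N * (\<Prod>a\<in>A - {0}. norm a powi zorder f a) = (\<Prod>a\<in>A - {0}. (2 * norm a) powi zorder f a)"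
      unfolding N_def using A by (subst powr_sum) (auto simp: prod.distrib[symmetric] power_int_mult_distrib powr_real_of_int')
    also have "\<dots> \<le> (\<Prod>a\<in>A - {0}. norm (w - a) powi zorder f a)"
    proof (intro prod_mono conjI)
      fix a assume a: "a \<in> A - {0}"
      show "(2 * norm a) powi zorder f a \<le> norm (w - a) powi zorder f a"
        using power_mono[OF far[of a], of "nat (zorder f a)"] zorder_nonneg[OF ana, of a] a
        by (simp add: power_int_def)
    qed auto
    also have "\<dots> \<le> norm w powi zorder f 0 * (\<Prod>a\<in>A - {0}. norm (w - a) powi zorder f a)"
    proof -
      have "1 \<le> norm w ^ nat (zorder f 0)" using w R by (intro one_le_power) auto
      then have "1 \<le> norm w powi zorder f 0" using zorder_nonneg[OF ana] by (simp add: power_int_def)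
      then have "1 * (\<Prod>a\<in>A - {0}. norm (w - a) powi zorder f a) \<le> norm w powi zorder f 0 * (\<Prod>a\<in>A - {0}. norm (w - a) powi zorder f a)"
        by (rule mult_right_mono) (auto intro!: prod_nonneg)
      then show ?thesis by simp
    qed
    also have "\<dots> = norm (divisor_prod A w)"
      using prod.remove[OF A(1,2), of "\<lambda>a. (w - a) powi zorder f a"] by (simp add: divisor_prod_def norm_power_int norm_mult flip: prod_norm)
    finally have low: "2 powr N * norm (strip {0} 0) \<le> norm (divisor_prod A w) * norm (strip A 0)"
      using s0 by (simp add: mult_right_mono)
    have "2 powr N * norm (strip {0} 0) * norm (strip A w)
        \<le> norm (divisor_prod A w) * norm (strip A w) * norm (strip A 0)"
      using mult_right_mono[OF low, of "norm (strip A w)"] by (simp add: mult_ac)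
    also have "\<dots> \<le> exp B * norm (strip A 0)"
      using eq by (rule mult_right_mono) simp
    finally show "norm (strip A w) \<le> exp B * norm (strip A 0) / (2 powr N * norm (strip {0} 0))"
      using s0 by (simp add: field_simps)
  qed (use z in auto)
  then show ?thesis
    using s0 by (simp add: N_def field_simps)
qed

text \<open>
  Here \<open>strip_growth\<close> is read in two ways: at \<open>z = 0\<close> it counts zeros, and at a general point, after dropping the
  power of \<open>2\<close>, it bounds the stripped function.
\<close>
lemma entire_strip_estimates:
  assumes ana: "f analytic_on UNIV" and m: "m \<ge> 1"
    and growth: "\<And>z. norm z \<ge> r \<Longrightarrow> norm (f z) \<le> exp (norm z ^ m)"
  obtains K where "K > 0"
    "\<And>R A. R \<ge> max 1 r \<Longrightarrow> finite A \<Longrightarrow> 0 \<in> A \<Longrightarrow> A \<subseteq> cball 0 R \<Longrightarrow>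
       (\<Sum>a\<in>A - {0}. of_int (zorder f a)) \<le> K * R ^ m"
    "\<And>R A z. R \<ge> max 1 r \<Longrightarrow> finite A \<Longrightarrow> 0 \<in> A \<Longrightarrow> A \<subseteq> cball 0 R \<Longrightarrow> norm z \<le> 3 * R \<Longrightarrow>
       norm (strip A z) < norm (strip A 0) * exp (K * R ^ m)"
proof -
  define s0 where "s0 = norm (strip {0} 0)"
  have s0: "s0 > 0" using strip_analytic[of "{0}" 0] by (simp add: s0_def)
  \<comment> \<open>The factor \<open>2\<close> absorbs \<open>1 / ln 2\<close> in the count of the zeros; the last summand makes the bound strict.\<close>
  define K where "K = 2 * (3 ^ m + \<bar>ln s0\<bar> + 1)"
  have K: "K \<ge> 2" unfolding K_def by simp
  have N_nonneg: "(\<Sum>a\<in>A - {0}. real_of_int (zorder f a)) \<ge> 0" for A :: "complex set"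
    using zorder_nonneg[OF ana] by (intro sum_nonneg) simp
  have main: "norm (strip A z) * 2 powr (\<Sum>a\<in>A - {0}. of_int (zorder f a)) < norm (strip A 0) * exp (K / 2 * R ^ m)"
    if A: "R \<ge> max 1 r" "finite A" "0 \<in> A" "A \<subseteq> cball 0 R" "norm z \<le> 3 * R" for A R and z :: complex
  proof -
    have sA: "norm (strip A 0) > 0" using strip_analytic(2)[of A 0] A by simp
    have "norm (f z) \<le> exp ((3 * R) ^ m)" if "norm z = 3 * R" for z
      using growth[of z] that A by simp
    then have "norm (strip A z) * 2 powr (\<Sum>a\<in>A - {0}. of_int (zorder f a)) * s0 \<le> norm (strip A 0) * exp ((3 * R) ^ m)"
      unfolding s0_def using A by (intro strip_growth[OF ana, of R]) auto
    then have "norm (strip A z) * 2 powr (\<Sum>a\<in>A - {0}. of_int (zorder f a)) \<le> norm (strip A 0) * (exp ((3 * R) ^ m) / s0)"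
      using s0 by (simp add: field_simps)
    also have "exp ((3 * R) ^ m) / s0 = exp ((3 * R) ^ m - ln s0)"
      using s0 by (simp add: exp_diff)
    also have "norm (strip A 0) * \<dots> < norm (strip A 0) * exp (K / 2 * R ^ m)"
    proof (intro mult_strict_left_mono sA)
      have "1 \<le> R ^ m" using A by (intro one_le_power) auto
      then have "(\<bar>ln s0\<bar> + 1) * 1 \<le> (\<bar>ln s0\<bar> + 1) * R ^ m"
        by (intro mult_left_mono) auto
      then have "(3 * R) ^ m - ln s0 < K / 2 * R ^ m"
        by (simp add: K_def power_mult_distrib distrib_right)
      then show "exp ((3 * R) ^ m - ln s0) < exp (K / 2 * R ^ m)" by simp
    qed
    finally show ?thesis .
  qed
  show ?thesis
  proof (rule that[of K])
    show "K > 0" using K by simp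
  next
    fix R and A :: "complex set" assume A: "R \<ge> max 1 r" "finite A" "0 \<in> A" "A \<subseteq> cball 0 R"
    define N where "N = (\<Sum>a\<in>A - {0}. real_of_int (zorder f a))"
    have sA: "norm (strip A 0) > 0" using strip_analytic(2)[of A 0] A by simp
    have "norm (strip A 0) * 2 powr N < norm (strip A 0) * exp (K / 2 * R ^ m)"
      using main[OF A, of 0] A unfolding N_def by simp
    then have "exp (N * ln 2) < exp (K / 2 * R ^ m)"
      using sA by (simp add: powr_def)
    then have "N * ln 2 < K / 2 * R ^ m" by simp
    moreover have "N * (1/2) \<le> N * ln 2"
      using ln2_ge_two_thirds N_nonneg[of A] unfolding N_def by (intro mult_left_mono) auto
    ultimately show "N \<le> K * R ^ m" by simp
  next
    fix R and z :: complex and A :: "complex set" assume A: "R \<ge> max 1 r" "finite A" "0 \<in> A" "A \<subseteq> cball 0 R" "norm z \<le> 3 * R"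
    have "norm (strip A z) * 1 \<le> norm (strip A z) * 2 powr (\<Sum>a\<in>A - {0}. of_int (zorder f a))"
      using N_nonneg[of A] by (intro mult_left_mono ge_one_powr_ge_zero) auto
    also note main[OF A]
    also have "norm (strip A 0) * exp (K / 2 * R ^ m) \<le> norm (strip A 0) * exp (K * R ^ m)"
      using A K by (intro mult_left_mono) auto
    finally show "norm (strip A z) < norm (strip A 0) * exp (K * R ^ m)" by simp
  qed
qed

text \<open>
  For \<open>R = n\<close> the error of the Taylor polynomial is of the size \<open>n ^ m / n * (1 / n) ^ m\<close>.  Therefore
  polynomials of degree less than \<open>m\<close>, the exponent of the growth, suffice.
\<close>
lemma entire_log_derivative_polynomials:
  assumes ana: "f analytic_on UNIV" and m: "m \<ge> 1"
    and growth: "\<And>z. norm z \<ge> r \<Longrightarrow> norm (f z) \<le> exp (norm z ^ m)"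
    and A: "\<And>n. finite (A n)" "\<And>n. 0 \<in> A n" "\<And>n. A n \<subseteq> cball 0 (real n)"
       "\<And>n. zeros_poles f \<inter> cball 0 (real n) \<subseteq> A n"
  obtains T :: "nat \<Rightarrow> complex poly"
    where "\<And>n j. m \<le> j \<Longrightarrow> coeff (T n) j = 0"
    "\<And>z. (\<lambda>n. deriv (strip (A n)) z / strip (A n) z - poly (T n) z) \<longlonglongrightarrow> 0"
proof -
  obtain K where K: "K > 0" "\<And>R A. R \<ge> max 1 r \<Longrightarrow> finite A \<Longrightarrow> 0 \<in> A \<Longrightarrow> A \<subseteq> cball 0 R \<Longrightarrow>
       (\<Sum>a\<in>A - {0}. of_int (zorder f a)) \<le> K * R ^ m"
    "\<And>R A z. R \<ge> max 1 r \<Longrightarrow> finite A \<Longrightarrow> 0 \<in> A \<Longrightarrow> A \<subseteq> cball 0 R \<Longrightarrow> norm z \<le> 3 * R \<Longrightarrow>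
       norm (strip A z) < norm (strip A 0) * exp (K * R ^ m)"
    using entire_strip_estimates[OF ana m growth] by blast
  define approx where "approx n T \<longleftrightarrow> (\<forall>j\<ge>m. coeff T j = 0) \<and>
      (real n \<ge> max 1 r \<longrightarrow> (\<forall>z. norm z \<le> real n / 8 \<longrightarrow> norm (deriv (strip (A n)) z / strip (A n) z - poly T z)
             \<le> 8 * (K * real n ^ m) / real n * (4 * norm z / real n) ^ m))" for n :: nat and T
  have "\<exists>T. approx n T" for n
  proof (cases "real n \<ge> max 1 r")
    case True
    obtain T :: "complex poly" where T: "\<And>j. m \<le> j \<Longrightarrow> coeff T j = 0"
      "\<And>z. norm z \<le> real n / 8 \<Longrightarrow> norm (deriv (strip (A n)) z / strip (A n) z - poly T z)
             \<le> 8 * (K * real n ^ m) / real n * (4 * norm z / real n) ^ m"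
    proof (rule log_derivative_taylor_bound[of "real n" "K * real n ^ m" "strip (A n)" m])
      show "strip (A n) holomorphic_on ball 0 (real n)"
        by (intro analytic_imp_holomorphic strip_analytic_entire ana A)
      show "strip (A n) z \<noteq> 0" if "z \<in> ball 0 (real n)" for z
        using A(4)[of n] that by (intro strip_analytic A) auto
      show "norm (strip (A n) z) < norm (strip (A n) 0) * exp (K * real n ^ m)" if "z \<in> ball 0 (real n)" for z
        using True that by (intro K(3) A) auto
    qed (use True K(1) in auto)
    then show ?thesis unfolding approx_def by blast
  qed (auto simp: approx_def intro: exI[of _ 0])
  then obtain T where approx: "\<And>n. approx n (T n)"
    by metis
  show ?thesis
  proof (rule that[of T])
    show "coeff (T n) j = 0" if "m \<le> j" for n j
      using approx[of n] that unfolding approx_def by blast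
    fix z :: complex
    have "\<forall>\<^sub>F n in sequentially. real n \<ge> max (max 1 r) (8 * norm z)"
      using filterlim_real_sequentially unfolding filterlim_at_top by blast
    then have "\<forall>\<^sub>F n in sequentially. norm (deriv (strip (A n)) z / strip (A n) z - poly (T n) z) \<le> 8 * K * (4 * norm z) ^ m / real n"
    proof eventually_elim
      case (elim n)
      have "norm (deriv (strip (A n)) z / strip (A n) z - poly (T n) z) \<le> 8 * (K * n ^ m) / n * (4 * norm z / n) ^ m"
        using approx[of n] elim unfolding approx_def by auto
      also have "\<dots> = 8 * K * (4 * norm z) ^ m / real n"
        using elim by (simp add: power_divide)
      finally show ?case .
    qed
    moreover have "(\<lambda>n. 8 * K * (4 * norm z) ^ m / real n) \<longlonglongrightarrow> 0"
      by (rule lim_const_over_n)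
    ultimately show "(\<lambda>n. deriv (strip (A n)) z / strip (A n) z - poly (T n) z) \<longlonglongrightarrow> 0"
      by (rule Lim_null_comparison)
  qed
qed

end

section \<open>Quotients of entire functions of finite order\<close>
locale finite_order_quotient =
  f: nonzero_meromorphic f + g: nonzero_meromorphic g + h: nonzero_meromorphic h for f g h +
  fixes m :: nat and r :: real
  assumes m: "m \<ge> 1" and g_entire: "g analytic_on UNIV" and h_entire: "h analytic_on UNIV"
    and quotient: "\<And>z. h z \<noteq> 0 \<Longrightarrow> f z = g z / h z"
    and g_growth: "\<And>z. norm z \<ge> r \<Longrightarrow> norm (g z) \<le> exp (norm z ^ m)"
    and h_growth: "\<And>z. norm z \<ge> r \<Longrightarrow> norm (h z) \<le> exp (norm z ^ m)"
begin

lemma zorder_quotient: "zorder f a = zorder g a - zorder h a"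
proof -
  have "zorder f a = zorder (\<lambda>z. g z / h z) a"
    by (intro zorder_cong refl eventually_mono[OF h.eventually_nonzero[of a]] quotient)
  also have "\<dots> = zorder g a - zorder h a"
    by (intro zorder_divide g.meromorphic h.meromorphic eventually_frequently
        g.eventually_nonzero h.eventually_nonzero at_neq_bot)
  finally show ?thesis .
qed

lemma zeros_poles_subset: "zeros_poles f \<subseteq> zeros_poles g \<union> zeros_poles h"
proof
  fix z assume "z \<in> zeros_poles f"
  then have "h z \<noteq> 0 \<Longrightarrow> g z = 0"
    using quotient[of z] by (simp add: f.zeros_poles_iff)
  then show "z \<in> zeros_poles g \<union> zeros_poles h"
    by (auto simp: g.zeros_poles_iff h.zeros_poles_iff)
qed

text \<open>
  All three functions are stripped of the same set, so that common zeros of \<open>g\<close> and \<open>h\<close>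
  cancel.  The origin is included for \<open>strip_at_base\<close>.
\<close>
definition nodes :: "real \<Rightarrow> complex set" where
  "nodes R = insert 0 ((zeros_poles g \<union> zeros_poles h) \<inter> cball 0 R)"

lemma nodes: "finite (nodes R)" "0 \<in> nodes R" "R \<ge> 0 \<Longrightarrow> nodes R \<subseteq> cball 0 R"
  using g.finite_zeros_poles[of "cball 0 R"] h.finite_zeros_poles[of "cball 0 R"]
  by (auto simp: nodes_def Int_Un_distrib2)

lemma strip_quotient:
  assumes "norm z \<le> R"
  shows "f.strip (nodes R) z = g.strip (nodes R) z / h.strip (nodes R) z"
proof -
  let ?A = "nodes R"
  have z: "z \<in> ?A \<or> z \<notin> zeros_poles f" "z \<in> ?A \<or> z \<notin> zeros_poles g" "z \<in> ?A \<or> z \<notin> zeros_poles h"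
    using assms zeros_poles_subset by (auto simp: nodes_def)
  note an = f.strip_analytic[OF nodes(1) z(1)] g.strip_analytic[OF nodes(1) z(2)] h.strip_analytic[OF nodes(1) z(3)]
  have ev: "\<forall>\<^sub>F w in at z. f.strip ?A w = g.strip ?A w / h.strip ?A w"
    using f.eventually_strip_eq[OF nodes(1)[of R], where z = z] g.eventually_strip_eq[OF nodes(1)[of R], where z = z]
      h.eventually_strip_eq[OF nodes(1)[of R], where z = z] eventually_not_in_finite[OF nodes(1)[of R], where z = z]
  proof eventually_elim
    case (elim w)
    have dp: "f.divisor_prod ?A w = g.divisor_prod ?A w / h.divisor_prod ?A w"
      unfolding f.divisor_prod_def g.divisor_prod_def h.divisor_prod_def prod_dividef[symmetric]
    proof (rule prod.cong)
      fix a assume "a \<in> ?A"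
      then have "w - a \<noteq> 0" using elim(4) by auto
      then show "(w - a) powi zorder f a = (w - a) powi zorder g a / (w - a) powi zorder h a"
        by (simp add: zorder_quotient power_int_diff)
    qed simp
    have "f.strip ?A w = f w / f.divisor_prod ?A w"
      using elim(1) by (simp add: nonzero_eq_divide_eq mult.commute)
    also have "f w = (g.divisor_prod ?A w * g.strip ?A w) / (h.divisor_prod ?A w * h.strip ?A w)"
    proof -
      have "h w \<noteq> 0" using elim(3) by (metis mult_eq_0_iff)
      then show ?thesis using quotient[of w] elim(2,3) by metis
    qed
    also have "\<dots> / f.divisor_prod ?A w = g.strip ?A w / h.strip ?A w"
      unfolding dp using elim(2,3) by (simp only: divide_divide_times_eq times_divide_eq_left) (simp add: divide_simps)
    finally show ?case .
  qed
  have "f.strip ?A \<midarrow>z\<rightarrow> f.strip ?A z"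
    by (rule isContD[OF analytic_at_imp_isCont[OF an(1)]])
  then have "(\<lambda>w. g.strip ?A w / h.strip ?A w) \<midarrow>z\<rightarrow> f.strip ?A z"
    using tendsto_cong[OF ev] by simp
  moreover have "(\<lambda>w. g.strip ?A w / h.strip ?A w) \<midarrow>z\<rightarrow> g.strip ?A z / h.strip ?A z"
    by (intro tendsto_divide isContD[OF analytic_at_imp_isCont] an)
  ultimately show ?thesis
    by (rule tendsto_unique[OF at_neq_bot])
qed

lemma log_derivative_strip_quotient:
  assumes "norm z < R"
  shows "deriv (f.strip (nodes R)) z / f.strip (nodes R) z =
     deriv (g.strip (nodes R)) z / g.strip (nodes R) z - deriv (h.strip (nodes R)) z / h.strip (nodes R) z"
proof -
  let ?A = "nodes R"
  have z: "z \<in> ?A \<or> z \<notin> zeros_poles g" "z \<in> ?A \<or> z \<notin> zeros_poles h"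
    using assms by (auto simp: nodes_def)
  note an = g.strip_analytic[OF nodes(1) z(1)] h.strip_analytic[OF nodes(1) z(2)]
  have "((\<lambda>w. g.strip ?A w / h.strip ?A w) has_field_derivative
     (g.strip ?A z / h.strip ?A z) * (deriv (g.strip ?A) z / g.strip ?A z - deriv (h.strip ?A) z / h.strip ?A z)) (at z)"
    using an has_derivative_logarithmic[OF an(1,2)] has_derivative_logarithmic[OF an(3,4)]
    by (auto intro!: derivative_eq_intros simp: field_simps)
  then have "(f.strip ?A has_field_derivative
     (g.strip ?A z / h.strip ?A z) * (deriv (g.strip ?A) z / g.strip ?A z - deriv (h.strip ?A) z / h.strip ?A z)) (at z)"
    by (rule has_field_derivative_transform_within_open[of _ _ _ "ball 0 R"])
      (use assms strip_quotient in auto)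
  then show ?thesis
    using an strip_quotient[of z R] assms by (simp add: DERIV_imp_deriv)
qed

text \<open>
  The polynomials for \<open>g\<close> and \<open>h\<close> are subtracted.  Nodes that are no zeros or poles of \<open>f\<close> have order \<open>0\<close>
  and drop out, so that the formula holds also at the common zeros of \<open>g\<close> and \<open>h\<close>.
\<close>
theorem log_derivative_limit:
  obtains T where "\<And>n j. m \<le> j \<Longrightarrow> coeff (T n) j = 0"
    "\<And>z. z \<notin> zeros_poles f \<Longrightarrow>
      (\<lambda>n. deriv f z / f z - (\<Sum>a\<in>zeros_poles f \<inter> cball 0 (real n). of_int (zorder f a) / (z - a)) - poly (T n) z) \<longlonglongrightarrow> 0"
proof -
  define A where "A n = nodes (real n)" for n
  have A: "finite (A n)" "0 \<in> A n" "A n \<subseteq> cball 0 (real n)" "zeros_poles g \<inter> cball 0 (real n) \<subseteq> A n"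
    "zeros_poles h \<inter> cball 0 (real n) \<subseteq> A n" "zeros_poles f \<inter> cball 0 (real n) \<subseteq> A n" for n
    using nodes[of "real n"] zeros_poles_subset by (auto simp: A_def nodes_def)
  obtain T1 where T1: "\<And>n j. m \<le> j \<Longrightarrow> coeff (T1 n) j = 0"
    "\<And>z. (\<lambda>n. deriv (g.strip (A n)) z / g.strip (A n) z - poly (T1 n) z) \<longlonglongrightarrow> 0"
    using g.entire_log_derivative_polynomials[OF g_entire m g_growth A(1,2,3) A(4)] by blast
  obtain T2 where T2: "\<And>n j. m \<le> j \<Longrightarrow> coeff (T2 n) j = 0"
    "\<And>z. (\<lambda>n. deriv (h.strip (A n)) z / h.strip (A n) z - poly (T2 n) z) \<longlonglongrightarrow> 0"
    using h.entire_log_derivative_polynomials[OF h_entire m h_growth A(1,2,3) A(5)] by blast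
  define T where "T n = T1 n - T2 n" for n
  show ?thesis
  proof (rule that[of T])
    show "coeff (T n) j = 0" if "m \<le> j" for n j
      using T1(1) T2(1) that by (simp add: T_def)
    fix z assume z: "z \<notin> zeros_poles f"
    have "(\<lambda>n. (deriv (g.strip (A n)) z / g.strip (A n) z - poly (T1 n) z)
        - (deriv (h.strip (A n)) z / h.strip (A n) z - poly (T2 n) z)) \<longlonglongrightarrow> 0 - 0"
      by (intro tendsto_diff T1(2) T2(2))
    moreover have "\<forall>\<^sub>F n in sequentially. real n > norm z"
      using filterlim_real_sequentially unfolding filterlim_at_top_dense by blast
    then have "\<forall>\<^sub>F n in sequentially. (deriv (g.strip (A n)) z / g.strip (A n) z - poly (T1 n) z)
        - (deriv (h.strip (A n)) z / h.strip (A n) z - poly (T2 n) z)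
        = deriv f z / f z - (\<Sum>a\<in>zeros_poles f \<inter> cball 0 (real n). of_int (zorder f a) / (z - a)) - poly (T n) z"
    proof eventually_elim
      case (elim n)
      have "(\<Sum>a\<in>zeros_poles f \<inter> cball 0 (real n). of_int (zorder f a) / (z - a))
          = (\<Sum>a\<in>A n. of_int (zorder f a) / (z - a))"
      proof (rule sum.mono_neutral_left)
        show "\<forall>i\<in>A n - zeros_poles f \<inter> cball 0 (real n). of_int (zorder f i) / (z - i) = 0"
          using A(3) f.zorder_zero_iff by fastforce
      qed (use A in auto)
      then show ?case
        using f.logarithmic_derivative_strip[OF A(1)[of n] z] log_derivative_strip_quotient[of z "real n"] elim
        by (simp add: A_def T_def)
    qed
    ultimately show "(\<lambda>n. deriv f z / f z - (\<Sum>a\<in>zeros_poles f \<inter> cball 0 (real n). of_int (zorder f a) / (z - a)) - poly (T n) z) \<longlonglongrightarrow> 0"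
      using Lim_transform_eventually by fastforce
  qed
qed

lemma divisor_count:
  obtains C where "C > 0" "\<And>R. R \<ge> 1 \<Longrightarrow> (\<Sum>a\<in>zeros_poles f \<inter> cball 0 R - {0}. \<bar>real_of_int (zorder f a)\<bar>) \<le> C * R ^ m"
proof -
  obtain K1 where K1: "K1 > 0" "\<And>R A. R \<ge> max 1 r \<Longrightarrow> finite A \<Longrightarrow> 0 \<in> A \<Longrightarrow> A \<subseteq> cball 0 R \<Longrightarrow>
       (\<Sum>a\<in>A - {0}. of_int (zorder g a)) \<le> K1 * R ^ m"
    "\<And>R A z. R \<ge> max 1 r \<Longrightarrow> finite A \<Longrightarrow> 0 \<in> A \<Longrightarrow> A \<subseteq> cball 0 R \<Longrightarrow> norm z \<le> 3 * R \<Longrightarrow>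
       norm (g.strip A z) < norm (g.strip A 0) * exp (K1 * R ^ m)"
    using g.entire_strip_estimates[OF g_entire m g_growth] by blast
  obtain K2 where K2: "K2 > 0" "\<And>R A. R \<ge> max 1 r \<Longrightarrow> finite A \<Longrightarrow> 0 \<in> A \<Longrightarrow> A \<subseteq> cball 0 R \<Longrightarrow>
       (\<Sum>a\<in>A - {0}. of_int (zorder h a)) \<le> K2 * R ^ m"
    "\<And>R A z. R \<ge> max 1 r \<Longrightarrow> finite A \<Longrightarrow> 0 \<in> A \<Longrightarrow> A \<subseteq> cball 0 R \<Longrightarrow> norm z \<le> 3 * R \<Longrightarrow>
       norm (h.strip A z) < norm (h.strip A 0) * exp (K2 * R ^ m)"
    using h.entire_strip_estimates[OF h_entire m h_growth] by blast
  define n where "n R = (\<Sum>a\<in>zeros_poles f \<inter> cball 0 R - {0}. \<bar>real_of_int (zorder f a)\<bar>)" for R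
  define R0 where "R0 = max 1 r"
  have fin: "finite (zeros_poles f \<inter> cball 0 R - {0})" for R
    using f.finite_zeros_poles[of "cball 0 R"] by simp
  have large: "n R \<le> (K1 + K2) * R ^ m" if R: "R \<ge> R0" for R
  proof -
    have "n R \<le> (\<Sum>a\<in>nodes R - {0}. \<bar>real_of_int (zorder f a)\<bar>)"
      unfolding n_def using nodes[of R] zeros_poles_subset
      by (intro sum_mono2) (auto simp: nodes_def)
    also have "\<dots> \<le> (\<Sum>a\<in>nodes R - {0}. real_of_int (zorder g a) + real_of_int (zorder h a))"
    proof (rule sum_mono)
      fix a
      show "\<bar>real_of_int (zorder f a)\<bar> \<le> real_of_int (zorder g a) + real_of_int (zorder h a)"
        using g.zorder_nonneg[OF g_entire, of a] h.zorder_nonneg[OF h_entire, of a] zorder_quotient[of a] by linarith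
    qed
    also have "\<dots> \<le> K1 * R ^ m + K2 * R ^ m"
      unfolding sum.distrib using nodes[of R] R by (intro add_mono K1(2) K2(2)) (auto simp: R0_def)
    finally show ?thesis by (simp add: distrib_right)
  qed
  show ?thesis
  proof (rule that[of "(K1 + K2) * R0 ^ m"])
    have R0: "R0 \<ge> 1" by (simp add: R0_def)
    then show "(K1 + K2) * R0 ^ m > 0" using K1(1) K2(1) by auto
    fix R :: real assume R: "R \<ge> 1"
    have "n R \<le> (K1 + K2) * max R R0 ^ m"
    proof -
      have "n R \<le> n (max R R0)"
        unfolding n_def by (intro sum_mono2 fin) auto
      then show ?thesis using large[of "max R R0"] by simp
    qed
    also have "(K1 + K2) * max R R0 ^ m \<le> (K1 + K2) * (R0 * R) ^ m"
    proof (rule mult_left_mono)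
      show "max R R0 ^ m \<le> (R0 * R) ^ m"
    proof (rule power_mono)
      have "1 * R \<le> R0 * R" "R0 * 1 \<le> R0 * R"
        using R R0 by (intro mult_right_mono mult_left_mono; simp)+
      then show "max R R0 \<le> R0 * R" by simp
    qed (use R in auto)
    qed (use K1(1) K2(1) in simp)
    finally show "(\<Sum>a\<in>zeros_poles f \<inter> cball 0 R - {0}. \<bar>real_of_int (zorder f a)\<bar>) \<le> (K1 + K2) * R0 ^ m * R ^ m"
      by (simp add: n_def power_mult_distrib mult.assoc)
  qed
qed

text \<open>
  Sum over the shells \<open>y \<le> norm \<rho> < y + 1\<close>.  The shell of \<open>y\<close> has mass at most \<open>C * (2 * y) ^ m\<close>, so the
  exponent \<open>m + 2\<close> leaves the convergent series of \<open>1 / y\<^sup>2\<close>.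
\<close>
lemma divisor_power_summable:
  "(\<lambda>\<rho>. \<bar>real_of_int (zorder f \<rho>)\<bar> / norm \<rho> ^ (m + 2)) summable_on (zeros_poles f - {0})"
proof -
  obtain C where C: "C > 0"
    "\<And>R. R \<ge> 1 \<Longrightarrow> (\<Sum>a\<in>zeros_poles f \<inter> cball 0 R - {0}. \<bar>real_of_int (zorder f a)\<bar>) \<le> C * R ^ m"
    using divisor_count by blast
  define w where "w \<rho> = \<bar>real_of_int (zorder f \<rho>)\<bar> / norm \<rho> ^ (m + 2)" for \<rho>
  have fin: "finite (zeros_poles f \<inter> cball 0 R - {0})" for R
    using f.finite_zeros_poles[of "cball 0 R"] by simp
  define far where "far = zeros_poles f - cball 0 1"
  have summ: "summable (\<lambda>n. inverse (real n ^ 2))"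
    by (rule inverse_power_summable) simp
  have "sum w F \<le> C * 2 ^ m * (\<Sum>n. inverse (real n ^ 2))" if F: "F \<subseteq> far" "finite F" for F
  proof -
    define j where "j a = nat \<lfloor>norm a\<rfloor>" for a :: complex
    have j: "1 \<le> j a" "real (j a) \<le> norm a" "norm a \<le> real (j a) + 1" if "a \<in> F" for a
    proof -
      have "norm a > 1" using that F(1) by (auto simp: far_def)
      then show "1 \<le> j a" "real (j a) \<le> norm a" "norm a \<le> real (j a) + 1"
        unfolding j_def by linarith+
    qed
    have shell: "sum w {a \<in> F. j a = y} \<le> C * 2 ^ m * inverse (real y ^ 2)" if y: "y \<ge> 1" for y
    proof -
      have "sum w {a \<in> F. j a = y} \<le> (\<Sum>a\<in>{a \<in> F. j a = y}. \<bar>real_of_int (zorder f a)\<bar> / real y ^ (m + 2))"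
        unfolding w_def using j y by (intro sum_mono divide_left_mono power_mono mult_pos_pos zero_less_power) force+
      also have "\<dots> = (\<Sum>a\<in>{a \<in> F. j a = y}. \<bar>real_of_int (zorder f a)\<bar>) / real y ^ (m + 2)"
        by (simp add: sum_divide_distrib)
      also have "\<dots> \<le> (C * (real y + 1) ^ m) / real y ^ (m + 2)"
      proof (rule divide_right_mono)
        have "(\<Sum>a\<in>{a \<in> F. j a = y}. \<bar>real_of_int (zorder f a)\<bar>)
            \<le> (\<Sum>a\<in>zeros_poles f \<inter> cball 0 (real y + 1) - {0}. \<bar>real_of_int (zorder f a)\<bar>)"
          using F j by (intro sum_mono2 fin) (auto simp: far_def)
        also have "\<dots> \<le> C * (real y + 1) ^ m" by (rule C(2)) simp
        finally show "(\<Sum>a\<in>{a \<in> F. j a = y}. \<bar>real_of_int (zorder f a)\<bar>) \<le> C * (real y + 1) ^ m" .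
      qed simp
      also have "\<dots> \<le> (C * (2 * real y) ^ m) / real y ^ (m + 2)"
        using C(1) y by (intro divide_right_mono mult_left_mono power_mono) auto
      also have "\<dots> = C * 2 ^ m * inverse (real y ^ 2)"
        using y by (simp add: power_mult_distrib power_add field_simps power2_eq_square)
      finally show ?thesis .
    qed
    have "sum w F = (\<Sum>y\<in>j ` F. sum w {a \<in> F. j a = y})"
      by (rule sum.image_gen[OF F(2)])
    also have "\<dots> \<le> (\<Sum>y\<in>j ` F. C * 2 ^ m * inverse (real y ^ 2))"
      using j(1) by (intro sum_mono shell) auto
    also have "\<dots> = C * 2 ^ m * (\<Sum>y\<in>j ` F. inverse (real y ^ 2))"
      by (rule sum_distrib_left[symmetric])
    also have "\<dots> \<le> C * 2 ^ m * (\<Sum>n. inverse (real n ^ 2))"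
      using C(1) F(2) by (intro mult_left_mono sum_le_suminf summ) auto
    finally show ?thesis .
  qed
  then have "w summable_on far"
    by (intro nonneg_bdd_above_summable_on bdd_aboveI2) (auto simp: w_def)
  then have "w summable_on ((zeros_poles f \<inter> cball 0 1 - {0}) \<union> far)"
    using fin by (intro summable_on_Un_disjoint) (auto simp: far_def)
  also have "(zeros_poles f \<inter> cball 0 1 - {0}) \<union> far = zeros_poles f - {0}"
    by (auto simp: far_def)
  finally show ?thesis unfolding w_def .
qed

lemma convergence_exponent_summable:
  "(\<lambda>\<rho>. \<bar>real_of_int (zorder f \<rho>)\<bar> / norm \<rho> ^ convergence_exponent f) summable_on (zeros_poles f - {0})"
  unfolding convergence_exponent_def by (rule LeastI[of _ "m + 2"]) (rule divisor_power_summable)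

end

section \<open>Partial fractions with an arbitrary base point\<close>

text \<open>
  The geometric sum in \<open>(z - b) / (a - b)\<close>.  It shows that the convergence factors of the partial fraction
  series change each summand by a polynomial only.
\<close>
lemma telescoping_quotient:
  fixes a b z :: complex
  assumes "a \<noteq> b" "z \<noteq> a"
  shows "((z - b) / (a - b)) ^ N / (z - a) - 1 / (z - a) = (\<Sum>j<N. (z - b) ^ j / (a - b) ^ (j + 1))"
proof -
  define w where "w = (z - b) / (a - b)"
  have za: "z - a = (a - b) * (w - 1)" using assms by (simp add: w_def field_simps)
  have "w \<noteq> 1" using assms by (auto simp: w_def)
  have "w ^ N / (z - a) - 1 / (z - a) = (w ^ N - 1) / (z - a)" by (simp add: diff_divide_distrib)
  also have "\<dots> = (\<Sum>j<N. w ^ j) / (a - b)"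
    using \<open>w \<noteq> 1\<close> assms unfolding power_diff_1_eq za by simp
  also have "\<dots> = (\<Sum>j<N. (z - b) ^ j / (a - b) ^ (j + 1))"
    by (simp add: sum_divide_distrib w_def power_divide mult_ac)
  finally show ?thesis by (simp add: w_def)
qed

definition telescoping_poly :: "nat \<Rightarrow> complex \<Rightarrow> complex \<Rightarrow> complex poly" where
  "telescoping_poly N b a = (\<Sum>j<N. smult (1 / (a - b) ^ (j + 1)) ([:- b, 1:] ^ j))"

lemma poly_telescoping_poly:
  assumes "a \<noteq> b" "z \<noteq> a"
  shows "poly (telescoping_poly N b a) z = ((z - b) / (a - b)) ^ N / (z - a) - 1 / (z - a)"
  unfolding telescoping_quotient[OF assms]
  by (simp add: telescoping_poly_def poly_sum poly_power)

lemma coeff_telescoping_poly: "N \<le> j \<Longrightarrow> coeff (telescoping_poly N b a) j = 0"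
  unfolding telescoping_poly_def coeff_sum
  by (intro sum.neutral ballI) (auto intro!: coeff_eq_0 simp: degree_linear_power[of "- b", simplified])

text \<open>
  From here on only the following consequences of finite order are used.
\<close>
locale convergent_divisor = nonzero_meromorphic +
  assumes conv_pos: "convergence_exponent f \<ge> 1"
    and weight_summable:
      "(\<lambda>\<rho>. \<bar>real_of_int (zorder f \<rho>)\<bar> / norm \<rho> ^ convergence_exponent f) summable_on (zeros_poles f - {0})"
    and log_derivative_limit:
      "\<exists>m T. (\<forall>n j. m \<le> j \<longrightarrow> coeff (T n) j = 0) \<and> (\<forall>z. z \<notin> zeros_poles f \<longrightarrow>
        (\<lambda>n. deriv f z / f z - (\<Sum>a\<in>zeros_poles f \<inter> cball 0 (real n). of_int (zorder f a) / (z - a))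
           - poly (T n) z) \<longlonglongrightarrow> 0)"

lemma (in finite_order_quotient) convergent_divisor:
  assumes "convergence_exponent f \<ge> 1"
  shows "convergent_divisor f"
proof unfold_locales
  obtain T where "\<And>n j. m \<le> j \<Longrightarrow> coeff (T n) j = 0"
    "\<And>z. z \<notin> zeros_poles f \<Longrightarrow>
      (\<lambda>n. deriv f z / f z - (\<Sum>a\<in>zeros_poles f \<inter> cball 0 (real n). of_int (zorder f a) / (z - a)) - poly (T n) z) \<longlonglongrightarrow> 0"
    by (rule log_derivative_limit) blast
  then show "\<exists>m T. (\<forall>n j. m \<le> j \<longrightarrow> coeff (T n) j = 0) \<and> (\<forall>z. z \<notin> zeros_poles f \<longrightarrow>
        (\<lambda>n. deriv f z / f z - (\<Sum>a\<in>zeros_poles f \<inter> cball 0 (real n). of_int (zorder f a) / (z - a))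
           - poly (T n) z) \<longlonglongrightarrow> 0)"
    by (intro exI[of _ m] exI[of _ T]) simp
qed (use assms convergence_exponent_summable in auto)

context convergent_divisor
begin

abbreviation "Z \<equiv> zeros_poles f"
abbreviation "D \<equiv> convergence_exponent f"
abbreviation "weight \<equiv> \<lambda>\<rho>. \<bar>real_of_int (zorder f \<rho>)\<bar> / norm \<rho> ^ D"
abbreviation "disc n \<equiv> Z \<inter> cball 0 (real n)"

text \<open>
  Only finitely many points of the divisor lie in a disc, so it suffices to compare with the weight far away, where
  \<open>norm \<rho>\<close>, \<open>norm (\<rho> - b)\<close> and \<open>norm (z - \<rho>)\<close> are comparable.
\<close>
lemma abs_summable_weight_comparison:
  fixes u :: "complex \<Rightarrow> 'b :: banach"
  assumes "B \<subseteq> Z" "R \<ge> 0" "\<And>\<rho>. \<rho> \<in> B \<Longrightarrow> norm \<rho> > R \<Longrightarrow> norm (u \<rho>) \<le> c * weight \<rho>"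
  shows "(\<lambda>\<rho>. norm (u \<rho>)) summable_on B" 
proof -
  have fin: "finite (B \<inter> cball 0 R)"
    using finite_zeros_poles[of "cball 0 R"] assms(1) by (auto intro: finite_subset[of _ "Z \<inter> cball 0 R"])
  have "weight summable_on (B - cball 0 R)"
    using assms by (intro summable_on_subset_banach[OF weight_summable]) auto
  then have "(\<lambda>\<rho>. c * weight \<rho>) summable_on (B - cball 0 R)"
    by (rule summable_on_cmult_right)
  then have "(\<lambda>\<rho>. norm (u \<rho>)) summable_on (B - cball 0 R)"
    by (rule Infinite_Sum.abs_summable_on_comparison_test') (use assms in auto)
  then have "(\<lambda>\<rho>. norm (u \<rho>)) summable_on ((B \<inter> cball 0 R) \<union> (B - cball 0 R))"
    using fin by (intro summable_on_Un_disjoint) auto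
  then show ?thesis by (simp add: Int_Diff_Un)
qed

text \<open>
  The Mittag-Leffler term of \<open>\<rho>\<close> with base point \<open>b\<close>.  The discrepancy uses the base point \<open>sigma1 f\<close>, the
  Hadamard product the base point \<open>0\<close>.
\<close>
definition ml_term :: "complex \<Rightarrow> complex \<Rightarrow> complex \<Rightarrow> complex" where
  "ml_term b z \<rho> = of_int (zorder f \<rho>) * ((z - b) ^ (D - 1) / (\<rho> - b) ^ (D - 1)) * (1 / (z - \<rho>))"

lemma ml_term_bound:
  assumes "norm \<rho> \<ge> 2 * norm b" "norm \<rho> \<ge> 2 * norm z" "\<rho> \<noteq> 0"
  shows "norm (ml_term b z \<rho>) \<le> 2 ^ D * norm (z - b) ^ (D - 1) * weight \<rho>"
proof -
  have 1: "norm (\<rho> - b) \<ge> norm \<rho> / 2" using norm_triangle_ineq2[of \<rho> b] assms by simp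
  have 2: "norm (z - \<rho>) \<ge> norm \<rho> / 2" using norm_triangle_ineq2[of \<rho> z] assms by (simp add: norm_minus_commute)
  have "norm (ml_term b z \<rho>) = \<bar>real_of_int (zorder f \<rho>)\<bar> * norm (z - b) ^ (D - 1) * (1 / (norm (\<rho> - b) ^ (D - 1) * norm (z - \<rho>)))"
    by (simp add: ml_term_def norm_mult norm_divide norm_power)
  also have "\<dots> \<le> \<bar>real_of_int (zorder f \<rho>)\<bar> * norm (z - b) ^ (D - 1) * (1 / ((norm \<rho> / 2) ^ (D - 1) * (norm \<rho> / 2)))"
    using assms(3) 1 2
    by (intro mult_left_mono divide_left_mono mult_mono power_mono mult_pos_pos zero_less_power) (auto intro!: mult_pos_pos zero_less_power)
  also have "(norm \<rho> / 2) ^ (D - 1) * (norm \<rho> / 2) = (norm \<rho> / 2) ^ D"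
    using conv_pos by (cases D) simp_all
  finally show ?thesis by (simp add: power_divide mult_ac)
qed

lemma ml_term_abs_summable: "B \<subseteq> Z \<Longrightarrow> (\<lambda>\<rho>. norm (ml_term b z \<rho>)) summable_on B"
proof (rule abs_summable_weight_comparison[where R = "2 * norm b + 2 * norm z" and c = "2 ^ D * norm (z - b) ^ (D - 1)"])
  fix \<rho> :: complex assume "norm \<rho> > 2 * norm b + 2 * norm z"
  moreover have "norm b \<ge> 0" "norm z \<ge> 0" by simp_all
  ultimately have "norm \<rho> \<ge> 2 * norm b" "norm \<rho> \<ge> 2 * norm z" "norm \<rho> > 0" by linarith+
  then show "norm (ml_term b z \<rho>) \<le> 2 ^ D * norm (z - b) ^ (D - 1) * weight \<rho>"
    by (intro ml_term_bound) auto
qed auto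

lemma ml_term_summable: "B \<subseteq> Z \<Longrightarrow> ml_term b z summable_on B"
  by (rule Infinite_Sum.abs_summable_summable[OF ml_term_abs_summable])

definition G :: "complex \<Rightarrow> complex \<Rightarrow> complex" where
  "G b z = of_int (zorder f b) / (z - b) + (\<Sum>\<^sub>\<infinity>\<rho>\<in>Z - {b}. ml_term b z \<rho>)"

definition Gpartial :: "complex \<Rightarrow> nat \<Rightarrow> complex \<Rightarrow> complex" where
  "Gpartial b n z = of_int (zorder f b) / (z - b) + (\<Sum>\<rho>\<in>disc n - {b}. ml_term b z \<rho>)"

lemma filterlim_discs: "filterlim (\<lambda>n. disc n - {b}) (finite_subsets_at_top (Z - {b})) sequentially"
  unfolding filterlim_finite_subsets_at_top
proof (intro allI impI)
  fix X assume X: "finite X \<and> X \<subseteq> Z - {b}"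
  have "\<forall>\<^sub>F n in sequentially. real n \<ge> Max (insert 0 (norm ` X))"
    using filterlim_real_sequentially unfolding filterlim_at_top by blast
  then show "\<forall>\<^sub>F n in sequentially. finite (disc n - {b}) \<and> X \<subseteq> disc n - {b} \<and>
      disc n - {b} \<subseteq> Z - {b}"
    by eventually_elim (use X finite_zeros_poles in auto)
qed

lemma infsum_discs_tendsto:
  fixes u :: "complex \<Rightarrow> complex"
  assumes "u summable_on (Z - {b})"
  shows "(\<lambda>n. \<Sum>\<rho>\<in>disc n - {b}. u \<rho>) \<longlonglongrightarrow> (\<Sum>\<^sub>\<infinity>\<rho>\<in>Z - {b}. u \<rho>)"
  by (rule filterlim_compose[OF infsum_tendsto[OF assms] filterlim_discs])

lemma Gpartial_tendsto: "(\<lambda>n. Gpartial b n z) \<longlonglongrightarrow> G b z"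
  unfolding G_def Gpartial_def by (intro tendsto_intros infsum_discs_tendsto ml_term_summable) auto

text \<open>
  What the convergence factors add to the finite sum of the plain fractions over the disc of
  radius \<open>n\<close>.
\<close>
definition base_change_poly :: "complex \<Rightarrow> nat \<Rightarrow> complex poly" where
  "base_change_poly b n = (\<Sum>\<rho>\<in>disc n - {b}. smult (of_int (zorder f \<rho>)) (telescoping_poly (D - 1) b \<rho>))"

lemma coeff_base_change_poly: "D - 1 \<le> j \<Longrightarrow> coeff (base_change_poly b n) j = 0"
  by (simp add: base_change_poly_def coeff_sum coeff_telescoping_poly)

lemma Gpartial_eq:
  assumes "z \<notin> Z" "norm b \<le> real n"
  shows "Gpartial b n z = (\<Sum>a\<in>disc n. of_int (zorder f a) / (z - a)) + poly (base_change_poly b n) z"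
proof -
  let ?A = "disc n"
  have fin: "finite ?A" using finite_zeros_poles by simp
  have "(\<Sum>\<rho>\<in>?A - {b}. ml_term b z \<rho>) = (\<Sum>\<rho>\<in>?A - {b}. of_int (zorder f \<rho>) / (z - \<rho>)
      + of_int (zorder f \<rho>) * poly (telescoping_poly (D - 1) b \<rho>) z)"
  proof (rule sum.cong)
    fix \<rho> assume "\<rho> \<in> ?A - {b}"
    then have "\<rho> \<noteq> b" "z \<noteq> \<rho>" using assms(1) by auto
    then show "ml_term b z \<rho> = of_int (zorder f \<rho>) / (z - \<rho>) + of_int (zorder f \<rho>) * poly (telescoping_poly (D - 1) b \<rho>) z"
      by (simp add: ml_term_def poly_telescoping_poly power_divide right_diff_distrib)
  qed simp
  also have "\<dots> = (\<Sum>\<rho>\<in>?A - {b}. of_int (zorder f \<rho>) / (z - \<rho>)) + poly (base_change_poly b n) z"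
    by (simp add: sum.distrib base_change_poly_def poly_sum)
  finally have "Gpartial b n z = of_int (zorder f b) / (z - b) + (\<Sum>\<rho>\<in>?A - {b}. of_int (zorder f \<rho>) / (z - \<rho>)) + poly (base_change_poly b n) z"
    by (simp add: Gpartial_def)
  also have "of_int (zorder f b) / (z - b) + (\<Sum>\<rho>\<in>?A - {b}. of_int (zorder f \<rho>) / (z - \<rho>))
      = (\<Sum>a\<in>?A. of_int (zorder f a) / (z - a))"
  proof (cases "b \<in> Z")
    case True
    then show ?thesis using assms(2) sum.remove[OF fin, of b "\<lambda>a. of_int (zorder f a) / (z - a)"] by simp
  next
    case False
    then show ?thesis using zorder_zero_iff[of b] by simp
  qed
  finally show ?thesis .
qed

lemma infinite_complement: "finite B \<Longrightarrow> infinite (- (Z \<union> B))"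
proof
  assume fin: "finite B" "finite (- (Z \<union> B))"
  have "\<not> 0 islimpt (- (Z \<union> B)) \<union> Z \<union> B"
    using not_islimpt_zeros_poles[of 0] islimpt_finite[OF fin(1), of 0] islimpt_finite[OF fin(2), of 0]
    by (simp only: islimpt_Un) simp
  moreover have "(- (Z \<union> B)) \<union> Z \<union> B = UNIV" by blast
  ultimately show False using islimpt_UNIV[of "0::complex"] by simp
qed

text \<open>
  Both \<open>G b\<close> and \<open>f'/f\<close> are limits of the same finite sums of plain fractions plus polynomials of bounded degree;
  the divergent sums cancel in the difference.
\<close>
lemma log_derivative_poly:
  obtains P where "\<And>z. z \<notin> Z \<Longrightarrow> z \<noteq> b \<Longrightarrow> poly P z = G b z - deriv f z / f z"
proof -
  obtain m T where T: "\<And>n j. m \<le> j \<Longrightarrow> coeff (T n) j = 0"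
    "\<And>z. z \<notin> Z \<Longrightarrow> (\<lambda>n. deriv f z / f z - (\<Sum>a\<in>disc n. of_int (zorder f a) / (z - a))
           - poly (T n) z) \<longlonglongrightarrow> 0"
    using log_derivative_limit by blast
  have lim: "(\<lambda>n. poly (base_change_poly b n - T n) z) \<longlonglongrightarrow> G b z - deriv f z / f z" if z: "z \<notin> Z" for z
  proof -
    have "(\<lambda>n. Gpartial b n z + (deriv f z / f z - (\<Sum>a\<in>disc n. of_int (zorder f a) / (z - a))
           - poly (T n) z) - deriv f z / f z) \<longlonglongrightarrow> G b z + 0 - deriv f z / f z"
      by (intro tendsto_intros Gpartial_tendsto T(2) z)
    moreover have "\<forall>\<^sub>F n in sequentially. real n \<ge> norm b"
      using filterlim_real_sequentially unfolding filterlim_at_top by blast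
    then have "\<forall>\<^sub>F n in sequentially. Gpartial b n z + (deriv f z / f z - (\<Sum>a\<in>disc n. of_int (zorder f a) / (z - a))
           - poly (T n) z) - deriv f z / f z = poly (base_change_poly b n - T n) z"
      by eventually_elim (simp add: Gpartial_eq[OF z])
    ultimately show ?thesis using Lim_transform_eventually by fastforce
  qed
  have cf: "coeff (base_change_poly b n - T n) j = 0" if "max m (D - 1) \<le> j" for n j
    using that T(1) coeff_base_change_poly by simp
  have inf: "infinite (- (Z \<union> {b}))" by (rule infinite_complement) simp
  obtain P where "\<And>z. z \<in> - (Z \<union> {b}) \<Longrightarrow> G b z - deriv f z / f z = poly P z"
  proof (rule polynomial_pointwise_limit[of "- (Z \<union> {b})" sequentially "max m (D - 1)" "\<lambda>n. base_change_poly b n - T n"])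
    show "(\<lambda>n. poly (base_change_poly b n - T n) z) \<longlonglongrightarrow> G b z - deriv f z / f z" if "z \<in> - (Z \<union> {b})" for z
      using that by (intro lim) simp
  qed (rule inf sequentially_bot cf | assumption | blast)+
  then show ?thesis using that[of P] by auto
qed

text \<open>
  In \<open>G b - G c\<close> the plain fractions cancel, and only the polynomials from the convergence factors
  remain.
\<close>
lemma coeff_base_change:
  assumes P: "\<And>z. z \<notin> Z \<Longrightarrow> z \<noteq> b \<Longrightarrow> poly P z = G b z - deriv f z / f z"
    and Q: "\<And>z. z \<notin> Z \<Longrightarrow> z \<noteq> c \<Longrightarrow> poly Q z = G c z - deriv f z / f z"
    and j: "D - 1 \<le> j"
  shows "coeff (P - Q) j = 0"
proof -
  let ?S = "- (Z \<union> {b, c})"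
  have inf: "infinite ?S" by (rule infinite_complement) simp
  have lim: "(\<lambda>n. poly (base_change_poly b n - base_change_poly c n) z) \<longlonglongrightarrow> G b z - G c z" if z: "z \<in> ?S" for z
  proof -
    have "(\<lambda>n. Gpartial b n z - Gpartial c n z) \<longlonglongrightarrow> G b z - G c z"
      by (intro tendsto_intros Gpartial_tendsto)
    moreover have "\<forall>\<^sub>F n in sequentially. real n \<ge> max (norm b) (norm c)"
      using filterlim_real_sequentially unfolding filterlim_at_top by blast
    then have "\<forall>\<^sub>F n in sequentially. Gpartial b n z - Gpartial c n z = poly (base_change_poly b n - base_change_poly c n) z"
      by eventually_elim (use z in \<open>simp add: Gpartial_eq\<close>)
    ultimately show ?thesis using Lim_transform_eventually by fastforce
  qed
  have cf: "coeff (base_change_poly b n - base_change_poly c n) j = 0" if "D - 1 \<le> j" for n j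
    using that coeff_base_change_poly by simp
  obtain q where q: "\<And>j. D - 1 \<le> j \<Longrightarrow> coeff q j = 0" "\<And>z. z \<in> ?S \<Longrightarrow> G b z - G c z = poly q z"
  proof (rule polynomial_pointwise_limit[of ?S sequentially "D - 1" "\<lambda>n. base_change_poly b n - base_change_poly c n"])
    show "(\<lambda>n. poly (base_change_poly b n - base_change_poly c n) z) \<longlonglongrightarrow> G b z - G c z" if "z \<in> ?S" for z
      by (rule lim[OF that])
  qed (rule inf sequentially_bot cf | assumption | blast)+
  have "P - Q = q"
    by (rule poly_eq_on_infinite[OF inf]) (use P Q in \<open>auto simp flip: q(2)\<close>)
  then show ?thesis using q(1) j by simp
qed

end

section \<open>The Hadamard product and the degree of the discrepancy\<close>
lemma has_derivative_weierstrass_factor: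
  assumes "a \<noteq> 0" "z \<noteq> a"
  shows "((\<lambda>s. weierstrass_factor p (s / a)) has_field_derivative
     weierstrass_factor p (z / a) * ((z / a) ^ p / (z - a))) (at z)"
proof -
  define e where "e s = exp (\<Sum>k=1..p. (s / a) ^ k / of_nat k)" for s
  have "((\<lambda>s. \<Sum>k=1..p. (s / a) ^ k / of_nat k) has_field_derivative (\<Sum>k=1..p. (z / a) ^ (k - 1) / a)) (at z)"
    by (rule DERIV_sum, rule DERIV_cong, rule DERIV_cdivide, rule DERIV_power, rule DERIV_cdivide, rule DERIV_ident)
      (use assms in simp)
  moreover have "(\<Sum>k=1..p. (z / a) ^ (k - 1) / a) = (\<Sum>j<p. (z - 0) ^ j / (a - 0) ^ (j + 1))"
    by (simp add: sum.atLeast1_atMost_eq power_divide mult.commute)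
  moreover have "\<dots> = (z / a) ^ p / (z - a) - 1 / (z - a)"
    using telescoping_quotient[of a 0 z p] assms by simp
  ultimately have "((\<lambda>s. \<Sum>k=1..p. (s / a) ^ k / of_nat k) has_field_derivative
      ((z / a) ^ p / (z - a) - 1 / (z - a))) (at z)"
    by metis
  then have e: "(e has_field_derivative e z * ((z / a) ^ p / (z - a) - 1 / (z - a))) (at z)"
    unfolding e_def by (rule DERIV_fun_exp)
  have "1 / a = - ((1 - z / a) * (1 / (z - a)))"
    using assms by (simp add: field_simps)
  then have "((\<lambda>s. 1 - s / a) has_field_derivative (1 - z / a) * (1 / (z - a))) (at z)"
    using assms by (auto intro!: derivative_eq_intros)
  then have "((\<lambda>s. (1 - s / a) * e s) has_field_derivative (1 - z / a) * e z * ((z / a) ^ p / (z - a))) (at z)"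
    by (rule DERIV_cong[OF DERIV_mult[OF _ e]]) (simp add: algebra_simps)
  then show ?thesis by (simp add: weierstrass_factor_def e_def)
qed

context convergent_divisor
begin

abbreviation "E s a \<equiv> weierstrass_factor (D - 1) (s / a)"

definition tail :: "complex set \<Rightarrow> real" where
  "tail X = (\<Sum>\<^sub>\<infinity>\<rho>\<in>Z - {0}. weight \<rho>) - (\<Sum>\<rho>\<in>X. weight \<rho>)"

lemma tail_eq: "finite X \<Longrightarrow> X \<subseteq> Z - {0} \<Longrightarrow> tail X = (\<Sum>\<^sub>\<infinity>\<rho>\<in>Z - {0} - X. weight \<rho>)"
  using infsum_Un_disjoint[of weight X "Z - {0} - X"] summable_on_subset_banach[OF weight_summable, of "Z - {0} - X"]
  by (simp add: tail_def Un_absorb1)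

lemma tail_nonneg: "finite X \<Longrightarrow> X \<subseteq> Z - {0} \<Longrightarrow> tail X \<ge> 0"
  by (simp add: tail_eq infsum_nonneg)

lemma tail_tendsto: "(tail \<longlongrightarrow> 0) (finite_subsets_at_top (Z - {0}))"
  unfolding tail_def
  using tendsto_diff[OF tendsto_const[of "\<Sum>\<^sub>\<infinity>\<rho>\<in>Z - {0}. weight \<rho>"] infsum_tendsto[OF weight_summable]] by simp

text \<open>
  On the disc of radius \<open>B = norm z + 1\<close> the function \<open>w = f / (z ^ n\<^sub>0 * (product over X) * exp Q)\<close> extends without zeros,
  as \<open>X\<close> contains the divisor in the disc of radius \<open>2 * B\<close>.  Its logarithmic derivative is the tail of the
  series \<open>G 0\<close> outside \<open>X\<close>, which is small uniformly on the disc.  Hence \<open>w\<close> is almost constant, and its value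
  at \<open>0\<close>, where all Weierstrass factors are \<open>1\<close>, does not depend on \<open>X\<close>.
\<close>
lemma partial_product_estimate:
  assumes P: "\<And>z. z \<notin> Z \<Longrightarrow> z \<noteq> 0 \<Longrightarrow> poly P z = G 0 z - deriv f z / f z"
    and Q: "pderiv Q = - P"
    and z: "z \<notin> Z" and X: "finite X" "X \<subseteq> Z - {0}" "Z \<inter> cball 0 (2 * (norm z + 1)) - {0} \<subseteq> X"
  obtains \<delta> where "norm \<delta> \<le> 2 ^ D * (norm z + 1) ^ D * tail X"
    "f z = z powi zorder f 0 * (\<Prod>a\<in>X. E z a powi zorder f a) * exp (poly Q z)
       * (strip {0} 0 * exp (- poly Q 0)) * exp \<delta>"
proof -
  define B where "B = norm z + 1"
  have B: "B \<ge> 1" "norm z < B" by (simp_all add: B_def)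
  define A where "A = insert 0 (Z \<inter> cball 0 (2 * B))"
  define A' where "A' = A - {0}"
  have A: "finite A" "0 \<in> A" "A' \<subseteq> X" "finite A'" "A' \<subseteq> Z"
    using finite_zeros_poles[of "cball 0 (2 * B)"] X by (auto simp: A_def A'_def B_def)
  \<comment> \<open>The quotient of \<open>s - a\<close> by the Weierstrass factor of \<open>a\<close>, with the common zero cancelled\<close>
  define v where "v a s = - a / exp (\<Sum>k=1..D - 1. (s / a) ^ k / of_nat k)" for a s :: complex
  have v_eq: "s - a = v a s * E s a" if "a \<noteq> 0" for a s
    using that by (simp add: v_def weierstrass_factor_def field_simps)
  define w where "w s = strip A s * (\<Prod>a\<in>A'. v a s powi zorder f a)
     * (\<Prod>a\<in>X - A'. E s a powi (- zorder f a)) * exp (- poly Q s)" for s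
  have E_nz: "E s a \<noteq> 0" if "a \<in> X - A'" "s \<in> ball 0 B" for a s
  proof -
    have "a \<in> Z" "norm a > 2 * B" using that X by (auto simp: A'_def A_def)
    then have "s \<noteq> a" "a \<noteq> 0" using that B by auto
    then show ?thesis by simp
  qed
  have w_an: "w analytic_on {s}" "w s \<noteq> 0" if s: "s \<in> ball 0 B" for s
  proof -
    have sA: "s \<in> A \<or> s \<notin> Z" using s B by (auto simp: A_def)
    have 1: "(\<lambda>s. v a s powi zorder f a) analytic_on {s}" "v a s \<noteq> 0" if "a \<in> A'" for a
      using that unfolding v_def by (auto intro!: analytic_intros simp: A'_def)
    have 2: "(\<lambda>s. E s a powi (- zorder f a)) analytic_on {s}" if "a \<in> X - A'" for a
      using that E_nz[OF that s] X by (intro analytic_intros) auto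
    have 3: "(\<lambda>s. exp (- poly Q s)) analytic_on {s}"
      by (rule holomorphic_on_imp_analytic_at[of _ UNIV])
        (auto simp: holomorphic_on_open intro!: exI derivative_eq_intros poly_DERIV)
    show "w analytic_on {s}"
      unfolding w_def using 1 2 3 strip_analytic[OF A(1) sA]
      by (intro analytic_on_mult analytic_on_prod) auto
    have "E s a powi (- zorder f a) \<noteq> 0" if "a \<in> X - A'" for a
      using E_nz[OF that s] power_int_eq_0_iff by blast
    then have 4: "(\<Prod>a\<in>X - A'. E s a powi (- zorder f a)) \<noteq> 0"
      unfolding prod_zero_iff[OF finite_Diff[OF X(1)]] by blast
    show "w s \<noteq> 0"
      unfolding w_def mult_eq_0_iff de_Morgan_disj
      by (intro conjI 4) (use 1 strip_analytic[OF A(1) sA] A in auto)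
  qed
  have w_hol: "w holomorphic_on ball 0 B"
    using w_an(1) analytic_on_analytic_at analytic_imp_holomorphic by blast
  have w0: "w 0 = strip {0} 0 * exp (- poly Q 0)"
  proof -
    have "v a 0 = - a" for a :: complex
      by (simp add: v_def power_0_left)
    then show ?thesis
      using strip_at_base[OF A(1,2)] by (simp add: w_def A'_def)
  qed
  define F where "F s = s powi zorder f 0 * (\<Prod>a\<in>X. E s a powi zorder f a) * exp (poly Q s) * w s" for s
  have f_eq: "f s = F s" if s: "s \<in> ball 0 B" "s \<notin> Z" for s
  proof -
    have "f s = divisor_prod A s * strip A s"
      using s A by (intro strip_eq analytic_off_zeros_poles) auto
    also have "divisor_prod A s = s powi zorder f 0 * (\<Prod>a\<in>A'. (s - a) powi zorder f a)"
      using prod.remove[OF A(1,2), of "\<lambda>a. (s - a) powi zorder f a"] by (simp add: divisor_prod_def A'_def)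
    also have "(\<Prod>a\<in>A'. (s - a) powi zorder f a) = (\<Prod>a\<in>A'. v a s powi zorder f a) * (\<Prod>a\<in>A'. E s a powi zorder f a)"
      unfolding prod.distrib[symmetric]
      by (intro prod.cong refl) (subst v_eq, auto simp: A'_def power_int_mult_distrib)
    also have "(\<Prod>a\<in>A'. E s a powi zorder f a) = (\<Prod>a\<in>X. E s a powi zorder f a) * (\<Prod>a\<in>X - A'. E s a powi (- zorder f a))"
    proof -
      have "(\<Prod>a\<in>X. E s a powi zorder f a) = (\<Prod>a\<in>X - A'. E s a powi zorder f a) * (\<Prod>a\<in>A'. E s a powi zorder f a)"
        using prod.subset_diff[OF A(3) X(1)] by blast
      moreover have "(\<Prod>a\<in>X - A'. E s a powi zorder f a) * (\<Prod>a\<in>X - A'. E s a powi (- zorder f a)) = 1"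
        unfolding prod.distrib[symmetric]
      proof (intro prod.neutral ballI)
        fix a assume a: "a \<in> X - A'"
        have "E s a powi zorder f a \<noteq> 0"
          using E_nz[OF a s(1)] by (simp only: power_int_eq_0_iff) blast
        then show "E s a powi zorder f a * E s a powi (- zorder f a) = 1"
          unfolding power_int_minus by (rule right_inverse)
      qed
      ultimately show ?thesis by (simp add: mult_ac)
    qed
    finally show ?thesis
      by (simp add: F_def w_def exp_minus field_simps)
  qed
  have log_w: "deriv w s / w s = (\<Sum>\<^sub>\<infinity>a\<in>Z - {0} - X. ml_term 0 s a)"
    if s: "s \<in> ball 0 B" "s \<notin> Z" "s \<noteq> 0" for s
  proof -
    have "(F has_field_derivative F s * (of_int (zorder f 0) * (1 / s) + (\<Sum>a\<in>X. of_int (zorder f a) * ((s / a) ^ (D - 1) / (s - a)))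
        + poly (pderiv Q) s + deriv w s / w s)) (at s)"
    proof -
      have d1: "((\<lambda>s. s powi zorder f 0) has_field_derivative s powi zorder f 0 * (of_int (zorder f 0) * (1 / s))) (at s)"
        using s by (intro has_field_derivative_powi_logarithmic) (auto intro!: derivative_eq_intros)
      have d2: "((\<lambda>s. \<Prod>a\<in>X. E s a powi zorder f a) has_field_derivative
         (\<Prod>a\<in>X. E s a powi zorder f a) * (\<Sum>a\<in>X. of_int (zorder f a) * ((s / a) ^ (D - 1) / (s - a)))) (at s)"
      proof (rule has_field_derivative_prod_logarithmic)
        fix a assume "a \<in> X"
        then have "a \<noteq> 0" "s \<noteq> a" using X s by auto
        then show "((\<lambda>s. E s a powi zorder f a) has_field_derivative
            E s a powi zorder f a * (of_int (zorder f a) * ((s / a) ^ (D - 1) / (s - a)))) (at s)"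
          by (intro has_field_derivative_powi_logarithmic has_derivative_weierstrass_factor) auto
      qed
      have d3: "((\<lambda>s. exp (poly Q s)) has_field_derivative exp (poly Q s) * poly (pderiv Q) s) (at s)"
        by (auto intro!: derivative_eq_intros poly_DERIV)
      have d4: "(w has_field_derivative w s * (deriv w s / w s)) (at s)"
        by (intro has_derivative_logarithmic w_an s)
      show ?thesis
        unfolding F_def
        by (rule DERIV_cong[OF DERIV_mult[OF DERIV_mult[OF DERIV_mult[OF d1 d2] d3] d4]]) (simp add: algebra_simps)
    qed
    then have "(f has_field_derivative F s * (of_int (zorder f 0) * (1 / s) + (\<Sum>a\<in>X. of_int (zorder f a) * ((s / a) ^ (D - 1) / (s - a)))
        + poly (pderiv Q) s + deriv w s / w s)) (at s)"
      by (rule has_field_derivative_transform_within_open[of _ _ _ "ball 0 B - Z"])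
        (use s f_eq closed_zeros_poles in auto)
    then have "deriv f s / f s = of_int (zorder f 0) * (1 / s) + (\<Sum>a\<in>X. of_int (zorder f a) * ((s / a) ^ (D - 1) / (s - a)))
        + poly (pderiv Q) s + deriv w s / w s"
      using f_eq[OF s(1,2)] s(2) zeros_poles_iff[of s] by (simp add: DERIV_imp_deriv)
    moreover have "(\<Sum>a\<in>X. of_int (zorder f a) * ((s / a) ^ (D - 1) / (s - a))) = (\<Sum>a\<in>X. ml_term 0 s a)"
      by (simp add: ml_term_def power_divide)
    moreover have "(\<Sum>\<^sub>\<infinity>a\<in>Z - {0}. ml_term 0 s a) = (\<Sum>a\<in>X. ml_term 0 s a) + (\<Sum>\<^sub>\<infinity>a\<in>Z - {0} - X. ml_term 0 s a)"
    proof -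
      have un: "X \<union> (Z - {0} - X) = Z - {0}" using X(2) by blast
      have "ml_term 0 s summable_on (Z - {0} - X)"
        by (rule ml_term_summable) blast
      moreover have "X \<inter> (Z - {0} - X) = {}" by blast
      ultimately have "infsum (ml_term 0 s) (X \<union> (Z - {0} - X)) = infsum (ml_term 0 s) X + infsum (ml_term 0 s) (Z - {0} - X)"
        by (intro infsum_Un_disjoint summable_on_finite[OF X(1)])
      then show ?thesis unfolding un infsum_finite[OF X(1)] .
    qed
    moreover have "poly (pderiv Q) s = deriv f s / f s - G 0 s"
      using P[OF s(2,3)] by (simp add: Q)
    ultimately show ?thesis by (simp add: G_def)
  qed
  define \<epsilon> where "\<epsilon> = 2 ^ D * B ^ (D - 1) * tail X"
  have bound: "norm (deriv w s / w s) \<le> \<epsilon>" if s: "s \<in> ball 0 B" "s \<notin> Z" "s \<noteq> 0" for s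
  proof -
    have "norm (deriv w s / w s) \<le> (\<Sum>\<^sub>\<infinity>a\<in>Z - {0} - X. norm (ml_term 0 s a))"
      unfolding log_w[OF s] by (rule Infinite_Sum.norm_infsum_bound[OF ml_term_abs_summable]) auto
    also have "\<dots> \<le> (\<Sum>\<^sub>\<infinity>a\<in>Z - {0} - X. 2 ^ D * B ^ (D - 1) * weight a)"
    proof (rule infsum_mono)
      show "(\<lambda>a. norm (ml_term 0 s a)) summable_on (Z - {0} - X)"
        by (rule ml_term_abs_summable) auto
      show "(\<lambda>a. 2 ^ D * B ^ (D - 1) * weight a) summable_on (Z - {0} - X)"
        by (intro summable_on_cmult_right summable_on_subset_banach[OF weight_summable]) auto
      fix a assume a: "a \<in> Z - {0} - X"
      then have "norm a > 2 * B" using X(3) by (auto simp: B_def)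
      then have "norm (ml_term 0 s a) \<le> 2 ^ D * norm (s - 0) ^ (D - 1) * weight a"
        using a s B by (intro ml_term_bound) auto
      also have "\<dots> \<le> 2 ^ D * B ^ (D - 1) * weight a"
        using s by (intro mult_right_mono mult_left_mono power_mono) auto
      finally show "norm (ml_term 0 s a) \<le> 2 ^ D * B ^ (D - 1) * weight a" .
    qed
    also have "\<dots> = \<epsilon>"
      using X by (simp add: \<epsilon>_def tail_eq infsum_cmult_right' del: times_divide_eq_right)
    finally show ?thesis .
  qed
  \<comment> \<open>The bound extends to the divisor and to the origin by continuity.\<close>
  have bound': "norm (deriv w s / w s) \<le> \<epsilon>" if s: "s \<in> ball 0 B" for s
  proof -
    have "(\<lambda>s. deriv w s / w s) holomorphic_on ball 0 B"
      using w_hol w_an(2) by (intro holomorphic_intros) auto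
    then have "continuous_on (ball 0 B) (\<lambda>s. deriv w s / w s)"
      by (rule holomorphic_on_imp_continuous_on)
    then have "isCont (\<lambda>s. deriv w s / w s) s"
      using s by (simp only: continuous_on_eq_continuous_at[OF open_ball])
    then have "((\<lambda>s. deriv w s / w s) \<longlongrightarrow> deriv w s / w s) (at s)"
      by (rule isContD)
    moreover have "\<forall>\<^sub>F u in at s. norm (deriv w u / w u) \<le> \<epsilon>"
      using eventually_at_in_open'[OF open_ball s] eventually_nonzero[of s] eventually_not_in_finite[of "{0}" s, simplified]
      by eventually_elim (use bound zeros_poles_iff in auto)
    ultimately show ?thesis
      by (intro tendsto_upperbound[OF tendsto_norm]) auto
  qed
  have "contractible (ball (0::complex) B)"
    by (intro convex_imp_contractible) auto
  then obtain l where l: "l holomorphic_on ball 0 B" "\<And>s. s \<in> ball 0 B \<Longrightarrow> w s = exp (l s)"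
    using contractible_imp_holomorphic_log[OF w_hol _ w_an(2)] by blast
  have "norm (l z - l 0) \<le> \<epsilon> * norm (z - 0)"
  proof (rule field_differentiable_bound[where S = "ball 0 B" and f' = "deriv l"])
    fix s :: complex assume s: "s \<in> ball 0 B"
    show dl: "(l has_field_derivative deriv l s) (at s within ball 0 B)"
      using holomorphic_derivI[OF l(1) _ s] by auto
    have "((\<lambda>s. exp (l s)) has_field_derivative exp (l s) * deriv l s) (at s)"
      using holomorphic_derivI[OF l(1) _ s] by (auto intro!: derivative_eq_intros)
    then have "(w has_field_derivative exp (l s) * deriv l s) (at s)"
      by (rule has_field_derivative_transform_within_open[of _ _ _ "ball 0 B"]) (use s l in auto)
    then have "deriv w s / w s = deriv l s"
      using l(2)[OF s] by (simp add: DERIV_imp_deriv)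
    then show "norm (deriv l s) \<le> \<epsilon>" using bound'[OF s] by simp
  qed (use B in auto)
  also have "\<dots> \<le> \<epsilon> * B"
    using B tail_nonneg[OF X(1,2)] by (intro mult_left_mono) (auto simp: \<epsilon>_def)
  also have "\<dots> = 2 ^ D * (norm z + 1) ^ D * tail X"
    using conv_pos by (cases D) (simp_all add: \<epsilon>_def B_def mult_ac)
  finally have \<delta>: "norm (l z - l 0) \<le> 2 ^ D * (norm z + 1) ^ D * tail X" .
  have "w z = w 0 * exp (l z - l 0)"
    using l(2)[of z] l(2)[of 0] B by (simp add: exp_diff)
  then show ?thesis
    using that[OF \<delta>] f_eq[of z] z B by (simp add: F_def w0)
qed

text \<open>
  As \<open>X\<close> grows, the tail in \<open>partial_product_estimate\<close> tends to \<open>0\<close>, so the partial products converge at every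
  point off the divisor.  At a zero of \<open>f\<close> other than the origin the products are eventually \<open>0\<close>.
\<close>
lemma hadamard_factorization_exists:
  assumes P: "\<And>z. z \<notin> Z \<Longrightarrow> z \<noteq> 0 \<Longrightarrow> poly P z = G 0 z - deriv f z / f z"
  obtains Q where "hadamard_factorization f Q" "pderiv Q = - P"
proof -
  obtain Q where Q: "pderiv Q = - P" using poly_antiderivative by blast
  define C where "C = strip {0} 0 * exp (- poly Q 0)"
  have C: "C \<noteq> 0" using strip_analytic[of "{0}" 0] by (simp add: C_def)
  \<comment> \<open>The constant value of the quotient is absorbed into the polynomial.\<close>
  define Q0 where "Q0 = Q + [:Ln C:]"
  have expQ0: "exp (poly Q0 z) = exp (poly Q z) * C" for z
    using C by (simp add: Q0_def exp_add)
  show ?thesis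
  proof (rule that[of Q0])
    show "pderiv Q0 = - P" by (simp add: Q0_def Q pderiv_add)
    show "hadamard_factorization f Q0"
      unfolding hadamard_factorization_def
    proof (intro allI impI)
      fix s assume np: "\<not> is_pole f s"
      show "\<exists>p. ((\<lambda>X. \<Prod>\<rho>\<in>X. E s \<rho> powi zorder f \<rho>) \<longlongrightarrow> p) (finite_subsets_at_top (Z - {0})) \<and>
        f s = s powi zorder f 0 * exp (poly Q0 s) * p"
      proof (cases "s \<in> Z")
        case False
        define q where "q = s powi zorder f 0"
        define p where "p = f s / (q * exp (poly Q0 s))"
        have s0: "q \<noteq> 0"
          using False zorder_zero_iff[of 0] by (cases "s = 0") (auto simp: q_def)
        define c where "c = 2 ^ D * (norm s + 1) ^ D"
        define good where "good X \<longleftrightarrow> finite X \<and> X \<subseteq> Z - {0} \<and> Z \<inter> cball 0 (2 * (norm s + 1)) - {0} \<subseteq> X" for X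
        have "\<exists>\<delta>. good X \<longrightarrow> norm \<delta> \<le> c * tail X \<and> (\<Prod>\<rho>\<in>X. E s \<rho> powi zorder f \<rho>) = p * exp (- \<delta>)" for X
        proof (cases "good X")
          case True
          then obtain \<delta> where "norm \<delta> \<le> c * tail X"
            "f s = q * (\<Prod>a\<in>X. E s a powi zorder f a) * exp (poly Q s) * C * exp \<delta>"
            using partial_product_estimate[OF P Q False, of X] unfolding good_def c_def C_def q_def by blast
          then show ?thesis
            using s0 C by (intro exI[of _ \<delta>]) (simp add: p_def expQ0 exp_minus field_simps)
        qed auto
        then obtain \<delta> where \<delta>: "\<And>X. good X \<Longrightarrow> norm (\<delta> X) \<le> c * tail X"
          "\<And>X. good X \<Longrightarrow> (\<Prod>\<rho>\<in>X. E s \<rho> powi zorder f \<rho>) = p * exp (- \<delta> X)"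
          by metis
        have ev: "\<forall>\<^sub>F X in finite_subsets_at_top (Z - {0}). good X"
          unfolding eventually_finite_subsets_at_top good_def
          using finite_zeros_poles[of "cball 0 (2 * (norm s + 1))"]
          by (intro exI[of _ "Z \<inter> cball 0 (2 * (norm s + 1)) - {0}"]) auto
        have "((\<lambda>X. c * tail X) \<longlongrightarrow> c * 0) (finite_subsets_at_top (Z - {0}))"
          by (intro tendsto_intros tail_tendsto)
        then have "(\<delta> \<longlongrightarrow> 0) (finite_subsets_at_top (Z - {0}))"
          by (intro Lim_null_comparison[OF eventually_mono[OF ev \<delta>(1)]]) auto
        then have "((\<lambda>X. p * exp (- \<delta> X)) \<longlongrightarrow> p * exp (- 0)) (finite_subsets_at_top (Z - {0}))"
          by (intro tendsto_intros)
        moreover have "\<forall>\<^sub>F X in finite_subsets_at_top (Z - {0}). p * exp (- \<delta> X) = (\<Prod>\<rho>\<in>X. E s \<rho> powi zorder f \<rho>)"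
          by (rule eventually_mono[OF ev]) (rule \<delta>(2)[symmetric])
        ultimately have "((\<lambda>X. \<Prod>\<rho>\<in>X. E s \<rho> powi zorder f \<rho>) \<longlongrightarrow> p) (finite_subsets_at_top (Z - {0}))"
          using Lim_transform_eventually by fastforce
        moreover have "f s = q * exp (poly Q0 s) * p" using s0 by (simp add: p_def)
        ultimately show ?thesis unfolding q_def by blast
      next
        case True
        then have fs: "f s = 0" "zorder f s \<noteq> 0" using zeros_poles_iff zorder_zero_iff by auto
        have pos: "zorder f s > 0"
          using fs zorder_ge_0[OF analytic_at[OF np]] eventually_frequently[OF at_neq_bot eventually_nonzero[of s]] by simp
        show ?thesis
        proof (cases "s = 0")
          case True
          then show ?thesis using fs pos
            by (intro exI[of _ 1]) auto
        next
          case False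
          have "\<forall>\<^sub>F X in finite_subsets_at_top (Z - {0}). (\<Prod>\<rho>\<in>X. E s \<rho> powi zorder f \<rho>) = 0"
            unfolding eventually_finite_subsets_at_top
            using True False pos by (intro exI[of _ "{s}"]) (auto intro!: prod_zero bexI[of _ s] simp: power_int_0_left_if)
          then show ?thesis using fs by (intro exI[of _ 0]) (auto intro: tendsto_eventually)
        qed
      qed
    qed
  qed
qed

text \<open>
  The definition of the genus selects an arbitrary factorizing polynomial; its derivative does not
  depend on the choice because the exponentials agree on an open set.
\<close>
lemma hadamard_poly_unique:
  assumes "hadamard_factorization f Q1" "hadamard_factorization f Q2"
  shows "pderiv Q1 = pderiv Q2"
proof -
  have eq: "exp (poly (Q1 - Q2) z) = 1" if z: "z \<in> - (Z \<union> {0})" for z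
  proof -
    have "\<not> is_pole f z" and fz: "f z \<noteq> 0"
      using z zeros_poles_iff by (auto simp: zeros_poles_def)
    then obtain p1 p2 where p: "((\<lambda>X. \<Prod>\<rho>\<in>X. E z \<rho> powi zorder f \<rho>) \<longlongrightarrow> p1) (finite_subsets_at_top (Z - {0}))"
      "((\<lambda>X. \<Prod>\<rho>\<in>X. E z \<rho> powi zorder f \<rho>) \<longlongrightarrow> p2) (finite_subsets_at_top (Z - {0}))"
      "f z = z powi zorder f 0 * exp (poly Q1 z) * p1" "f z = z powi zorder f 0 * exp (poly Q2 z) * p2"
      using assms unfolding hadamard_factorization_def by blast
    have "p1 = p2" by (rule tendsto_unique[OF _ p(1,2)]) simp
    then have "exp (poly Q1 z) = exp (poly Q2 z)"
      using p(3,4) fz by (metis mult_cancel_left mult_cancel_right mult_eq_0_iff)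
    then show ?thesis by (simp add: exp_diff)
  qed
  have op: "open (- (Z \<union> {0}))" using closed_zeros_poles by auto
  have "poly (pderiv (Q1 - Q2)) z = poly 0 z" if z: "z \<in> - (Z \<union> {0})" for z
  proof -
    have "((\<lambda>z. exp (poly (Q1 - Q2) z)) has_field_derivative exp (poly (Q1 - Q2) z) * poly (pderiv (Q1 - Q2)) z) (at z)"
      by (rule DERIV_fun_exp[OF poly_DERIV])
    moreover have "((\<lambda>z. exp (poly (Q1 - Q2) z)) has_field_derivative 0) (at z)"
      by (rule has_field_derivative_transform_within_open[OF DERIV_const[of 1] op z]) (rule eq[symmetric])
    ultimately have "exp (poly (Q1 - Q2) z) * poly (pderiv (Q1 - Q2)) z = 0"
      by (rule DERIV_unique)
    then have "poly (pderiv (Q1 - Q2)) z = 0"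
      using exp_not_eq_zero by (metis mult_eq_0_iff)
    then show ?thesis by (simp only: poly_0)
  qed
  then have "pderiv (Q1 - Q2) = 0"
    using infinite_complement[of "{0}"] by (intro poly_eq_on_infinite[of "- (Z \<union> {0})"]) auto
  then show ?thesis by (simp add: pderiv_diff)
qed

lemma discrepancy_G_eq: "discrepancy_G f = G (complex_of_real (sigma1 f))"
  by (simp add: fun_eq_iff discrepancy_G_def G_def ml_term_def Let_def)

text \<open>
  With \<open>P\<^sub>0\<close> the polynomial for base point \<open>0\<close>, the discrepancy is \<open>(P - P\<^sub>0) - Q'\<close>; the first part has
  degree less than \<open>d - 1\<close> and the second one degree less than that of \<open>Q\<close>.
\<close>
theorem discrepancy_poly:
  shows "z \<notin> Z \<Longrightarrow> z \<noteq> complex_of_real (sigma1 f) \<Longrightarrow> poly (discrepancy_poly f) z = discrepancy_G f z - deriv f z / f z"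
    and "genus f \<le> j \<Longrightarrow> coeff (discrepancy_poly f) j = 0"
proof -
  let ?s = "complex_of_real (sigma1 f)"
  obtain P where P: "\<And>z. z \<notin> Z \<Longrightarrow> z \<noteq> ?s \<Longrightarrow> poly P z = G ?s z - deriv f z / f z"
    using log_derivative_poly[of ?s] by blast
  have eq: "discrepancy_poly f = P"
    unfolding discrepancy_poly_def
  proof (rule the_equality)
    show "\<forall>s. s \<notin> Z \<and> s \<noteq> ?s \<longrightarrow> poly P s = discrepancy_G f s - deriv f s / f s"
      using P by (simp add: discrepancy_G_eq)
    fix P' assume "\<forall>s. s \<notin> Z \<and> s \<noteq> ?s \<longrightarrow> poly P' s = discrepancy_G f s - deriv f s / f s"
    then show "P' = P"
      using P infinite_complement[of "{?s}"] by (intro poly_eq_on_infinite[of "- (Z \<union> {?s})"]) (auto simp: discrepancy_G_eq)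
  qed
  then show "z \<notin> Z \<Longrightarrow> z \<noteq> ?s \<Longrightarrow> poly (discrepancy_poly f) z = discrepancy_G f z - deriv f z / f z"
    using P by (simp add: discrepancy_G_eq)
  assume j: "genus f \<le> j"
  obtain P0 where P0: "\<And>z. z \<notin> Z \<Longrightarrow> z \<noteq> 0 \<Longrightarrow> poly P0 z = G 0 z - deriv f z / f z"
    using log_derivative_poly[of 0] by blast
  obtain Q where Q: "hadamard_factorization f Q" "pderiv Q = - P0"
    by (rule hadamard_factorization_exists[OF P0])
  have "hadamard_factorization f (hadamard_poly f)"
    unfolding hadamard_poly_def by (rule someI[of "hadamard_factorization f", OF Q(1)])
  then have "pderiv (hadamard_poly f) = - P0"
    using hadamard_poly_unique[OF _ Q(1)] Q(2) by simp
  moreover have "coeff (pderiv (hadamard_poly f)) j = 0"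
    using j by (simp add: coeff_pderiv coeff_eq_0 genus_def)
  moreover have "coeff (P - P0) j = 0"
    by (rule coeff_base_change[OF P P0]) (use j in \<open>auto simp: genus_def\<close>)
  ultimately show "coeff (discrepancy_poly f) j = 0"
    using eq by simp
qed

end

section \<open>Smooth functions and test functions\<close>
definition smooth :: "(real \<Rightarrow> complex) \<Rightarrow> bool" where
  "smooth \<phi> \<longleftrightarrow> (\<forall>n t. (tderiv ^^ n) \<phi> differentiable (at t))"

text \<open>
  Smoothness is the largest class of differentiable functions that is closed under \<open>tderiv\<close>.
\<close>
lemma smooth_coinduct:
  assumes "\<And>\<phi>. \<phi> \<in> S \<Longrightarrow> (\<forall>t. \<phi> differentiable (at t)) \<and> tderiv \<phi> \<in> S" "\<phi> \<in> S"
  shows "smooth \<phi>"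
proof -
  have "(tderiv ^^ n) \<phi> \<in> S" for n
    by (induction n) (use assms in auto)
  then show ?thesis using assms(1) unfolding smooth_def by blast
qed

lemma smooth_tderiv: "smooth \<phi> \<Longrightarrow> smooth (tderiv \<phi>)"
  unfolding smooth_def by (metis funpow_Suc_right o_apply)

lemma smooth_funpow_tderiv: "smooth \<phi> \<Longrightarrow> smooth ((tderiv ^^ n) \<phi>)"
  by (induction n) (auto intro: smooth_tderiv)

lemma has_tderiv: "smooth \<phi> \<Longrightarrow> (\<phi> has_vector_derivative tderiv \<phi> t) (at t)"
  unfolding smooth_def tderiv_def
  by (metis funpow_0 vector_derivative_works)

lemma tderivI: "(\<And>t. (\<phi> has_vector_derivative \<psi> t) (at t)) \<Longrightarrow> tderiv \<phi> = \<psi>"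
  by (auto simp: tderiv_def fun_eq_iff intro: vector_derivative_at)

lemma smooth_differentiable: "smooth \<phi> \<Longrightarrow> \<phi> differentiable (at t)"
  using has_tderiv differentiableI_vector by blast

lemma smooth_continuous: "smooth \<phi> \<Longrightarrow> continuous_on UNIV \<phi>"
  using smooth_differentiable by (auto intro!: continuous_at_imp_continuous_on differentiable_imp_continuous_within)

lemma tderiv_linear:
  assumes "smooth \<phi>" "smooth \<psi>"
  shows "tderiv (\<lambda>t. a * \<phi> t + \<psi> t) = (\<lambda>t. a * tderiv \<phi> t + tderiv \<psi> t)"
  by (intro tderivI has_vector_derivative_add has_vector_derivative_mult_right has_tderiv assms)

lemma smooth_linear:
  assumes "smooth \<phi>" "smooth \<psi>"
  shows "smooth (\<lambda>t. a * \<phi> t + \<psi> t)"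
proof (rule smooth_coinduct[where S = "{(\<lambda>t. a * \<phi> t + \<psi> t) | \<phi> \<psi>. smooth \<phi> \<and> smooth \<psi>}"])
  fix \<theta> assume "\<theta> \<in> {(\<lambda>t. a * \<phi> t + \<psi> t) | \<phi> \<psi>. smooth \<phi> \<and> smooth \<psi>}"
  then obtain \<phi> \<psi> where *: "\<theta> = (\<lambda>t. a * \<phi> t + \<psi> t)" "smooth \<phi>" "smooth \<psi>" by blast
  have "\<theta> differentiable (at t)" for t
    unfolding *(1) by (rule differentiableI_vector[OF has_vector_derivative_add[OF
          has_vector_derivative_mult_right[OF has_tderiv[OF *(2)]] has_tderiv[OF *(3)]]])
  moreover have "tderiv \<theta> \<in> {(\<lambda>t. a * \<phi> t + \<psi> t) | \<phi> \<psi>. smooth \<phi> \<and> smooth \<psi>}"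
    using tderiv_linear[OF *(2,3), of a] smooth_tderiv * by blast
  ultimately show "(\<forall>t. \<theta> differentiable (at t)) \<and> tderiv \<theta> \<in> {(\<lambda>t. a * \<phi> t + \<psi> t) | \<phi> \<psi>. smooth \<phi> \<and> smooth \<psi>}"
    by blast
qed (use assms in blast)

text \<open>
  The operator \<open>D + a\<close>, which is \<open>D\<close> conjugated by \<open>exp (a t)\<close>.
\<close>
definition twist :: "complex \<Rightarrow> (real \<Rightarrow> complex) \<Rightarrow> real \<Rightarrow> complex" where
  "twist a \<psi> = (\<lambda>t. a * \<psi> t + tderiv \<psi> t)"

lemma smooth_twist: "smooth \<psi> \<Longrightarrow> smooth (twist a \<psi>)"
  unfolding twist_def by (intro smooth_linear smooth_tderiv)

lemma has_vector_derivative_exp_mult: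
  assumes "smooth \<psi>"
  shows "((\<lambda>t. exp (a * of_real t) * \<psi> t) has_vector_derivative exp (a * of_real t) * twist a \<psi> t) (at t)"
proof -
  have "((\<lambda>z. exp (a * z)) has_field_derivative a * exp (a * of_real t)) (at (of_real t))"
    by (auto intro!: derivative_eq_intros)
  then have "((\<lambda>t. exp (a * of_real t)) has_vector_derivative a * exp (a * of_real t)) (at t)"
    by (rule has_vector_derivative_real_field)
  from has_vector_derivative_mult[OF this has_tderiv[OF assms]] show ?thesis
    by (simp add: twist_def algebra_simps)
qed

lemma tderiv_exp_mult: "smooth \<psi> \<Longrightarrow> tderiv (\<lambda>t. exp (a * of_real t) * \<psi> t) = (\<lambda>t. exp (a * of_real t) * twist a \<psi> t)"
  by (intro tderivI has_vector_derivative_exp_mult)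

lemma smooth_exp_mult:
  assumes "smooth \<psi>"
  shows "smooth (\<lambda>t. exp (a * of_real t) * \<psi> t)"
proof (rule smooth_coinduct[where S = "{(\<lambda>t. exp (a * of_real t) * \<psi> t) | \<psi>. smooth \<psi>}"])
  fix \<theta> assume "\<theta> \<in> {(\<lambda>t. exp (a * of_real t) * \<psi> t) | \<psi>. smooth \<psi>}"
  then obtain \<psi> where *: "\<theta> = (\<lambda>t. exp (a * of_real t) * \<psi> t)" "smooth \<psi>" by blast
  have "\<theta> differentiable (at t)" for t
    unfolding * using has_vector_derivative_exp_mult[OF *(2)] differentiableI_vector by blast
  moreover have "tderiv \<theta> \<in> {(\<lambda>t. exp (a * of_real t) * \<psi> t) | \<psi>. smooth \<psi>}"
    using tderiv_exp_mult[OF *(2)] smooth_twist * by blast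
  ultimately show "(\<forall>t. \<theta> differentiable (at t)) \<and> tderiv \<theta> \<in> {(\<lambda>t. exp (a * of_real t) * \<psi> t) | \<psi>. smooth \<psi>}"
    by blast
qed (use assms in blast)

lemma funpow_twist: "smooth \<psi> \<Longrightarrow> smooth ((twist a ^^ n) \<psi>)"
  by (induction n) (auto intro: smooth_twist)

lemma funpow_tderiv_exp_mult:
  "smooth \<psi> \<Longrightarrow> (tderiv ^^ n) (\<lambda>t. exp (a * of_real t) * \<psi> t) = (\<lambda>t. exp (a * of_real t) * (twist a ^^ n) \<psi> t)"
  by (induction n) (auto simp: tderiv_exp_mult funpow_twist)

lemma has_vector_derivative_dilation:
  assumes "smooth \<eta>"
  shows "((\<lambda>t. \<eta> (t / R)) has_vector_derivative of_real (1 / R) * tderiv \<eta> (t / R)) (at t)"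
proof -
  have "((\<eta> \<circ> (\<lambda>t. t / R)) has_vector_derivative (1 / R) *\<^sub>R tderiv \<eta> (t / R)) (at t)"
  proof (rule vector_diff_chain_at)
    have "((\<lambda>t. t / R) has_real_derivative 1 / R) (at t)"
      by (rule DERIV_cdivide[OF DERIV_ident])
    then show "((\<lambda>t. t / R) has_vector_derivative 1 / R) (at t)"
      by (simp add: has_real_derivative_iff_has_vector_derivative)
  qed (rule has_tderiv[OF assms])
  then show ?thesis by (simp add: o_def scaleR_conv_of_real)
qed

lemma smooth_dilation:
  assumes "smooth \<eta>"
  shows "smooth (\<lambda>t. \<eta> (t / R))"
proof (rule smooth_coinduct[where S = "{(\<lambda>t. c * \<eta> (t / R)) | c \<eta>. smooth \<eta>}"])
  fix \<theta> assume "\<theta> \<in> {(\<lambda>t. c * \<eta> (t / R)) | c \<eta>. smooth \<eta>}"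
  then obtain c \<eta> where *: "\<theta> = (\<lambda>t. c * \<eta> (t / R))" "smooth \<eta>" by blast
  have d: "(\<theta> has_vector_derivative c * (of_real (1 / R) * tderiv \<eta> (t / R))) (at t)" for t
    unfolding * by (intro has_vector_derivative_mult_right has_vector_derivative_dilation *)
  have "tderiv \<theta> = (\<lambda>t. (c * of_real (1 / R)) * tderiv \<eta> (t / R))"
    using tderivI[OF d] by (simp add: mult.assoc)
  then show "(\<forall>t. \<theta> differentiable (at t)) \<and> tderiv \<theta> \<in> {(\<lambda>t. c * \<eta> (t / R)) | c \<eta>. smooth \<eta>}"
    using d differentiableI_vector smooth_tderiv[OF *(2)] by blast
qed (use assms in \<open>auto intro!: exI[of _ 1] exI[of _ \<eta>]\<close>)

text \<open>
  Each derivative that falls on the dilated function brings a factor \<open>1 / R\<close>.  Only the coefficient of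
  the term without such a factor matters when \<open>R\<close> tends to infinity.
\<close>
lemma twist_dilation_expansion:
  assumes "smooth \<eta>"
  shows "\<exists>c. c 0 = a ^ n \<and> (\<forall>R t. (twist a ^^ n) (\<lambda>t. \<eta> (t / R)) t
      = (\<Sum>j\<le>n. c j * of_real ((1 / R) ^ j) * (tderiv ^^ j) \<eta> (t / R)))"
proof (induction n)
  case 0
  show ?case by (intro exI[of _ "\<lambda>_. 1"]) auto
next
  case (Suc n)
  then obtain c where c: "c 0 = a ^ n" "\<And>R. (twist a ^^ n) (\<lambda>t. \<eta> (t / R))
      = (\<lambda>t. \<Sum>j\<le>n. c j * of_real ((1 / R) ^ j) * (tderiv ^^ j) \<eta> (t / R))"
    by (auto simp: fun_eq_iff)
  define c' where "c' j = a * (if j \<le> n then c j else 0) + (if j = 0 then 0 else c (j - 1))" for j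
  have "(twist a ^^ Suc n) (\<lambda>t. \<eta> (t / R)) t
      = (\<Sum>j\<le>Suc n. c' j * of_real ((1 / R) ^ j) * (tderiv ^^ j) \<eta> (t / R))" for R t
  proof -
    have d: "((\<lambda>t. \<Sum>j\<le>n. c j * of_real ((1 / R) ^ j) * (tderiv ^^ j) \<eta> (t / R)) has_vector_derivative
       (\<Sum>j\<le>n. c j * of_real ((1 / R) ^ j) * (of_real (1 / R) * tderiv ((tderiv ^^ j) \<eta>) (t / R)))) (at t)" for t
      by (intro has_vector_derivative_sum has_vector_derivative_mult_right has_vector_derivative_dilation
          smooth_funpow_tderiv assms)
    have "(twist a ^^ Suc n) (\<lambda>t. \<eta> (t / R)) t = a * (\<Sum>j\<le>n. c j * of_real ((1 / R) ^ j) * (tderiv ^^ j) \<eta> (t / R))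
      + (\<Sum>j\<le>n. c j * of_real ((1 / R) ^ j) * (of_real (1 / R) * tderiv ((tderiv ^^ j) \<eta>) (t / R)))"
      unfolding funpow.simps o_apply c(2) twist_def tderivI[OF d] ..
    also have "a * (\<Sum>j\<le>n. c j * of_real ((1 / R) ^ j) * (tderiv ^^ j) \<eta> (t / R))
       = (\<Sum>j\<le>Suc n. a * (if j \<le> n then c j else 0) * of_real ((1 / R) ^ j) * (tderiv ^^ j) \<eta> (t / R))"
      by (simp add: sum_distrib_left mult.assoc)
    also have "(\<Sum>j\<le>n. c j * of_real ((1 / R) ^ j) * (of_real (1 / R) * tderiv ((tderiv ^^ j) \<eta>) (t / R)))
       = (\<Sum>j\<le>Suc n. (if j = 0 then 0 else c (j - 1)) * of_real ((1 / R) ^ j) * (tderiv ^^ j) \<eta> (t / R))"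
      unfolding sum.atMost_Suc_shift by (simp add: mult_ac)
    finally show ?thesis
      by (simp only: c'_def distrib_right sum.distrib)
  qed
  then show ?case
    by (intro exI[of _ c']) (auto simp: c'_def c(1))
qed

lemma test_function_smooth: "test_function \<phi> \<Longrightarrow> smooth \<phi>"
  by (simp add: test_function_def smooth_def)

lemma test_functionI:
  assumes "smooth \<phi>" "compact K" "\<And>t. t \<notin> K \<Longrightarrow> \<phi> t = 0"
  shows "test_function \<phi>"
proof -
  have "closure {t. \<phi> t \<noteq> 0} \<subseteq> K"
    using assms by (intro closure_minimal) (auto intro: compact_imp_closed)
  then show ?thesis
    using compact_Int_closed[OF assms(2) closed_closure, of "{t. \<phi> t \<noteq> 0}"] assms(1)
    unfolding test_function_def smooth_def by (simp only: Int_absorb1) blast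
qed

lemma tderiv_vanishes:
  assumes "open U" "t \<in> U" "\<And>x. x \<in> U \<Longrightarrow> \<phi> x = (c::complex)"
  shows "tderiv \<phi> t = 0"
proof -
  have "(\<phi> has_vector_derivative 0) (at t)"
    by (rule has_vector_derivative_transform_within_open[OF has_vector_derivative_const[of c] assms(1,2)]) (simp add: assms)
  then show ?thesis unfolding tderiv_def by (rule vector_derivative_at)
qed

lemma funpow_tderiv_vanishes:
  assumes "open U" "\<And>x. x \<in> U \<Longrightarrow> \<phi> x = (0::complex)" "t \<in> U"
  shows "(tderiv ^^ n) \<phi> t = 0"
  using assms(3) by (induction n arbitrary: t) (use assms tderiv_vanishes[OF assms(1)] in auto)

lemma funpow_tderiv_outside_support:
  "t \<notin> closure {t. \<phi> t \<noteq> 0} \<Longrightarrow> (tderiv ^^ n) \<phi> t = 0"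
  by (rule funpow_tderiv_vanishes[of "- closure {t. \<phi> t \<noteq> 0}"]) (auto intro: closure_subset[THEN subsetD])

lemma test_function_funpow: 
  assumes "test_function \<phi>"
  shows "test_function ((tderiv ^^ n) \<phi>)"
proof (rule test_functionI)
  show "compact (closure {t. \<phi> t \<noteq> 0})" using assms by (simp only: test_function_def)
qed (rule smooth_funpow_tderiv[OF test_function_smooth[OF assms]], rule funpow_tderiv_outside_support)

lemma test_function_tderiv: "test_function \<phi> \<Longrightarrow> test_function (tderiv \<phi>)"
  using test_function_funpow[of \<phi> 1] by simp

lemma test_function_exp_mult:
  assumes "test_function \<phi>"
  shows "test_function (\<lambda>t. exp (a * of_real t) * \<phi> t)"
proof (rule test_functionI)
  show "compact (closure {t. \<phi> t \<noteq> 0})" using assms by (simp only: test_function_def)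
  fix t assume "t \<notin> closure {t. \<phi> t \<noteq> 0}"
  then have "\<phi> t = 0" using closure_subset[of "{t. \<phi> t \<noteq> 0}"] by blast
  then show "exp (a * of_real t) * \<phi> t = 0" by simp
qed (rule smooth_exp_mult[OF test_function_smooth[OF assms]])

lemma test_function_support:
  assumes "test_function \<phi>"
  obtains r where "r > 0" "\<And>t. \<bar>t\<bar> > r \<Longrightarrow> \<phi> t = 0"
proof -
  have "bounded (closure {t. \<phi> t \<noteq> 0})"
    using assms compact_imp_bounded by (auto simp: test_function_def)
  then obtain r where r: "r > 0" "\<And>t. t \<in> closure {t. \<phi> t \<noteq> 0} \<Longrightarrow> norm t \<le> r"
    unfolding bounded_pos by blast
  have "\<phi> t = 0" if "\<bar>t\<bar> > r" for t
    using r(2)[of t] that closure_subset[of "{t. \<phi> t \<noteq> 0}"] by force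
  then show ?thesis using that r by blast
qed

lemma test_function_continuous: "test_function \<phi> \<Longrightarrow> continuous_on A \<phi>"
  using smooth_continuous[OF test_function_smooth] continuous_on_subset by blast

lemma test_function_measurable: "test_function \<phi> \<Longrightarrow> \<phi> \<in> borel_measurable borel"
  by (intro borel_measurable_continuous_onI test_function_continuous)

lemma test_function_bounded:
  assumes "test_function \<phi>"
  obtains M where "M > 0" "\<And>t. norm (\<phi> t) \<le> M"
proof -
  obtain r where r: "r > 0" "\<And>t. \<bar>t\<bar> > r \<Longrightarrow> \<phi> t = 0" using test_function_support[OF assms] by blast
  have "compact (\<phi> ` {-r..r})"
    by (intro compact_continuous_image test_function_continuous assms) auto
  then have "bounded (\<phi> ` {-r..r})" by (rule compact_imp_bounded)
  then obtain M where M: "M > 0" "\<forall>y\<in>\<phi> ` {-r..r}. norm y \<le> M"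
    unfolding bounded_pos by blast
  have "norm (\<phi> t) \<le> M" for t
  proof (cases "\<bar>t\<bar> > r")
    case True
    then show ?thesis using r(2)[of t] M(1) by simp
  next
    case False
    then have "t \<in> {-r..r}" by auto
    then show ?thesis using M(2) by simp
  qed
  then show ?thesis using that[of M] M(1) by simp
qed

lemma test_function_integrable:
  assumes "test_function \<phi>"
  shows "integrable lborel \<phi>"
proof -
  obtain r where r: "r > 0" "\<And>t. \<bar>t\<bar> > r \<Longrightarrow> \<phi> t = 0" using test_function_support[OF assms] by blast
  have "set_integrable lborel {-r..r} \<phi>"
    by (intro borel_integrable_atLeastAtMost' test_function_continuous assms)
  moreover have "(\<lambda>t. indicator {-r..r} t *\<^sub>R \<phi> t) = \<phi>"
  proof
    fix t show "indicator {-r..r} t *\<^sub>R \<phi> t = \<phi> t"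
    proof (cases "\<bar>t\<bar> > r")
      case True
      then show ?thesis using r(2)[of t] by simp
    next
      case False
      then have "t \<in> {-r..r}" by auto
      then show ?thesis by simp
    qed
  qed
  ultimately show ?thesis by (simp add: set_integrable_def)
qed

lemma integral_tderiv_zero:
  assumes "test_function \<phi>"
  shows "(LBINT t. tderiv \<phi> t) = 0"
proof -
  obtain r where r: "r > 0" "\<And>t. \<bar>t\<bar> > r \<Longrightarrow> \<phi> t = 0" using test_function_support[OF assms] by blast
  define b where "b = r + 1"
  have b: "b > r" "b > 0" using r(1) by (simp_all add: b_def)
  have op: "open {t :: real. r < \<bar>t\<bar>}" by (intro open_Collect_less continuous_intros)
  have zero: "tderiv \<phi> t = 0" if "\<bar>t\<bar> > r" for t
    by (rule tderiv_vanishes[OF op, of _ _ 0]) (use that r(2) in blast)+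
  have eq: "tderiv \<phi> t = indicator {- b..b} t *\<^sub>R tderiv \<phi> t" for t
  proof (cases "\<bar>t\<bar> > r")
    case True
    then show ?thesis by (simp only: zero scaleR_zero_right)
  next
    case False
    then have "t \<in> {- b..b}" using b(1) by auto
    then show ?thesis by (simp only: indicator_simps scaleR_one)
  qed
  have "(LBINT t. tderiv \<phi> t) = (LBINT t. indicator {- b..b} t *\<^sub>R tderiv \<phi> t)"
    by (rule Bochner_Integration.integral_cong[OF refl eq])
  also have "\<dots> = \<phi> b - \<phi> (- b)"
  proof (rule integral_FTC_atLeastAtMost)
    show "(\<phi> has_vector_derivative tderiv \<phi> t) (at t within {- b..b})" for t
      by (rule has_vector_derivative_at_within[OF has_tderiv[OF test_function_smooth[OF assms]]])
    show "continuous_on {- b..b} (tderiv \<phi>)"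
      by (intro test_function_continuous test_function_tderiv assms)
  qed (use b in linarith)
  also have "\<dots> = 0" using r(2)[of b] r(2)[of "- b"] b by simp
  finally show ?thesis .
qed

lemma distr_deriv_funpow: "(distr_deriv ^^ n) T \<phi> = (- 1) ^ n * T ((tderiv ^^ n) \<phi>)"
proof (induction n arbitrary: \<phi>)
  case (Suc n)
  have "(distr_deriv ^^ Suc n) T \<phi> = - (distr_deriv ^^ n) T (tderiv \<phi>)"
    by (simp add: distr_deriv_def)
  also have "\<dots> = (- 1) ^ Suc n * T ((tderiv ^^ n) (tderiv \<phi>))"
    unfolding Suc by simp
  also have "(tderiv ^^ n) (tderiv \<phi>) = (tderiv ^^ Suc n) \<phi>"
    by (simp only: funpow_Suc_right o_apply)
  finally show ?case .
qed simp

section \<open>Fourier inversion and pairings on a vertical line\<close>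

text \<open>
  The exponent has a plus sign, because this is the transform that \<open>exp (s t)\<close> in the inverse Laplace
  integral produces on test functions.
\<close>
definition bilateral_laplace :: "(real \<Rightarrow> complex) \<Rightarrow> complex \<Rightarrow> complex" where
  "bilateral_laplace \<phi> z = (LBINT t. exp (z * of_real t) * \<phi> t)"

lemma bilateral_laplace_tderiv:
  assumes "test_function \<phi>"
  shows "bilateral_laplace (tderiv \<phi>) z = - z * bilateral_laplace \<phi> z"
proof -
  note t = test_function_exp_mult
  have "0 = (LBINT t. tderiv (\<lambda>t. exp (z * of_real t) * \<phi> t) t)"
    by (rule integral_tderiv_zero[symmetric]) (rule t[OF assms])
  also have "\<dots> = (LBINT t. z * (exp (z * of_real t) * \<phi> t) + exp (z * of_real t) * tderiv \<phi> t)"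
    unfolding tderiv_exp_mult[OF test_function_smooth[OF assms]] twist_def by (simp add: algebra_simps)
  also have "\<dots> = (LBINT t. z * (exp (z * of_real t) * \<phi> t)) + bilateral_laplace (tderiv \<phi>) z"
    unfolding bilateral_laplace_def
    by (intro Bochner_Integration.integral_add integrable_mult_right test_function_integrable t test_function_tderiv assms)
  also have "(LBINT t. z * (exp (z * of_real t) * \<phi> t)) = z * bilateral_laplace \<phi> z"
    unfolding bilateral_laplace_def by (rule integral_mult_right_zero)
  finally show ?thesis by (simp add: eq_neg_iff_add_eq_0 add.commute)
qed

lemma bilateral_laplace_funpow_tderiv: "test_function \<phi> \<Longrightarrow> bilateral_laplace ((tderiv ^^ n) \<phi>) z = (- z) ^ n * bilateral_laplace \<phi> z"
  by (induction n) (auto simp: bilateral_laplace_tderiv test_function_funpow)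

lemma bilateral_laplace_exp_mult: "bilateral_laplace (\<lambda>t. exp (a * of_real t) * \<phi> t) z = bilateral_laplace \<phi> (z + a)"
  by (simp add: bilateral_laplace_def distrib_right exp_add mult.assoc)

text \<open>
  Multiplication by \<open>z ^ n\<close> is differentiation of the test function up to sign; the bound is the
  \<open>L\<^sup>1\<close> norm of the differentiated function.
\<close>
lemma bilateral_laplace_decay:
  assumes "test_function \<phi>"
  obtains M where "M \<ge> 0" "\<And>v. norm (bilateral_laplace \<phi> (Complex c v)) * norm (Complex c v) ^ n \<le> M"
proof -
  define M where "M = (LBINT t. norm (exp (of_real c * of_real t) * (tderiv ^^ n) \<phi> t))"
  have "norm (bilateral_laplace \<phi> (Complex c v)) * norm (Complex c v) ^ n \<le> M" for v
  proof -
    have "norm (bilateral_laplace \<phi> (Complex c v)) * norm (Complex c v) ^ n = norm (bilateral_laplace ((tderiv ^^ n) \<phi>) (Complex c v))"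
      using bilateral_laplace_funpow_tderiv[OF assms] by (simp add: norm_mult norm_power mult.commute)
    also have "\<dots> \<le> (LBINT t. norm (exp (Complex c v * of_real t) * (tderiv ^^ n) \<phi> t))"
      unfolding bilateral_laplace_def by (rule integral_norm_bound)
    also have "\<dots> = M"
      unfolding M_def by (simp add: norm_mult)
    finally show ?thesis .
  qed
  moreover have "M \<ge> 0" unfolding M_def by simp
  ultimately show ?thesis using that by blast
qed

lemma bilateral_laplace_continuous:
  assumes "test_function \<phi>"
  shows "continuous_on UNIV (\<lambda>v. bilateral_laplace \<phi> (Complex c v))"
proof (rule continuous_at_imp_continuous_on, safe)
  fix v :: real
  have int: "integrable lborel (\<lambda>t. norm (exp (of_real c * of_real t) * \<phi> t))"
    by (intro integrable_norm test_function_integrable test_function_exp_mult assms)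
  show "isCont (\<lambda>v. bilateral_laplace \<phi> (Complex c v)) v"
    unfolding isCont_def bilateral_laplace_def
  proof (rule tendsto_at_iff_sequentially[THEN iffD2], safe)
    fix X :: "nat \<Rightarrow> real" assume X: "X \<longlonglongrightarrow> v"
    show "((\<lambda>v. LBINT t. exp (Complex c v * of_real t) * \<phi> t) \<circ> X) \<longlonglongrightarrow> (LBINT t. exp (Complex c v * of_real t) * \<phi> t)"
      unfolding o_def
    proof (rule integral_dominated_convergence[OF _ _ int])
      show "AE t in lborel. (\<lambda>i. exp (Complex c (X i) * of_real t) * \<phi> t) \<longlonglongrightarrow> exp (Complex c v * of_real t) * \<phi> t"
        by (intro AE_I2 tendsto_intros tendsto_Complex X)
      show "AE t in lborel. norm (exp (Complex c (X i) * of_real t) * \<phi> t) \<le> norm (exp (of_real c * of_real t) * \<phi> t)" for i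
        by (simp add: norm_mult)
    qed (use test_function_exp_mult[OF assms] in \<open>auto intro: test_function_measurable\<close>)
  qed
qed

lemma integrable_inverse_square: "integrable lborel (\<lambda>x::real. inverse (1 + x\<^sup>2))"
  using integrable_inverse_1_plus_square by (simp add: set_integrable_def einterval_def)

lemma integrable_vertical_line:
  fixes h :: "real \<Rightarrow> complex"
  assumes c: "c > 0" and cont: "continuous_on UNIV h"
    and bound: "\<And>v. norm (h v) * norm (Complex c v) ^ 2 \<le> C"
  shows "integrable lborel h"
proof -
  define q where "q = min 1 (c\<^sup>2)"
  have q: "q > 0" using c by (simp add: q_def)
  have le: "norm (h v) \<le> norm (C / q * inverse (1 + v\<^sup>2))" for v
  proof -
    have "q * (1 + v\<^sup>2) = q + q * v\<^sup>2" by (simp add: distrib_left)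
    also have "\<dots> \<le> c\<^sup>2 + 1 * v\<^sup>2"
      by (intro add_mono mult_right_mono) (auto simp: q_def)
    also have "\<dots> = norm (Complex c v) ^ 2" by (simp add: cmod_power2)
    finally have "norm (h v) * (q * (1 + v\<^sup>2)) \<le> norm (h v) * norm (Complex c v) ^ 2"
      by (intro mult_left_mono) auto
    also have "\<dots> \<le> C" by (rule bound)
    finally have "norm (h v) * (q * (1 + v\<^sup>2)) \<le> C" .
    moreover have "0 < q * (1 + v\<^sup>2)" using q by (simp add: add_pos_nonneg)
    ultimately have "norm (h v) \<le> C / (q * (1 + v\<^sup>2))" by (simp only: pos_le_divide_eq)
    also have "\<dots> = C / q * inverse (1 + v\<^sup>2)" by (simp add: divide_inverse)
    finally have le: "norm (h v) \<le> C / q * inverse (1 + v\<^sup>2)" .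
    show ?thesis unfolding real_norm_def by (rule order_trans[OF le abs_ge_self])
  qed
  have "integrable lborel (\<lambda>v. C / q * inverse (1 + v\<^sup>2))"
    by (intro integrable_mult_right integrable_inverse_square)
  moreover have "h \<in> borel_measurable lborel"
    using cont by (simp add: borel_measurable_continuous_onI)
  ultimately show ?thesis
    by (rule Bochner_Integration.integrable_bound) (use le in auto)
qed

lemma integrable_times_bilateral_laplace:
  assumes \<phi>: "test_function \<phi>" and c: "c > 0" and cont: "continuous_on UNIV (\<lambda>v. F (Complex c v))"
    and bound: "\<And>v. norm (F (Complex c v)) \<le> C * norm (Complex c v) ^ k"
  shows "integrable lborel (\<lambda>v. F (Complex c v) * bilateral_laplace \<phi> (Complex c v))"
proof -
  obtain M where M: "M \<ge> 0" "\<And>v. norm (bilateral_laplace \<phi> (Complex c v)) * norm (Complex c v) ^ (k + 2) \<le> M"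
    using bilateral_laplace_decay[OF \<phi>] by blast
  have "0 \<le> C * norm (Complex c 0) ^ k" by (rule order_trans[OF norm_ge_zero bound])
  moreover have "norm (Complex c 0) ^ k > 0"
    using c by (simp add: complex_norm)
  ultimately have C: "C \<ge> 0" by (metis not_le zero_le_mult_iff)
  show ?thesis
  proof (rule integrable_vertical_line[OF c, where C = "C * M"])
    show "continuous_on UNIV (\<lambda>v. F (Complex c v) * bilateral_laplace \<phi> (Complex c v))"
      by (intro continuous_intros cont bilateral_laplace_continuous \<phi>)
    fix v
    have "norm (F (Complex c v) * bilateral_laplace \<phi> (Complex c v)) * norm (Complex c v) ^ 2
        \<le> C * norm (Complex c v) ^ k * norm (bilateral_laplace \<phi> (Complex c v)) * norm (Complex c v) ^ 2"
      unfolding norm_mult by (intro mult_right_mono bound) auto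
    also have "\<dots> = C * (norm (bilateral_laplace \<phi> (Complex c v)) * norm (Complex c v) ^ (k + 2))"
      unfolding power_add by (simp only: mult_ac)
    also have "\<dots> \<le> C * M"
      by (intro mult_left_mono M C)
    finally show "norm (F (Complex c v) * bilateral_laplace \<phi> (Complex c v)) * norm (Complex c v) ^ 2 \<le> C * M" .
  qed
qed

lemma fubini_bounded_kernel:
  fixes A B :: "real \<Rightarrow> complex" and K :: "real \<Rightarrow> real \<Rightarrow> complex"
  assumes A: "integrable lborel A" and B: "integrable lborel B"
    and K: "(\<lambda>(x, y). K x y) \<in> borel_measurable (lborel \<Otimes>\<^sub>M lborel)" "\<And>x y. norm (K x y) \<le> 1"
  shows "(LBINT y. B y * (LBINT x. A x * K x y)) = (LBINT x. A x * (LBINT y. B y * K x y))"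
proof -
  have [measurable]: "A \<in> borel_measurable borel" "B \<in> borel_measurable borel"
    using A B by auto
  note [measurable] = K(1)
  let ?h = "\<lambda>(x, y). A x * B y * K x y"
  have m: "?h \<in> borel_measurable (lborel \<Otimes>\<^sub>M lborel)"
    using K(1) by measurable
  have prod: "integrable (lborel \<Otimes>\<^sub>M lborel) (\<lambda>(x, y). A x * B y)"
  proof (rule lborel_pair.Fubini_integrable)
    show "(\<lambda>(x, y). A x * B y) \<in> borel_measurable (lborel \<Otimes>\<^sub>M lborel)" by measurable
    show "integrable lborel (\<lambda>x. LBINT y. norm (case (x, y) of (x, y) \<Rightarrow> A x * B y))"
      using A by (simp add: norm_mult)
    show "AE x in lborel. integrable lborel (\<lambda>y. case (x, y) of (x, y) \<Rightarrow> A x * B y)"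
      using B by simp
  qed
  have "integrable (lborel \<Otimes>\<^sub>M lborel) ?h"
  proof (rule Bochner_Integration.integrable_bound[OF prod m], intro AE_I2, clarify)
    fix x y
    show "norm (A x * B y * K x y) \<le> norm (A x * B y)"
      using mult_left_mono[OF K(2)[of x y], of "norm (A x * B y)"] by (simp add: norm_mult)
  qed
  then have "(LBINT y. LBINT x. A x * B y * K x y) = (LBINT x. LBINT y. A x * B y * K x y)"
    by (rule lborel_pair.Fubini_integral)
  moreover have "(LBINT x. A x * B y * K x y) = B y * (LBINT x. A x * K x y)" for y
    by (subst Bochner_Integration.integral_mult_right_zero[symmetric]) (simp add: mult_ac)
  moreover have "(LBINT y. A x * B y * K x y) = A x * (LBINT y. B y * K x y)" for x
    by (subst Bochner_Integration.integral_mult_right_zero[symmetric]) (simp add: mult_ac)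
  ultimately show ?thesis by simp
qed

lemma Complex_expand: "Complex a b = of_real a + \<i> * of_real b"
  by (simp add: complex_eq_iff)

lemma continuous_on_Complex_line [continuous_intros]: "continuous_on A (Complex c)"
  unfolding Complex_expand[abs_def] by (intro continuous_intros)

lemma integral_gaussian_fourier:
  "(LBINT y. of_real (std_normal_density y) * exp (\<i> * of_real (a * y))) = of_real (exp (- a\<^sup>2 / 2))"
proof -
  have "of_real (exp (- a\<^sup>2 / 2)) = char std_normal_distribution a"
    by (simp add: char_std_normal_distribution)
  also have "\<dots> = (LBINT y. std_normal_density y *\<^sub>R exp (\<i> * of_real (a * y)))"
    unfolding char_def by (subst integral_density) (auto simp: normal_density_nonneg)
  finally show ?thesis by (simp add: scaleR_conv_of_real)
qed

text \<open>
  Gaussian regularization: multiply the transform by the Gaussian of width \<open>k\<close>.  By Fubini and the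
  transform of the Gaussian its integral becomes an average of \<open>x\<close> over a scale \<open>1 / k\<close>.  Both sides
  converge by dominated convergence as \<open>k\<close> tends to infinity.
\<close>
lemma fourier_inversion_at_zero:
  fixes x :: "real \<Rightarrow> complex"
  assumes cont: "continuous_on UNIV x" and bdd: "\<And>t. norm (x t) \<le> M" and int: "integrable lborel x"
    and int': "integrable lborel (\<lambda>v. LBINT t. exp (\<i> * of_real (v * t)) * x t)"
  shows "(LBINT v. LBINT t. exp (\<i> * of_real (v * t)) * x t) = of_real (2 * pi) * x 0"
proof -
  define X where "X v = (LBINT t. exp (\<i> * of_real (v * t)) * x t)" for v
  define g where "g y = complex_of_real (std_normal_density y)" for y
  have g_int: "integrable lborel g"
    unfolding g_def[abs_def]
    using integrable_bounded_linear[OF bounded_linear_of_real integrable_std_normal_moment[of 0]] by simp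
  have g_meas [measurable]: "g \<in> borel_measurable borel"
    using g_int by auto
  have x_meas [measurable]: "x \<in> borel_measurable borel"
    using int by auto
  have g_bdd: "norm (g y) \<le> 1" for y
  proof -
    have "norm (g y) = std_normal_density y"
      by (simp add: g_def normal_density_nonneg)
    also have "\<dots> = 1 / sqrt (2 * pi) * exp (- y\<^sup>2 / 2)"
      by (rule std_normal_density_def)
    also have "\<dots> \<le> 1 * 1"
      using pi_ge_two by (intro mult_mono) (auto simp: real_le_rsqrt)
    finally show ?thesis by simp
  qed
  have e_gauss: "exp (- (y\<^sup>2) / 2) = sqrt (2 * pi) * std_normal_density y" for y :: real
    by (simp add: std_normal_density_def)
  have key: "(LBINT v. X v * g (v / k)) = of_real (sqrt (2 * pi)) * (LBINT y. x (y / k) * g y)" if k: "k > 0" for k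
  proof -
    have gk: "integrable lborel (\<lambda>v. g (v / k))"
      using lborel_integrable_real_affine[OF g_int, of "1 / k" 0] k by (simp add: divide_inverse mult.commute)
    have "(LBINT v. X v * g (v / k)) = (LBINT v. g (v / k) * (LBINT t. x t * exp (\<i> * of_real (v * t))))"
      by (simp add: X_def mult.commute)
    also have "\<dots> = (LBINT t. x t * (LBINT v. g (v / k) * exp (\<i> * of_real (v * t))))"
    proof (rule fubini_bounded_kernel[OF int gk])
      have "continuous_on UNIV (\<lambda>p. exp (\<i> * complex_of_real (snd p * fst p)))"
        by (intro continuous_intros)
      then show "(\<lambda>(t, v). exp (\<i> * complex_of_real (v * t))) \<in> borel_measurable (lborel \<Otimes>\<^sub>M lborel)"
        by (simp add: lborel_prod case_prod_beta borel_measurable_continuous_onI)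
    qed simp
    also have "\<dots> = (LBINT t. x t * (of_real k * of_real (exp (- (k * t)\<^sup>2 / 2))))"
    proof -
      have "(LBINT v. g (v / k) * exp (\<i> * of_real (v * t))) = of_real k * of_real (exp (- (k * t)\<^sup>2 / 2))" for t
      proof -
        have "(LBINT v. g (v / k) * exp (\<i> * of_real (v * t)))
            = \<bar>k\<bar> *\<^sub>R (LBINT y. g ((0 + k * y) / k) * exp (\<i> * of_real ((0 + k * y) * t)))"
          by (rule lborel_integral_real_affine) (use k in simp)
        also have "(LBINT y. g ((0 + k * y) / k) * exp (\<i> * of_real ((0 + k * y) * t)))
            = (LBINT y. of_real (std_normal_density y) * exp (\<i> * of_real ((k * t) * y)))"
          using k by (simp add: g_def mult_ac)
        finally show ?thesis
          unfolding integral_gaussian_fourier using k by (simp add: scaleR_conv_of_real)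
      qed
      then show ?thesis by simp
    qed
    also have "\<dots> = \<bar>1 / k\<bar> *\<^sub>R (LBINT y. x (0 + 1 / k * y) * (of_real k * of_real (exp (- (k * (0 + 1 / k * y))\<^sup>2 / 2))))"
      by (rule lborel_integral_real_affine) (use k in simp)
    also have "\<dots> = (LBINT y. (1 / k) *\<^sub>R (x (y / k) * (of_real k * of_real (exp (- (y\<^sup>2) / 2)))))"
      using k by simp
    also have "\<dots> = (LBINT y. of_real (sqrt (2 * pi)) * (x (y / k) * g y))"
      unfolding e_gauss using k by (intro Bochner_Integration.integral_cong) (simp_all add: g_def scaleR_conv_of_real)
    finally show ?thesis by simp
  qed
  define k where "k n = real (Suc n)" for n
  have k: "k n > 0" for n by (simp add: k_def)
  have inv_k: "(\<lambda>n. y / k n) \<longlonglongrightarrow> 0" for y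
    unfolding k_def by (rule LIMSEQ_Suc[OF lim_const_over_n])
  have cont_g: "isCont g 0"
    unfolding g_def std_normal_density_def by (intro continuous_intros) auto
  have cont_x: "isCont x 0" using cont by (simp add: continuous_on_eq_continuous_at)
  have "(\<lambda>n. LBINT v. X v * g (v / k n)) \<longlonglongrightarrow> (LBINT v. X v * g 0)"
  proof (rule integral_dominated_convergence)
    show "integrable lborel (\<lambda>v. norm (X v))" using int' by (simp add: X_def)
    have "X \<in> borel_measurable borel" using int' by (auto simp: X_def[abs_def])
    then show "(\<lambda>v. X v * g 0) \<in> borel_measurable lborel" "(\<lambda>v. X v * g (v / k n)) \<in> borel_measurable lborel" for n
      by measurable
    show "AE v in lborel. (\<lambda>n. X v * g (v / k n)) \<longlonglongrightarrow> X v * g 0"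
      by (intro AE_I2 tendsto_intros isCont_tendsto_compose[OF cont_g] inv_k)
    show "AE v in lborel. norm (X v * g (v / k n)) \<le> norm (X v)" for n
      using g_bdd by (auto simp: norm_mult mult_left_le)
  qed
  moreover have "(\<lambda>n. LBINT v. X v * g (v / k n)) \<longlonglongrightarrow> of_real (sqrt (2 * pi)) * x 0"
  proof -
    have "(\<lambda>n. LBINT y. x (y / k n) * g y) \<longlonglongrightarrow> (LBINT y. x 0 * g y)"
    proof (rule integral_dominated_convergence)
      show "integrable lborel (\<lambda>y. M * norm (g y))" using g_int by simp
      show "AE y in lborel. (\<lambda>n. x (y / k n) * g y) \<longlonglongrightarrow> x 0 * g y"
        by (intro AE_I2 tendsto_intros isCont_tendsto_compose[OF cont_x] inv_k)
      show "AE y in lborel. norm (x (y / k n) * g y) \<le> M * norm (g y)" for n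
        using bdd by (auto simp: norm_mult mult_right_mono)
    qed measurable
    moreover have "(LBINT y. g y) = 1"
      using integral_gaussian_fourier[of 0] by (simp add: g_def)
    ultimately have "(\<lambda>n. LBINT y. x (y / k n) * g y) \<longlonglongrightarrow> x 0"
      by (simp only: integral_mult_right_zero mult_1_right)
    then show ?thesis
      unfolding key[OF k] by (intro tendsto_intros)
  qed
  ultimately have "(LBINT v. X v * g 0) = of_real (sqrt (2 * pi)) * x 0"
    by (rule LIMSEQ_unique)
  then have "(LBINT v. X v) * g 0 = of_real (sqrt (2 * pi)) * x 0" by simp
  moreover have "g 0 = 1 / of_real (sqrt (2 * pi))"
    by (simp add: g_def std_normal_density_def)
  ultimately have "(LBINT v. X v) = of_real (sqrt (2 * pi)) * of_real (sqrt (2 * pi)) * x 0"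
    by (simp add: field_simps)
  also have "of_real (sqrt (2 * pi)) * of_real (sqrt (2 * pi)) = complex_of_real (2 * pi)"
    by (simp only: of_real_mult[symmetric] real_sqrt_mult_self) simp
  finally show ?thesis by (simp add: X_def)
qed

text \<open>
  The Fourier inversion formula at the origin for the translate by \<open>t\<close> of \<open>\<phi>\<close> times an exponential.
\<close>
lemma bilateral_laplace_inversion:
  assumes \<phi>: "test_function \<phi>" and c: "c > 0"
  shows "(LBINT v. bilateral_laplace \<phi> (Complex c v) * exp (- Complex c v * of_real t)) = of_real (2 * pi) * \<phi> t"
proof -
  define \<psi> where "\<psi> = (\<lambda>x. exp (of_real c * of_real x) * \<phi> x)"
  have \<psi>: "test_function \<psi>" unfolding \<psi>_def by (rule test_function_exp_mult[OF \<phi>])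
  define x where "x s = exp (- of_real c * of_real t) * \<psi> (t + s)" for s
  have FLx: "(LBINT s. exp (\<i> * of_real (v * s)) * x s) = bilateral_laplace \<phi> (Complex c v) * exp (- Complex c v * of_real t)" for v
  proof -
    have "bilateral_laplace \<phi> (Complex c v) * exp (- Complex c v * of_real t)
        = (LBINT y. exp (Complex c v * of_real y) * \<phi> y * exp (- Complex c v * of_real t))"
      unfolding bilateral_laplace_def by simp
    also have "\<dots> = (LBINT s. exp (Complex c v * of_real (t + 1 * s)) * \<phi> (t + 1 * s) * exp (- Complex c v * of_real t))"
      by (subst lborel_integral_real_affine[where c = 1 and t = t]) auto
    also have "\<dots> = (LBINT s. exp (\<i> * of_real (v * s)) * x s)"
      unfolding x_def \<psi>_def Complex_expand
      by (intro Bochner_Integration.integral_cong refl) (simp add: exp_add[symmetric] algebra_simps flip: exp_add)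
    finally show ?thesis by simp
  qed
  obtain M where M: "M > 0" "\<And>y. norm (\<psi> y) \<le> M" using test_function_bounded[OF \<psi>] by blast
  have "(LBINT v. LBINT s. exp (\<i> * of_real (v * s)) * x s) = of_real (2 * pi) * x 0"
  proof (rule fourier_inversion_at_zero)
    have "continuous_on UNIV (\<lambda>s. \<psi> (t + s))"
      by (rule continuous_on_compose2[OF test_function_continuous[OF \<psi>, of UNIV]]) (auto intro!: continuous_intros)
    then show "continuous_on UNIV x" unfolding x_def[abs_def] by (intro continuous_intros)
    show "norm (x s) \<le> norm (exp (- of_real c * of_real t :: complex)) * M" for s
      unfolding x_def norm_mult by (intro mult_left_mono M) simp
    show "integrable lborel x"
      unfolding x_def[abs_def]
      using lborel_integrable_real_affine[OF test_function_integrable[OF \<psi>], of 1 t] by simp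
    have "integrable lborel (\<lambda>v. exp (- Complex c v * of_real t) * bilateral_laplace \<phi> (Complex c v))"
      by (rule integrable_times_bilateral_laplace[OF \<phi> c, where k = 0 and C = "exp (- c * t)"])
        (auto intro!: continuous_intros)
    then show "integrable lborel (\<lambda>v. LBINT s. exp (\<i> * of_real (v * s)) * x s)"
      unfolding FLx by (simp add: mult.commute)
  qed
  also have "x 0 = \<phi> t"
    by (simp add: x_def \<psi>_def flip: exp_add mult.assoc)
  finally show ?thesis unfolding FLx .
qed

text \<open>
  A power \<open>z ^ j\<close> turns \<open>\<Phi>\<close> into the transform of a derivative, and inversion at \<open>0\<close> evaluates that
  derivative.
\<close>
lemma polynomial_delta_pairing:
  assumes \<phi>: "test_function \<phi>" and c: "c > 0" and P: "\<And>j. N \<le> j \<Longrightarrow> coeff P j = 0"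
  shows "integrable lborel (\<lambda>v. poly P (Complex c v) * bilateral_laplace \<phi> (Complex c v))"
    and "(LBINT v. poly P (Complex c v) * bilateral_laplace \<phi> (Complex c v))
      = of_real (2 * pi) * (\<Sum>j<N. coeff P j * (distr_deriv ^^ j) dirac0 \<phi>)"
proof -
  have pow: "(Complex c v) ^ j * bilateral_laplace \<phi> (Complex c v) = (- 1) ^ j * bilateral_laplace ((tderiv ^^ j) \<phi>) (Complex c v)" for j v
    unfolding bilateral_laplace_funpow_tderiv[OF \<phi>] by (simp add: power_mult_distrib[symmetric] mult.assoc[symmetric])
  have int: "integrable lborel (\<lambda>v. coeff P j * ((Complex c v) ^ j * bilateral_laplace \<phi> (Complex c v)))" for j
  proof (rule integrable_mult_right)
    show "integrable lborel (\<lambda>v. (Complex c v) ^ j * bilateral_laplace \<phi> (Complex c v))"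
      by (rule integrable_times_bilateral_laplace[OF \<phi> c, where k = j and C = 1]) (auto intro!: continuous_intros simp: norm_power)
  qed
  have inv: "(LBINT v. (Complex c v) ^ j * bilateral_laplace \<phi> (Complex c v)) = of_real (2 * pi) * (distr_deriv ^^ j) dirac0 \<phi>" for j
    using bilateral_laplace_inversion[OF test_function_funpow[OF \<phi>, of j] c, of 0]
    unfolding pow by (simp add: distr_deriv_funpow dirac0_def)
  have eq: "poly P z * w = (\<Sum>j<N. coeff P j * (z ^ j * w))" for z w
  proof -
    have "poly P z = (\<Sum>j\<le>degree P. coeff P j * z ^ j)" by (rule poly_altdef)
    also have "\<dots> = (\<Sum>j<max N (Suc (degree P)). coeff P j * z ^ j)"
      by (rule sum.mono_neutral_left) (auto simp: coeff_eq_0)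
    also have "\<dots> = (\<Sum>j<N. coeff P j * z ^ j)"
      by (rule sum.mono_neutral_right) (auto simp: P)
    finally show ?thesis by (simp add: sum_distrib_right mult.assoc)
  qed
  show "integrable lborel (\<lambda>v. poly P (Complex c v) * bilateral_laplace \<phi> (Complex c v))"
    unfolding eq by (intro Bochner_Integration.integrable_sum int)
  have "(LBINT v. poly P (Complex c v) * bilateral_laplace \<phi> (Complex c v))
      = (\<Sum>j<N. LBINT v. coeff P j * ((Complex c v) ^ j * bilateral_laplace \<phi> (Complex c v)))"
    unfolding eq by (intro Bochner_Integration.integral_sum int)
  then show "(LBINT v. poly P (Complex c v) * bilateral_laplace \<phi> (Complex c v))
      = of_real (2 * pi) * (\<Sum>j<N. coeff P j * (distr_deriv ^^ j) dirac0 \<phi>)"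
    unfolding integral_mult_right_zero inv by (simp add: sum_distrib_left mult_ac)
qed

lemma polynomial_growth_line:
  assumes "polynomial_growth F c k" "c > 0"
  obtains C where "continuous_on UNIV (\<lambda>v. F (Complex c v))"
    "\<And>v. norm (F (Complex c v)) \<le> C * norm (Complex c v) ^ k"
proof -
  obtain C where hol: "F holomorphic_on {s. Re s \<ge> c}"
    and C: "\<And>s. Re s \<ge> c \<Longrightarrow> norm (F s) \<le> C * (1 + norm s) ^ k"
    using assms(1) unfolding polynomial_growth_def by blast
  have "continuous_on UNIV (\<lambda>v. F (Complex c v))"
    by (rule continuous_on_compose2[OF holomorphic_on_imp_continuous_on[OF hol] continuous_on_Complex_line]) auto
  moreover have "norm (F (Complex c v)) \<le> \<bar>C\<bar> * (1 / c + 1) ^ k * norm (Complex c v) ^ k" for v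
  proof -
    have "c \<le> norm (Complex c v)" using complex_Re_le_cmod[of "Complex c v"] by simp
    then have "1 + norm (Complex c v) \<le> (1 / c + 1) * norm (Complex c v)"
      using assms(2) by (simp add: field_simps)
    then have "(1 + norm (Complex c v)) ^ k \<le> ((1 / c + 1) * norm (Complex c v)) ^ k"
      by (intro power_mono) auto
    then have "\<bar>C\<bar> * (1 + norm (Complex c v)) ^ k \<le> \<bar>C\<bar> * ((1 / c + 1) * norm (Complex c v)) ^ k"
      by (rule mult_left_mono) simp
    moreover have "norm (F (Complex c v)) \<le> C * (1 + norm (Complex c v)) ^ k" by (rule C) simp
    moreover have "C * (1 + norm (Complex c v)) ^ k \<le> \<bar>C\<bar> * (1 + norm (Complex c v)) ^ k"
      by (intro mult_right_mono) auto
    ultimately show ?thesis by (simp only: power_mult_distrib mult.assoc)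
  qed
  ultimately show ?thesis using that by blast
qed

text \<open>
  The \<open>m\<close> derivatives are moved to the test function.  After Fubini they become a factor \<open>(- z) ^ m\<close>, which cancels the
  denominator that was inserted for convergence; in particular \<open>m\<close> no longer appears.
\<close>
lemma inverse_laplace_pairing:
  assumes \<phi>: "test_function \<phi>" and c: "c > 0" and F: "polynomial_growth F c k" and m: "m \<ge> k + 2"
  shows "of_real (2 * pi) * inverse_laplace c m F \<phi> = (LBINT v. F (Complex c v) * bilateral_laplace \<phi> (Complex c v))"
proof -
  obtain C where cont: "continuous_on UNIV (\<lambda>v. F (Complex c v))"
    and C: "\<And>v. norm (F (Complex c v)) \<le> C * norm (Complex c v) ^ k"
    using polynomial_growth_line[OF F c] by blast
  have nz: "Complex c v \<noteq> 0" for v using c by (simp add: complex_eq_iff)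
  have cn: "c \<le> norm (Complex c v)" for v using complex_Re_le_cmod[of "Complex c v"] by simp
  define H where "H v = F (Complex c v) / Complex c v ^ m" for v
  have H_int: "integrable lborel H"
  proof (rule integrable_vertical_line[OF c, where C = "C / c ^ (m - (k + 2))"])
    show "continuous_on UNIV H"
      unfolding H_def[abs_def] by (intro continuous_intros cont) (use nz in auto)
    fix v
    define n where "n = norm (Complex c v)"
    have n: "n > 0" "c \<le> n" using nz[of v] cn[of v] by (auto simp: n_def)
    have "0 \<le> C * n ^ k" using C[of v] norm_ge_zero order_trans unfolding n_def by blast
    then have C0: "C \<ge> 0" using n(1) by (metis not_le zero_le_mult_iff zero_less_power)
    have "norm (H v) * n ^ 2 = norm (F (Complex c v)) / n ^ m * n ^ 2"
      by (simp add: H_def n_def norm_divide norm_power)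
    also have "\<dots> \<le> C * n ^ k / n ^ m * n ^ 2"
      using C[of v] n by (intro mult_right_mono divide_right_mono) (auto simp: n_def)
    also have "\<dots> = C / n ^ (m - (k + 2))"
    proof -
      have "n ^ m = n ^ ((m - (k + 2)) + (k + 2))"
        by (simp only: le_add_diff_inverse2[OF m])
      then have "n ^ m = n ^ (m - (k + 2)) * (n ^ k * n ^ 2)"
        by (simp only: power_add)
      then show ?thesis using n by (simp add: field_simps)
    qed
    also have "\<dots> \<le> C / c ^ (m - (k + 2))"
      using n c C0 by (intro divide_left_mono power_mono mult_pos_pos zero_less_power) auto
    finally show "norm (H v) * norm (Complex c v) ^ 2 \<le> C / c ^ (m - (k + 2))"
      by (simp add: n_def)
  qed
  define A where "A t = exp (of_real c * of_real t) * (tderiv ^^ m) \<phi> t" for t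
  have A_int: "integrable lborel A"
    unfolding A_def[abs_def] by (intro test_function_integrable test_function_exp_mult test_function_funpow \<phi>)
  define K where "K t v = exp (\<i> * of_real (v * t))" for t v :: real
  have K_meas: "(\<lambda>(t, v). K t v) \<in> borel_measurable (lborel \<Otimes>\<^sub>M lborel)"
  proof -
    have "continuous_on UNIV (\<lambda>p. exp (\<i> * complex_of_real (snd p * fst p)))"
      by (intro continuous_intros)
    then show ?thesis
      by (simp add: K_def lborel_prod case_prod_beta borel_measurable_continuous_onI)
  qed
  have e: "exp (Complex c v * of_real t) = exp (of_real c * of_real t) * K t v" for t v
  proof -
    have "Complex c v * of_real t = of_real c * of_real t + \<i> * of_real (v * t)"
      by (simp add: Complex_expand algebra_simps)
    then show ?thesis unfolding K_def by (simp only: exp_add)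
  qed
  have "of_real (2 * pi) * inverse_laplace c m F \<phi>
      = (- 1) ^ m * (of_real (2 * pi) * (LBINT t. (LBINT v. F (Complex c v) / Complex c v ^ m * exp (Complex c v * of_real t)
                   / of_real (2 * pi)) * (tderiv ^^ m) \<phi> t))"
    by (simp add: inverse_laplace_def distr_deriv_funpow distr_of_fun_def)
  also have "of_real (2 * pi) * (LBINT t. (LBINT v. F (Complex c v) / Complex c v ^ m * exp (Complex c v * of_real t)
                   / of_real (2 * pi)) * (tderiv ^^ m) \<phi> t)
      = (LBINT t. A t * (LBINT v. H v * K t v))"
  proof -
    have "(LBINT v. F (Complex c v) / Complex c v ^ m * exp (Complex c v * of_real t) / of_real (2 * pi))
       = exp (of_real c * of_real t) * (LBINT v. H v * K t v) / of_real (2 * pi)" for t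
    proof -
      have "(LBINT v. F (Complex c v) / Complex c v ^ m * exp (Complex c v * of_real t) / of_real (2 * pi))
         = (LBINT v. exp (of_real c * of_real t) / of_real (2 * pi) * (H v * K t v))"
        unfolding e H_def by (intro Bochner_Integration.integral_cong) (simp_all add: mult_ac)
      then show ?thesis by simp
    qed
    then have "(LBINT t. (LBINT v. F (Complex c v) / Complex c v ^ m * exp (Complex c v * of_real t)
                   / of_real (2 * pi)) * (tderiv ^^ m) \<phi> t)
        = (LBINT t. 1 / of_real (2 * pi) * (A t * (LBINT v. H v * K t v)))"
      by (intro Bochner_Integration.integral_cong) (simp_all add: A_def)
    then show ?thesis by simp
  qed
  also have "(LBINT t. A t * (LBINT v. H v * K t v)) = (LBINT v. H v * (LBINT t. A t * K t v))"
    by (rule fubini_bounded_kernel[OF A_int H_int K_meas, symmetric]) (simp add: K_def)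
  also have "(LBINT v. H v * (LBINT t. A t * K t v)) = (LBINT v. (- 1) ^ m * (F (Complex c v) * bilateral_laplace \<phi> (Complex c v)))"
  proof (intro Bochner_Integration.integral_cong refl)
    fix v
    have "(LBINT t. A t * K t v) = bilateral_laplace ((tderiv ^^ m) \<phi>) (Complex c v)"
      unfolding bilateral_laplace_def e A_def by (simp add: mult_ac)
    also have "\<dots> = (- 1) ^ m * Complex c v ^ m * bilateral_laplace \<phi> (Complex c v)"
      unfolding bilateral_laplace_funpow_tderiv[OF \<phi>] by (simp add: power_minus[of "Complex c v"])
    finally show "H v * (LBINT t. A t * K t v) = (- 1) ^ m * (F (Complex c v) * bilateral_laplace \<phi> (Complex c v))"
      using nz[of v] by (simp add: H_def)
  qed
  also have "(LBINT v. (- 1) ^ m * (F (Complex c v) * bilateral_laplace \<phi> (Complex c v)))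
      = (- 1) ^ m * (LBINT v. F (Complex c v) * bilateral_laplace \<phi> (Complex c v))"
    by (rule integral_mult_right_zero)
  finally show ?thesis by (simp flip: mult.assoc power_mult_distrib)
qed

section \<open>Distributions with a Laplace transform on a half plane\<close>

text \<open>
  The shape of the Newton-Cramer distribution: \<open>exp (\<sigma> t)\<close> times the \<open>d\<close>-th derivative of a function
  on the half line of subexponential growth.
\<close>
locale laplace_density =
  fixes u :: "real \<Rightarrow> complex" and d :: nat and \<sigma> :: real
  assumes u_meas: "u \<in> borel_measurable borel"
    and u_neg: "\<And>t. t < 0 \<Longrightarrow> u t = 0"
    and u_int: "\<And>\<epsilon>. \<epsilon> > 0 \<Longrightarrow> integrable lborel (\<lambda>t. exp (- of_real \<epsilon> * of_real t) * u t)"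
begin

definition W :: distr where
  "W = distr_mult (\<lambda>t. exp (complex_of_real (\<sigma> * t))) ((distr_deriv ^^ d) (distr_of_fun u))"

definition W_laplace :: "complex \<Rightarrow> complex" where
  "W_laplace s = (s - of_real \<sigma>) ^ d * (LBINT t. exp (- (s - of_real \<sigma>) * of_real t) * u t)"

lemma W_eq: "W \<phi> = (- 1) ^ d * (LBINT t. u t * (tderiv ^^ d) (\<lambda>t. exp (of_real \<sigma> * of_real t) * \<phi> t) t)"
  by (simp add: W_def distr_mult_def distr_deriv_funpow distr_of_fun_def)

lemma u_int_complex:
  assumes "Re s > 0"
  shows "integrable lborel (\<lambda>t. exp (- s * of_real t) * u t)"
proof (rule Bochner_Integration.integrable_bound[OF u_int[OF assms]])
  show "(\<lambda>t. exp (- s * of_real t) * u t) \<in> borel_measurable lborel"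
  proof -
    have "(\<lambda>t. exp (- s * of_real t)) \<in> borel_measurable borel"
      by (intro borel_measurable_continuous_onI continuous_intros)
    then show ?thesis using u_meas by simp
  qed
qed (simp add: norm_mult)

lemma W_supported: "supported_nonneg W"
  unfolding supported_nonneg_def
proof (intro allI impI, elim conjE)
  fix \<phi> assume \<phi>: "test_function \<phi>" "closure {t. \<phi> t \<noteq> 0} \<subseteq> {..<0}"
  have z: "u t * (tderiv ^^ d) (\<lambda>t. exp (of_real \<sigma> * of_real t) * \<phi> t) t = 0" for t
  proof (cases "t < 0")
    case False
    then have "t \<in> - closure {t. \<phi> t \<noteq> 0}" using \<phi>(2) by auto
    then have "(tderiv ^^ d) (\<lambda>t. exp (of_real \<sigma> * of_real t) * \<phi> t) t = 0"
      by (rule funpow_tderiv_vanishes[of "- closure {t. \<phi> t \<noteq> 0}", rotated 2])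
        (use closure_subset[of "{t. \<phi> t \<noteq> 0}"] in auto)
    then show ?thesis by simp
  qed (simp add: u_neg)
  show "W \<phi> = 0" unfolding W_eq z by simp
qed

text \<open>
  The \<open>d\<close> derivatives act on \<open>exp ((\<sigma> - s) t)\<close> times the cut-off.  By \<open>twist_dilation_expansion\<close> this tends to
  \<open>(\<sigma> - s) ^ d * exp ((\<sigma> - s) t)\<close> pointwise, with a bound that is uniform for \<open>R \<ge> 1\<close>.
\<close>
lemma W_pairing_exp:
  assumes s: "Re s > \<sigma>"
  shows "pairing_exp W s (W_laplace s)"
  unfolding pairing_exp_def
proof (intro allI impI, elim conjE)
  fix \<eta> assume \<eta>: "test_function \<eta>" "\<forall>\<^sub>F t in nhds 0. \<eta> t = 1"
  have sm: "smooth \<eta>" by (rule test_function_smooth[OF \<eta>(1)])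
  have \<eta>0: "\<eta> 0 = 1" using \<eta>(2) by (rule eventually_nhds_x_imp_x)
  define a where "a = of_real \<sigma> - s"
  obtain c where c: "c 0 = a ^ d" "\<And>R t. (twist a ^^ d) (\<lambda>t. \<eta> (t / R)) t
      = (\<Sum>j\<le>d. c j * of_real ((1 / R) ^ j) * (tderiv ^^ j) \<eta> (t / R))"
    using twist_dilation_expansion[OF sm, of a d] by blast
  have "\<exists>M. \<forall>t. norm ((tderiv ^^ j) \<eta> t) \<le> M" for j
    using test_function_bounded[OF test_function_funpow[OF \<eta>(1)]] by metis
  then obtain M where M: "\<And>j t. norm ((tderiv ^^ j) \<eta> t) \<le> M j" by metis
  define B where "B = (\<Sum>j\<le>d. norm (c j) * M j)"
  have bound: "norm ((twist a ^^ d) (\<lambda>t. \<eta> (t / R)) t) \<le> B" if "R \<ge> 1" for R t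
    unfolding c(2) B_def
  proof (rule sum_norm_le)
    fix j
    have "\<bar>(1 / R) ^ j\<bar> \<le> 1" using that by (simp add: power_abs power_le_one divide_le_eq_1)
    then have "norm (c j) * \<bar>(1 / R) ^ j\<bar> * norm ((tderiv ^^ j) \<eta> (t / R)) \<le> norm (c j) * 1 * M j"
      by (intro mult_mono M) auto
    then show "norm (c j * of_real ((1 / R) ^ j) * (tderiv ^^ j) \<eta> (t / R)) \<le> norm (c j) * M j"
      by (simp only: norm_mult norm_of_real mult_1_right)
  qed
  have lim: "((\<lambda>R. (twist a ^^ d) (\<lambda>t. \<eta> (t / R)) t) \<longlongrightarrow> a ^ d) at_top" for t
  proof -
    have inv: "((\<lambda>R. x / R) \<longlongrightarrow> 0) at_top" for x :: real
      by (rule tendsto_divide_0[OF tendsto_const filterlim_at_top_imp_at_infinity[OF filterlim_ident]])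
    have "((\<lambda>R. (tderiv ^^ j) \<eta> (t / R)) \<longlongrightarrow> (tderiv ^^ j) \<eta> 0) at_top" for j
    proof (rule isCont_tendsto_compose[OF _ inv])
      show "isCont ((tderiv ^^ j) \<eta>) 0"
        using smooth_continuous[OF smooth_funpow_tderiv[OF sm]] by (simp add: continuous_on_eq_continuous_at)
    qed
    then have "((\<lambda>R. \<Sum>j\<le>d. c j * of_real ((1 / R) ^ j) * (tderiv ^^ j) \<eta> (t / R)) \<longlongrightarrow>
        (\<Sum>j\<le>d. c j * of_real (0 ^ j) * (tderiv ^^ j) \<eta> 0)) at_top"
      by (intro tendsto_sum tendsto_mult tendsto_const tendsto_of_real tendsto_power inv)
    also have "(\<Sum>j\<le>d. c j * of_real (0 ^ j) * (tderiv ^^ j) \<eta> 0) = (\<Sum>j\<in>{0}. c j * of_real (0 ^ j) * (tderiv ^^ j) \<eta> 0)"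
      by (rule sum.mono_neutral_right) auto
    finally show ?thesis unfolding c(2) by (simp add: c(1) \<eta>0)
  qed
  have W_R: "W (\<lambda>t. \<eta> (t / R) * exp (- s * of_real t))
      = (- 1) ^ d * (LBINT t. exp (a * of_real t) * u t * (twist a ^^ d) (\<lambda>t. \<eta> (t / R)) t)" for R
  proof -
    have E: "(\<lambda>t. exp (of_real \<sigma> * of_real t) * (\<eta> (t / R) * exp (- s * of_real t))) = (\<lambda>t. exp (a * of_real t) * \<eta> (t / R))"
      by (simp add: a_def fun_eq_iff left_diff_distrib exp_diff exp_minus field_simps)
    show ?thesis
      unfolding W_eq E funpow_tderiv_exp_mult[OF smooth_dilation[OF sm]] by (simp add: mult_ac)
  qed
  have int: "integrable lborel (\<lambda>t. exp (a * of_real t) * u t)"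
    using u_int_complex[of "s - of_real \<sigma>"] s by (simp add: a_def)
  have "((\<lambda>R. LBINT t. exp (a * of_real t) * u t * (twist a ^^ d) (\<lambda>t. \<eta> (t / R)) t) \<longlongrightarrow>
      (LBINT t. exp (a * of_real t) * u t * a ^ d)) at_top"
  proof (rule integral_dominated_convergence_at_top)
    show "integrable lborel (\<lambda>t. norm (exp (a * of_real t) * u t) * B)"
      using int by simp
    have m: "(\<lambda>t. exp (a * of_real t) * u t) \<in> borel_measurable borel" using int by auto
    then show "(\<lambda>t. exp (a * of_real t) * u t * a ^ d) \<in> borel_measurable lborel" by simp
    have "(twist a ^^ d) (\<lambda>t. \<eta> (t / R)) \<in> borel_measurable borel" for R
      by (intro borel_measurable_continuous_onI smooth_continuous funpow_twist smooth_dilation sm)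
    then show "(\<lambda>t. exp (a * of_real t) * u t * (twist a ^^ d) (\<lambda>t. \<eta> (t / R)) t) \<in> borel_measurable lborel" for R
      using m by simp
    show "AE t in lborel. ((\<lambda>R. exp (a * of_real t) * u t * (twist a ^^ d) (\<lambda>t. \<eta> (t / R)) t) \<longlongrightarrow>
        exp (a * of_real t) * u t * a ^ d) at_top"
      by (intro AE_I2 tendsto_intros lim)
    show "\<forall>\<^sub>F R in at_top. AE t in lborel. norm (exp (a * of_real t) * u t * (twist a ^^ d) (\<lambda>t. \<eta> (t / R)) t)
        \<le> norm (exp (a * of_real t) * u t) * B"
      using eventually_ge_at_top[of "1::real"]
    proof eventually_elim
      case (elim R)
      show ?case
        unfolding norm_mult[of "exp (a * of_real _) * u _"] by (intro AE_I2 mult_left_mono bound elim) simp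
    qed
  qed
  then have "((\<lambda>R. W (\<lambda>t. \<eta> (t / R) * exp (- s * of_real t))) \<longlongrightarrow> (- 1) ^ d * (LBINT t. exp (a * of_real t) * u t * a ^ d)) at_top"
    unfolding W_R by (intro tendsto_intros)
  also have "(- 1) ^ d * (LBINT t. exp (a * of_real t) * u t * a ^ d) = W_laplace s"
  proof -
    have "(- 1) ^ d * a ^ d = (s - of_real \<sigma>) ^ d"
      by (simp add: a_def flip: power_mult_distrib)
    moreover have "W_laplace s = (s - of_real \<sigma>) ^ d * (LBINT t. exp (a * of_real t) * u t)"
      by (simp add: W_laplace_def a_def)
    moreover have "(- 1) ^ d * (LBINT t. exp (a * of_real t) * u t * a ^ d) = (- 1) ^ d * a ^ d * (LBINT t. exp (a * of_real t) * u t)"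
      unfolding integral_mult_left_zero by (simp only: mult_ac)
    ultimately show ?thesis by (simp only:)
  qed
  finally show "((\<lambda>R. W (\<lambda>t. \<eta> (t / R) * exp (- s * of_real t))) \<longlongrightarrow> W_laplace s) at_top" .
qed

text \<open>
  Insert the Laplace integral of \<open>u\<close>, exchange the integrals, and apply Fourier inversion on the line
  \<open>Re s = c - \<sigma>\<close> to the test function that \<open>u\<close> is paired with in \<open>W_eq\<close>.
\<close>
lemma W_parseval:
  assumes \<phi>: "test_function \<phi>" and c: "c > 0" "c > \<sigma>"
  shows "of_real (2 * pi) * W \<phi> = (LBINT v. W_laplace (Complex c v) * bilateral_laplace \<phi> (Complex c v))"
proof -
  define \<psi> where "\<psi> = (\<lambda>t. exp (of_real \<sigma> * of_real t) * \<phi> t)"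
  have \<psi>: "test_function \<psi>" unfolding \<psi>_def by (rule test_function_exp_mult[OF \<phi>])
  \<comment> \<open>The factor \<open>exp (\<sigma> t)\<close> shifts the line of integration.\<close>
  define e where "e = c - \<sigma>"
  have e: "e > 0" using c by (simp add: e_def)
  have Ce: "Complex c v - of_real \<sigma> = Complex e v" for v by (simp add: e_def complex_eq_iff)
  have FLd: "bilateral_laplace ((tderiv ^^ d) \<psi>) (Complex e v) = (- Complex e v) ^ d * bilateral_laplace \<phi> (Complex c v)" for v
  proof -
    have "Complex e v + of_real \<sigma> = Complex c v" by (simp add: e_def complex_eq_iff)
    then show ?thesis unfolding bilateral_laplace_funpow_tderiv[OF \<psi>] unfolding \<psi>_def bilateral_laplace_exp_mult by simp
  qed
  define A where "A t = exp (- of_real e * of_real t) * u t" for t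
  have A_int: "integrable lborel A" unfolding A_def[abs_def] by (rule u_int[OF e])
  define B where "B v = bilateral_laplace ((tderiv ^^ d) \<psi>) (Complex e v)" for v
  have B_int: "integrable lborel B"
    using integrable_times_bilateral_laplace[OF test_function_funpow[OF \<psi>] e, of "\<lambda>_. 1" 1 0 d] by (simp add: B_def[abs_def])
  define K where "K t v = exp (- (\<i> * of_real (v * t)))" for t v :: real
  have K_meas: "(\<lambda>(t, v). K t v) \<in> borel_measurable (lborel \<Otimes>\<^sub>M lborel)"
  proof -
    have "continuous_on UNIV (\<lambda>p. exp (- (\<i> * complex_of_real (snd p * fst p))))"
      by (intro continuous_intros)
    then show ?thesis
      by (simp add: K_def lborel_prod case_prod_beta borel_measurable_continuous_onI)
  qed
  have eK: "exp (- Complex e v * of_real t) = exp (- of_real e * of_real t) * K t v" for t v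
  proof -
    have "- Complex e v * of_real t = - of_real e * of_real t + - (\<i> * of_real (v * t))"
      by (simp add: Complex_expand algebra_simps)
    then show ?thesis unfolding K_def by (simp only: exp_add)
  qed
  have "(LBINT v. W_laplace (Complex c v) * bilateral_laplace \<phi> (Complex c v)) = (LBINT v. (- 1) ^ d * (B v * (LBINT t. A t * K t v)))"
  proof (intro Bochner_Integration.integral_cong refl)
    fix v
    have "W_laplace (Complex c v) = Complex e v ^ d * (LBINT t. A t * K t v)"
      unfolding W_laplace_def Ce eK A_def by (simp add: mult_ac)
    moreover have "(- 1) ^ d * B v = Complex e v ^ d * bilateral_laplace \<phi> (Complex c v)"
      unfolding B_def FLd by (simp flip: mult.assoc power_mult_distrib)
    ultimately show "W_laplace (Complex c v) * bilateral_laplace \<phi> (Complex c v) = (- 1) ^ d * (B v * (LBINT t. A t * K t v))"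
      by (simp flip: mult.assoc)
  qed
  also have "\<dots> = (- 1) ^ d * (LBINT v. B v * (LBINT t. A t * K t v))" by simp
  also have "(LBINT v. B v * (LBINT t. A t * K t v)) = (LBINT t. A t * (LBINT v. B v * K t v))"
    by (rule fubini_bounded_kernel[OF A_int B_int K_meas]) (simp add: K_def)
  also have "\<dots> = (LBINT t. of_real (2 * pi) * (u t * (tderiv ^^ d) \<psi> t))"
  proof (intro Bochner_Integration.integral_cong refl)
    fix t
    have "exp (- of_real e * of_real t) * (LBINT v. B v * K t v) = (LBINT v. B v * exp (- Complex e v * of_real t))"
      unfolding eK by (simp add: mult_ac flip: Bochner_Integration.integral_mult_right_zero)
    also have "\<dots> = of_real (2 * pi) * (tderiv ^^ d) \<psi> t"
      unfolding B_def by (rule bilateral_laplace_inversion[OF test_function_funpow[OF \<psi>] e])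
    finally show "A t * (LBINT v. B v * K t v) = of_real (2 * pi) * (u t * (tderiv ^^ d) \<psi> t)"
      by (simp add: A_def mult_ac)
  qed
  finally show ?thesis unfolding W_eq \<psi>_def by simp
qed

end

section \<open>The kernel of the Newton-Cramer distribution\<close>
lemma integrable_power_exp:
  assumes e: "e > 0"
  shows "integrable lborel (\<lambda>t::real. indicator {0..} t * (t ^ k * exp (- e * t)))"
proof -
  have "integrable lborel (erlang_density k e)"
  proof (rule integrableI_nonneg)
    have "(\<integral>\<^sup>+ x. ennreal (erlang_density k e x) \<partial>lborel) = 1"
      using nn_integral_erlang_ith_moment[OF e, where k = k and i = 0] by simp
    then show "(\<integral>\<^sup>+ x. ennreal (erlang_density k e x) \<partial>lborel) < \<infinity>" by simp
  qed (use e in auto)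
  then have "integrable lborel (\<lambda>t. fact k / e ^ Suc k * erlang_density k e t)"
    by (rule integrable_mult_right)
  moreover have "fact k / e ^ Suc k * erlang_density k e t = indicator {0..} t * (t ^ k * exp (- e * t))" for t
    using e by (simp add: erlang_density_def indicator_def)
  ultimately show ?thesis by simp
qed

lemma power_exp_tendsto_0:
  assumes e: "(e::real) > 0"
  shows "((\<lambda>t. t ^ k * exp (- e * t)) \<longlongrightarrow> 0) at_top"
proof -
  have "filterlim (\<lambda>t. e * t) at_top at_top"
    by (rule filterlim_tendsto_pos_mult_at_top[OF tendsto_const e filterlim_ident])
  from filterlim_compose[OF tendsto_power_div_exp_0 this, of k]
  have "((\<lambda>t. (e * t) ^ k / exp (e * t) / e ^ k) \<longlongrightarrow> 0 / e ^ k) at_top"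
    using e by (intro tendsto_divide tendsto_const) auto
  moreover have "(e * t) ^ k / exp (e * t) / e ^ k = t ^ k * exp (- e * t)" for t
    using e by (simp add: power_mult_distrib exp_minus field_simps)
  ultimately show ?thesis by simp
qed

lemma half_line_integral:
  fixes F f :: "real \<Rightarrow> complex"
  assumes F: "\<And>t. (F has_vector_derivative f t) (at t)" and cont: "continuous_on UNIV f"
    and int: "integrable lborel (\<lambda>t. indicator {0..} t *\<^sub>R f t)" and lim: "(F \<longlongrightarrow> L) at_top"
  shows "(LBINT t. indicator {0..} t *\<^sub>R f t) = L - F 0"
proof -
  have [measurable]: "f \<in> borel_measurable borel"
    by (intro borel_measurable_continuous_onI cont)
  have "(\<lambda>n. LBINT t. indicator {0..real n} t *\<^sub>R f t) \<longlonglongrightarrow> (LBINT t. indicator {0..} t *\<^sub>R f t)"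
  proof (rule integral_dominated_convergence)
    show "integrable lborel (\<lambda>t. norm (indicator {0..} t *\<^sub>R f t))"
      using int by (rule integrable_norm)
    show "AE t in lborel. (\<lambda>n. indicator {0..real n} t *\<^sub>R f t) \<longlonglongrightarrow> indicator {0..} t *\<^sub>R f t"
    proof (intro AE_I2 tendsto_eventually)
      fix t :: real
      have "\<forall>\<^sub>F n in sequentially. real n \<ge> t"
        using filterlim_real_sequentially unfolding filterlim_at_top by blast
      then show "\<forall>\<^sub>F n in sequentially. indicator {0..real n} t *\<^sub>R f t = indicator {0..} t *\<^sub>R f t"
        by eventually_elim (auto simp: indicator_def)
    qed
    show "AE t in lborel. norm (indicator {0..real n} t *\<^sub>R f t) \<le> norm (indicator {0..} t *\<^sub>R f t)" for n
      by (auto simp: indicator_def)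
  qed measurable
  moreover have "(LBINT t. indicator {0..real n} t *\<^sub>R f t) = F (real n) - F 0" for n
  proof (rule integral_FTC_atLeastAtMost)
    show "(F has_vector_derivative f t) (at t within {0..real n})" for t
      by (rule has_vector_derivative_at_within[OF F])
    show "continuous_on {0..real n} f" by (rule continuous_on_subset[OF cont]) simp
  qed simp
  moreover have "(\<lambda>n. F (real n) - F 0) \<longlonglongrightarrow> L - F 0"
    by (intro tendsto_diff tendsto_const filterlim_compose[OF lim filterlim_real_sequentially])
  ultimately show ?thesis using LIMSEQ_unique by (simp only:)
qed

text \<open>
  Induction on \<open>k\<close>, integrating by parts.  The density of the Erlang distribution serves as an
  integrable bound.
\<close>
lemma laplace_power:
  assumes l: "Re l > 0"
  shows "integrable lborel (\<lambda>t. indicator {0..} t *\<^sub>R (of_real t ^ k / fact k * exp (- l * of_real t)))"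
    and "(LBINT t. indicator {0..} t *\<^sub>R (of_real t ^ k / fact k * exp (- l * of_real t))) = 1 / l ^ Suc k"
proof -
  define f where "f k t = of_real t ^ k / fact k * exp (- l * of_real t)" for k and t :: real
  have cont: "continuous_on UNIV (f k)" for k
    unfolding f_def[abs_def] by (intro continuous_intros) auto
  have norm_f: "norm (f k t) = \<bar>t\<bar> ^ k * exp (- Re l * t) / fact k" for k t
    by (simp add: f_def norm_mult norm_divide norm_power)
  have int: "integrable lborel (\<lambda>t. indicator {0..} t *\<^sub>R f k t)" for k
  proof (rule Bochner_Integration.integrable_bound[OF integrable_power_exp[OF l, of k]])
    have [measurable]: "f k \<in> borel_measurable borel"
      by (intro borel_measurable_continuous_onI cont)
    show "(\<lambda>t. indicator {0..} t *\<^sub>R f k t) \<in> borel_measurable lborel" by measurable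
    have "norm (f k t) \<le> t ^ k * exp (- Re l * t)" if "t \<ge> 0" for t
    proof -
      have "t ^ k * exp (- Re l * t) / fact k \<le> t ^ k * exp (- Re l * t) / 1"
        using that by (intro divide_left_mono) auto
      then show ?thesis unfolding norm_f using that by simp
    qed
    then show "AE t in lborel. norm (indicator {0..} t *\<^sub>R f k t) \<le> norm (indicator {0..} t * (t ^ k * exp (- Re l * t)))"
      by (auto simp: indicator_def)
  qed
  have l0: "l \<noteq> 0" using l by auto
  have lim: "((\<lambda>t. - f k t / l) \<longlongrightarrow> 0) at_top" for k
  proof (rule Lim_null_comparison)
    have "((\<lambda>t. t ^ k * exp (- Re l * t) / fact k / norm l) \<longlongrightarrow> 0 / fact k / norm l) at_top"
      using l0 by (intro tendsto_divide tendsto_const power_exp_tendsto_0 l) auto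
    then show "((\<lambda>t. t ^ k * exp (- Re l * t) / fact k / norm l) \<longlongrightarrow> 0) at_top" by simp
    show "\<forall>\<^sub>F t in at_top. norm (- f k t / l) \<le> t ^ k * exp (- Re l * t) / fact k / norm l"
      using eventually_ge_at_top[of 0] by eventually_elim (simp add: norm_divide norm_f)
  qed
  have "(LBINT t. indicator {0..} t *\<^sub>R f k t) = 1 / l ^ Suc k"
  proof (induction k)
    case 0
    have d: "((\<lambda>t. - f 0 t / l) has_vector_derivative f 0 t) (at t)" for t
    proof -
      have "((\<lambda>z. - exp (- l * z) / l) has_field_derivative exp (- l * of_real t)) (at (of_real t))"
        using l0 by (auto intro!: derivative_eq_intros)
      from has_vector_derivative_real_field[OF this] show ?thesis by (simp add: f_def)
    qed
    show ?case using half_line_integral[OF d cont int lim] l0 by (simp add: f_def)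
  next
    case (Suc k)
    have d: "((\<lambda>t. - f (Suc k) t / l) has_vector_derivative f (Suc k) t - f k t / l) (at t)" for t
    proof -
      have "((\<lambda>z. z ^ Suc k / fact (Suc k)) has_field_derivative of_real t ^ k / fact k) (at (of_real t :: complex))"
      proof -
        have nz: "(1 + of_nat k :: complex) \<noteq> 0"
          using of_nat_neq_0[of k, where 'a = complex] by simp
        have "((\<lambda>z. z ^ Suc k / fact (Suc k)) has_field_derivative ((1 + of_nat k) * (1 * of_real t ^ k)) / fact (Suc k)) (at (of_real t :: complex))"
          by (intro DERIV_cdivide DERIV_power_Suc DERIV_ident)
        moreover have "(1 + of_nat k) * (1 * of_real t ^ k) / fact (Suc k) = (of_real t ^ k / fact k :: complex)"
          by (simp only: fact_Suc of_nat_Suc mult_1_left mult_divide_mult_cancel_left[OF nz])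
        ultimately show ?thesis by (simp only:)
      qed
      moreover have "((\<lambda>z. - exp (- l * z) / l) has_field_derivative exp (- l * of_real t)) (at (of_real t))"
        using l0 by (auto intro!: derivative_eq_intros)
      ultimately have "((\<lambda>z. z ^ Suc k / fact (Suc k) * (- exp (- l * z) / l)) has_field_derivative
          of_real t ^ k / fact k * (- exp (- l * of_real t) / l) + exp (- l * of_real t) * (of_real t ^ Suc k / fact (Suc k))) (at (of_real t))"
        by (rule DERIV_mult)
      from has_vector_derivative_real_field[OF this] show ?thesis
        by (simp add: f_def mult_ac add.commute del: fact_Suc power_Suc)
    qed
    have sc: "indicator {0..} t *\<^sub>R (f (Suc k) t - f k t / l)
        = indicator {0..} t *\<^sub>R f (Suc k) t - (indicator {0..} t *\<^sub>R f k t) / l" for t :: real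
      by (simp add: scaleR_conv_of_real right_diff_distrib)
    have int_diff: "integrable lborel (\<lambda>t. (indicator {0..} t *\<^sub>R f k t) / l)"
      by (intro integrable_divide int)
    have "integrable lborel (\<lambda>t. indicator {0..} t *\<^sub>R f (Suc k) t - (indicator {0..} t *\<^sub>R f k t) / l)"
      by (rule Bochner_Integration.integrable_diff[OF int int_diff])
    then have i: "integrable lborel (\<lambda>t. indicator {0..} t *\<^sub>R (f (Suc k) t - f k t / l))"
      unfolding sc .
    have "(LBINT t. indicator {0..} t *\<^sub>R (f (Suc k) t - f k t / l)) = 0 - (- f (Suc k) 0 / l)"
      by (rule half_line_integral[OF d _ i lim]) (use l0 in \<open>auto intro!: continuous_intros cont\<close>)
    moreover have "(LBINT t. indicator {0..} t *\<^sub>R (f (Suc k) t - f k t / l))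
        = (LBINT t. indicator {0..} t *\<^sub>R f (Suc k) t) - (LBINT t. (indicator {0..} t *\<^sub>R f k t) / l)"
      unfolding sc by (rule Bochner_Integration.integral_diff[OF int int_diff])
    moreover have "f (Suc k) 0 = 0" by (simp add: f_def)
    ultimately show ?case
      using Suc.IH by (simp add: mult.commute)
  qed
  then show "(LBINT t. indicator {0..} t *\<^sub>R (of_real t ^ k / fact k * exp (- l * of_real t))) = 1 / l ^ Suc k"
    by (simp add: f_def)
  show "integrable lborel (\<lambda>t. indicator {0..} t *\<^sub>R (of_real t ^ k / fact k * exp (- l * of_real t)))"
    using int[of k] by (simp only: f_def)
qed

locale left_half_plane_divisor = convergent_divisor +
  assumes bdd: "bdd_above (Re ` zeros_poles f)"
begin

abbreviation "\<sigma> \<equiv> sigma1 f"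
abbreviation "s1 \<equiv> complex_of_real (sigma1 f)"

lemma Re_le: "\<rho> \<in> Z \<Longrightarrow> Re \<rho> \<le> \<sigma>"
  unfolding sigma1_def by (rule cSUP_upper[OF _ bdd])

definition coef :: "complex \<Rightarrow> complex" where
  "coef \<rho> = of_int (zorder f \<rho>) / (\<rho> - s1) ^ D"

lemma coef_abs_summable: "(\<lambda>\<rho>. norm (coef \<rho>)) summable_on (Z - {s1})"
proof (rule abs_summable_weight_comparison[where R = "2 * norm s1" and c = "2 ^ D"])
  fix \<rho> :: complex assume \<rho>: "norm \<rho> > 2 * norm s1"
  have "norm (\<rho> - s1) \<ge> norm \<rho> / 2"
    using norm_triangle_ineq2[of \<rho> "s1"] \<rho> by linarith
  moreover have "norm \<rho> > 0" using \<rho> norm_ge_zero[of "s1"] by linarith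
  ultimately have "\<bar>real_of_int (zorder f \<rho>)\<bar> / norm (\<rho> - s1) ^ D \<le> \<bar>real_of_int (zorder f \<rho>)\<bar> / (norm \<rho> / 2) ^ D"
    by (intro divide_left_mono power_mono mult_pos_pos zero_less_power) auto
  then show "norm (coef \<rho>) \<le> 2 ^ D * weight \<rho>"
    by (simp add: coef_def norm_divide norm_power power_divide mult.commute)
qed auto

lemma norm_exp_le_1: "\<rho> \<in> Z \<Longrightarrow> t \<ge> 0 \<Longrightarrow> norm (exp ((\<rho> - s1) * of_real t)) \<le> 1"
  using Re_le[of \<rho>] by (simp add: mult_nonpos_nonneg)

definition nc_kernel :: "real \<Rightarrow> complex" where
  "nc_kernel t = (newton_cramer_K f t - newton_cramer_K f 0) * indicator {0..} t"

definition kernel_part :: "nat \<Rightarrow> real \<Rightarrow> complex" where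
  "kernel_part n t = (of_int (zorder f s1) * (of_real t ^ D / fact D)
     + (\<Sum>\<rho>\<in>disc n - {s1}. coef \<rho> * (exp ((\<rho> - s1) * of_real t) - 1))) * indicator {0..} t"

lemma coef_exp_summable:
  assumes "t \<ge> 0"
  shows "(\<lambda>\<rho>. coef \<rho> * exp ((\<rho> - s1) * of_real t)) summable_on (Z - {s1})"
proof (rule Infinite_Sum.abs_summable_summable, rule Infinite_Sum.abs_summable_on_comparison_test'[OF coef_abs_summable])
  fix \<rho> assume "\<rho> \<in> Z - {s1}"
  then show "norm (coef \<rho> * exp ((\<rho> - s1) * of_real t)) \<le> norm (coef \<rho>)"
    using norm_exp_le_1[of \<rho> t] assms unfolding norm_mult by (intro mult_left_le) auto
qed

lemma kernel_part_tendsto: "(\<lambda>n. kernel_part n t) \<longlonglongrightarrow> nc_kernel t"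
proof (cases "t \<ge> 0")
  case False
  then show ?thesis by (simp add: nc_kernel_def kernel_part_def)
next
  case True
  define S where "S t = (\<Sum>\<^sub>\<infinity>\<rho>\<in>Z - {s1}. coef \<rho> * exp ((\<rho> - s1) * of_real t))" for t
  define Sn where "Sn n t = (\<Sum>\<rho>\<in>disc n - {s1}. coef \<rho> * exp ((\<rho> - s1) * of_real t))" for n t
  have lim: "(\<lambda>n. Sn n t) \<longlonglongrightarrow> S t" if "t \<ge> 0" for t
    unfolding Sn_def S_def by (rule infsum_discs_tendsto[OF coef_exp_summable[OF that]])
  have K: "newton_cramer_K f t = of_int (zorder f s1) * (of_real t ^ D / fact D) + S t" if "t \<ge> 0" for t
    using that by (simp add: newton_cramer_K_def Let_def S_def coef_def)
  have part: "kernel_part n t = of_int (zorder f s1) * (of_real t ^ D / fact D) + (Sn n t - Sn n 0)" for n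
    using True by (simp add: kernel_part_def Sn_def right_diff_distrib sum_subtractf)
  have "nc_kernel t = of_int (zorder f s1) * (of_real t ^ D / fact D) + (S t - S 0)"
    using True conv_pos by (simp add: nc_kernel_def K power_0_left)
  then show ?thesis
    unfolding part by (simp only:) (intro tendsto_intros lim True order_refl)
qed

definition kernel_bound :: "real \<Rightarrow> real" where
  "kernel_bound t = indicator {0..} t * (norm (of_int (zorder f s1) :: complex) * (t ^ D / fact D)
     + 2 * (\<Sum>\<^sub>\<infinity>\<rho>\<in>Z - {s1}. norm (coef \<rho>)))"

text \<open>
  Here the left half plane enters: \<open>Re \<rho> \<le> \<sigma>\<close> makes all exponentials in the sum bounded by \<open>1\<close> for \<open>t \<ge> 0\<close>.
  The bound does not depend on \<open>n\<close> and is used for dominated convergence.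
\<close>
lemma kernel_part_bound: "norm (kernel_part n t) \<le> kernel_bound t"
proof (cases "t \<ge> 0")
  case False
  then show ?thesis by (simp add: kernel_part_def kernel_bound_def)
next
  case True
  let ?X = "disc n - {s1}"
  have fin: "finite ?X" using finite_zeros_poles[of "cball 0 (real n)"] by simp
  have "norm (\<Sum>\<rho>\<in>?X. coef \<rho> * (exp ((\<rho> - s1) * of_real t) - 1)) \<le> (\<Sum>\<rho>\<in>?X. norm (coef \<rho>) * 2)"
  proof (rule sum_norm_le)
    fix \<rho> assume "\<rho> \<in> ?X"
    then have "norm (exp ((\<rho> - s1) * of_real t) - 1) \<le> 1 + 1"
    proof -
      have "norm (exp ((\<rho> - s1) * of_real t)) \<le> 1"
        using \<open>\<rho> \<in> ?X\<close> True by (intro norm_exp_le_1) auto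
      then show ?thesis
        using norm_triangle_ineq4[of "exp ((\<rho> - s1) * of_real t)" 1] unfolding norm_one by linarith
    qed
    then show "norm (coef \<rho> * (exp ((\<rho> - s1) * of_real t) - 1)) \<le> norm (coef \<rho>) * 2"
      unfolding norm_mult by (intro mult_left_mono) auto
  qed
  also have "\<dots> = 2 * (\<Sum>\<rho>\<in>?X. norm (coef \<rho>))"
    by (simp add: sum_distrib_left mult.commute)
  also have "\<dots> \<le> 2 * (\<Sum>\<^sub>\<infinity>\<rho>\<in>Z - {s1}. norm (coef \<rho>))"
    using finite_sum_le_infsum[OF coef_abs_summable fin] by auto
  finally have "norm (\<Sum>\<rho>\<in>?X. coef \<rho> * (exp ((\<rho> - s1) * of_real t) - 1)) \<le> 2 * (\<Sum>\<^sub>\<infinity>\<rho>\<in>Z - {s1}. norm (coef \<rho>))" .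
  moreover have "norm (of_int (zorder f s1) * (of_real t ^ D / fact D) :: complex)
      = norm (of_int (zorder f s1) :: complex) * (t ^ D / fact D)"
    using True by (simp add: norm_mult norm_divide norm_power)
  ultimately show ?thesis
    using True unfolding kernel_part_def kernel_bound_def
    by (simp only: indicator_simps mult_1_right mult_1_left atLeast_iff) (rule norm_triangle_le, linarith)
qed

lemma kernel_le: "norm (nc_kernel t) \<le> kernel_bound t"
  by (rule LIMSEQ_le_const2[OF tendsto_norm[OF kernel_part_tendsto]]) (auto intro: kernel_part_bound)

lemma kernel_part_measurable: "kernel_part n \<in> borel_measurable borel"
proof -
  have "continuous_on UNIV (\<lambda>t. of_int (zorder f s1) * (of_real t ^ D / fact D)
     + (\<Sum>\<rho>\<in>disc n - {s1}. coef \<rho> * (exp ((\<rho> - s1) * of_real t) - 1)))"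
    by (intro continuous_intros) auto
  then show ?thesis
    unfolding kernel_part_def[abs_def]
    by (intro borel_measurable_times borel_measurable_continuous_onI borel_measurable_indicator) auto
qed

lemma kernel_measurable: "nc_kernel \<in> borel_measurable borel"
  by (rule borel_measurable_LIMSEQ_metric[OF kernel_part_measurable kernel_part_tendsto])

lemma kernel_bound_integrable:
  assumes "e > 0"
  shows "integrable lborel (\<lambda>t. exp (- e * t) * kernel_bound t)"
proof -
  define a where "a = norm (of_int (zorder f s1) :: complex) / fact D"
  define b where "b = 2 * (\<Sum>\<^sub>\<infinity>\<rho>\<in>Z - {s1}. norm (coef \<rho>))"
  have "integrable lborel (\<lambda>t. a * (indicator {0..} t * (t ^ D * exp (- e * t))) + b * (indicator {0..} t * (t ^ 0 * exp (- e * t))))"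
    by (intro Bochner_Integration.integrable_add integrable_mult_right integrable_power_exp assms)
  moreover have "exp (- e * t) * kernel_bound t
      = a * (indicator {0..} t * (t ^ D * exp (- e * t))) + b * (indicator {0..} t * (t ^ 0 * exp (- e * t)))" for t
    unfolding kernel_bound_def a_def b_def by (simp add: algebra_simps)
  ultimately show ?thesis by simp
qed

sublocale laplace_density nc_kernel D \<sigma>
proof
  show "nc_kernel \<in> borel_measurable borel" by (rule kernel_measurable)
  show "nc_kernel t = 0" if "t < 0" for t using that by (simp add: nc_kernel_def)
  fix e :: real assume e: "e > 0"
  show "integrable lborel (\<lambda>t. exp (- of_real e * of_real t) * nc_kernel t)"
  proof (rule Bochner_Integration.integrable_bound[OF kernel_bound_integrable[OF e]])
    have "(\<lambda>t. exp (- of_real e * complex_of_real t)) \<in> borel_measurable borel"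
      by (intro borel_measurable_continuous_onI continuous_intros)
    then show "(\<lambda>t. exp (- of_real e * complex_of_real t) * nc_kernel t) \<in> borel_measurable lborel"
      using kernel_measurable by simp
    show "AE t in lborel. norm (exp (- of_real e * complex_of_real t) * nc_kernel t) \<le> norm (exp (- e * t) * kernel_bound t)"
    proof (rule AE_I2)
      fix t
      have "norm (exp (- of_real e * complex_of_real t) * nc_kernel t) = exp (- e * t) * norm (nc_kernel t)"
        by (simp add: norm_mult)
      also have "\<dots> \<le> exp (- e * t) * kernel_bound t"
        by (intro mult_left_mono kernel_le) simp
      also have "\<dots> \<le> norm (exp (- e * t) * kernel_bound t)"
        unfolding real_norm_def by (rule abs_ge_self)
      finally show "norm (exp (- of_real e * complex_of_real t) * nc_kernel t) \<le> norm (exp (- e * t) * kernel_bound t)" .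
    qed
  qed
qed

lemma W_newton_cramer: "W = newton_cramer f"
proof -
  have "newton_cramer f = distr_mult (\<lambda>t. exp (complex_of_real (\<sigma> * t))) ((distr_deriv ^^ D) (distr_of_fun nc_kernel))"
    unfolding newton_cramer_def nc_kernel_def[abs_def] ..
  then show ?thesis unfolding W_def by (rule sym)
qed

text \<open>
  The partial sums are integrated term by term: with \<open>l = s - \<sigma>\<close> and \<open>r = \<rho> - \<sigma>\<close>,
  \<open>l ^ d * (1 / (l - r) - 1 / l) / r ^ d = (l / r) ^ (d - 1) / (l - r)\<close>.  Dominated convergence passes to the
  limit.
\<close>
lemma W_laplace_eq:
  assumes s: "Re s > \<sigma>"
  shows "W_laplace s = G s1 s"
proof -
  define l where "l = s - s1"
  have l: "Re l > 0" "l \<noteq> 0" using s by (auto simp: l_def)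
  define p where "p k z t = indicator {0..} t *\<^sub>R (complex_of_real t ^ k / fact k * exp (- z * of_real t))" for k z t
  have p: "integrable lborel (p k z)" "(LBINT t. p k z t) = 1 / z ^ Suc k" if "Re z > 0" for k z
    using laplace_power[OF that, of k] by (simp_all add: p_def[abs_def])
  have Z_s: "Re (s - \<rho>) > 0" if "\<rho> \<in> Z" for \<rho> using Re_le[OF that] s by simp
  have eq: "exp (- l * of_real t) * kernel_part n t = of_int (zorder f s1) * p D l t
      + (\<Sum>\<rho>\<in>disc n - {s1}. coef \<rho> * (p 0 (s - \<rho>) t - p 0 l t))" for n t
  proof (cases "t \<ge> 0")
    case False
    then show ?thesis by (simp add: p_def kernel_part_def)
  next
    case True
    define X where "X = exp (- l * of_real t)"
    have "- (s - \<rho>) * of_real t = - l * of_real t + (\<rho> - s1) * of_real t" for \<rho>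
      by (simp add: l_def algebra_simps)
    then have e: "exp (- (s - \<rho>) * of_real t) = X * exp ((\<rho> - s1) * of_real t)" for \<rho>
      unfolding X_def by (simp only: exp_add)
    have pl: "p D l t = of_real t ^ D / fact D * X" "p 0 l t = X"
      using True by (simp_all add: p_def X_def)
    have ps: "p 0 (s - \<rho>) t = X * exp ((\<rho> - s1) * of_real t)" for \<rho>
      using True unfolding p_def e by simp
    have kp: "kernel_part n t = of_int (zorder f s1) * (of_real t ^ D / fact D)
       + (\<Sum>\<rho>\<in>disc n - {s1}. coef \<rho> * (exp ((\<rho> - s1) * of_real t) - 1))"
      using True by (simp add: kernel_part_def)
    show ?thesis
      unfolding pl ps kp X_def[symmetric] distrib_left sum_distrib_left
      by (intro arg_cong2[where f = "(+)"] sum.cong refl) (simp_all add: right_diff_distrib mult_ac)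
  qed
  have part: "l ^ D * (LBINT t. exp (- l * of_real t) * kernel_part n t) = Gpartial s1 n s" for n
  proof -
    have I: "(LBINT t. exp (- l * of_real t) * kernel_part n t) = of_int (zorder f s1) * (1 / l ^ Suc D)
        + (\<Sum>\<rho>\<in>disc n - {s1}. coef \<rho> * (1 / (s - \<rho>) - 1 / l))"
    proof -
      have int: "integrable lborel (\<lambda>t. coef \<rho> * (p 0 (s - \<rho>) t - p 0 l t))" if "\<rho> \<in> disc n - {s1}" for \<rho>
        using that by (intro integrable_mult_right Bochner_Integration.integrable_diff p Z_s l) auto
      have term_int: "(LBINT t. coef \<rho> * (p 0 (s - \<rho>) t - p 0 l t)) = coef \<rho> * (1 / (s - \<rho>) - 1 / l)"
        if "\<rho> \<in> disc n - {s1}" for \<rho>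
      proof -
        have r: "Re (s - \<rho>) > 0" using that Z_s by blast
        show ?thesis
          unfolding integral_mult_right_zero Bochner_Integration.integral_diff[OF p(1)[OF r] p(1)[OF l(1)]] p(2)[OF r] p(2)[OF l(1)]
          by simp
      qed
      have "(LBINT t. exp (- l * of_real t) * kernel_part n t) = (LBINT t. of_int (zorder f s1) * p D l t)
          + (LBINT t. \<Sum>\<rho>\<in>disc n - {s1}. coef \<rho> * (p 0 (s - \<rho>) t - p 0 l t))"
        unfolding eq by (intro Bochner_Integration.integral_add integrable_mult_right Bochner_Integration.integrable_sum int p(1)[OF l(1)])
      also have "(LBINT t. of_int (zorder f s1) * p D l t) = of_int (zorder f s1) * (1 / l ^ Suc D)"
        unfolding integral_mult_right_zero p(2)[OF l(1)] ..
      also have "(LBINT t. \<Sum>\<rho>\<in>disc n - {s1}. coef \<rho> * (p 0 (s - \<rho>) t - p 0 l t))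
          = (\<Sum>\<rho>\<in>disc n - {s1}. coef \<rho> * (1 / (s - \<rho>) - 1 / l))"
      proof -
        have "(LBINT t. \<Sum>\<rho>\<in>disc n - {s1}. coef \<rho> * (p 0 (s - \<rho>) t - p 0 l t))
          = (\<Sum>\<rho>\<in>disc n - {s1}. LBINT t. coef \<rho> * (p 0 (s - \<rho>) t - p 0 l t))"
          by (rule Bochner_Integration.integral_sum[OF int])
        also have "\<dots> = (\<Sum>\<rho>\<in>disc n - {s1}. coef \<rho> * (1 / (s - \<rho>) - 1 / l))"
          by (rule sum.cong[OF refl term_int])
        finally show ?thesis .
      qed
      finally show ?thesis .
    qed
    have "l ^ D * (LBINT t. exp (- l * of_real t) * kernel_part n t) = l ^ D * (of_int (zorder f s1) * (1 / l ^ Suc D))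
        + (\<Sum>\<rho>\<in>disc n - {s1}. l ^ D * (coef \<rho> * (1 / (s - \<rho>) - 1 / l)))"
      by (simp only: I distrib_left sum_distrib_left)
    also have "l ^ D * (of_int (zorder f s1) * (1 / l ^ Suc D)) = of_int (zorder f s1) / (s - s1)"
      using l(2) by (simp add: l_def[symmetric])
    also have "(\<Sum>\<rho>\<in>disc n - {s1}. l ^ D * (coef \<rho> * (1 / (s - \<rho>) - 1 / l)))
       = (\<Sum>\<rho>\<in>disc n - {s1}. ml_term s1 s \<rho>)"
    proof (rule sum.cong)
      fix \<rho> assume \<rho>: "\<rho> \<in> disc n - {s1}"
      define r where "r = \<rho> - s1"
      have r: "r \<noteq> 0" "s - \<rho> = l - r" using \<rho> by (auto simp: r_def l_def)
      have "s - \<rho> \<noteq> 0" using Z_s[of \<rho>] \<rho> by auto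
      then have "1 / (s - \<rho>) - 1 / l = r / ((s - \<rho>) * l)"
        using l(2) r by (simp add: divide_simps)
      moreover obtain n where n: "D = Suc n" using conv_pos by (cases D) auto
      ultimately show "l ^ D * (coef \<rho> * (1 / (s - \<rho>) - 1 / l)) = ml_term s1 s \<rho>"
        using l(2) r(1) \<open>s - \<rho> \<noteq> 0\<close>
        by (simp add: coef_def ml_term_def r_def[symmetric] l_def[symmetric] n) 
    qed simp
    finally show ?thesis by (simp add: Gpartial_def)
  qed
  have "(\<lambda>n. LBINT t. exp (- l * of_real t) * kernel_part n t) \<longlonglongrightarrow> (LBINT t. exp (- l * of_real t) * nc_kernel t)"
  proof (rule integral_dominated_convergence[OF _ _ kernel_bound_integrable[OF l(1)]])
    have "(\<lambda>t. exp (- l * complex_of_real t)) \<in> borel_measurable borel"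
      by (intro borel_measurable_continuous_onI continuous_intros)
    then show "(\<lambda>t. exp (- l * complex_of_real t) * nc_kernel t) \<in> borel_measurable lborel"
      "(\<lambda>t. exp (- l * complex_of_real t) * kernel_part n t) \<in> borel_measurable lborel" for n
      using kernel_measurable kernel_part_measurable by simp_all
    show "AE t in lborel. (\<lambda>n. exp (- l * complex_of_real t) * kernel_part n t) \<longlonglongrightarrow> exp (- l * complex_of_real t) * nc_kernel t"
      by (intro AE_I2 tendsto_intros kernel_part_tendsto)
    show "AE t in lborel. norm (exp (- l * complex_of_real t) * kernel_part n t) \<le> exp (- Re l * t) * kernel_bound t" for n
      using kernel_part_bound by (intro AE_I2) (simp add: norm_mult)
  qed
  then have "(\<lambda>n. l ^ D * (LBINT t. exp (- l * of_real t) * kernel_part n t)) \<longlonglongrightarrow> l ^ D * (LBINT t. exp (- l * of_real t) * nc_kernel t)"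
    by (intro tendsto_intros)
  then have "(\<lambda>n. Gpartial s1 n s) \<longlonglongrightarrow> W_laplace s"
    unfolding part by (simp add: W_laplace_def l_def)
  then show ?thesis using Gpartial_tendsto by (rule LIMSEQ_unique)
qed

text \<open>
  Each term is \<open>coef \<rho>\<close>, which is summable, times \<open>(s - \<sigma>) ^ (d - 1)\<close> and \<open>(\<rho> - \<sigma>) / (s - \<rho>)\<close>.  The last factor
  is at most \<open>1 + norm (s - \<sigma>) / \<delta>\<close>, because \<open>s\<close> keeps the distance \<open>\<delta> = c - \<sigma>\<close> from the divisor.
\<close>
lemma G_growth:
  assumes c: "c > \<sigma>"
  obtains C where "C \<ge> 0" "\<And>s. Re s \<ge> c \<Longrightarrow> norm (G s1 s) \<le> C * (1 + norm s) ^ D"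
proof -
  define \<delta> where "\<delta> = c - \<sigma>"
  have \<delta>: "\<delta> > 0" using c by (simp add: \<delta>_def)
  define A where "A = (\<Sum>\<^sub>\<infinity>\<rho>\<in>Z - {s1}. norm (coef \<rho>))"
  have A: "A \<ge> 0" unfolding A_def by (rule infsum_nonneg) simp
  define N where "N = norm (of_int (zorder f s1) :: complex)"
  define q where "q = 1 + \<bar>\<sigma>\<bar>"
  have q: "q \<ge> 1" by (simp add: q_def)
  obtain n where n: "D = Suc n" using conv_pos by (cases D) auto
  have "norm (G s1 s) \<le> (N / \<delta> + A * q ^ n * (1 + q / \<delta>)) * (1 + norm s) ^ D" if s: "Re s \<ge> c" for s
  proof -
    define y where "y = 1 + norm s"
    have y: "y \<ge> 1" by (simp add: y_def)
    have ls: "norm (s - s1) \<le> q * y"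
    proof -
      have "norm (s - s1) \<le> norm s + \<bar>\<sigma>\<bar>"
        using norm_triangle_ineq4[of s "s1"] by simp
      also have "\<dots> \<le> q * y" by (simp add: q_def y_def algebra_simps)
      finally show ?thesis .
    qed
    have far: "norm (s - \<rho>) \<ge> \<delta>" if "Re \<rho> \<le> \<sigma>" for \<rho>
      using complex_Re_le_cmod[of "s - \<rho>"] that s by (simp add: \<delta>_def)
    have pt: "norm (ml_term s1 s \<rho>) \<le> (q * y) ^ n * (1 + q * y / \<delta>) * norm (coef \<rho>)" if \<rho>: "\<rho> \<in> Z - {s1}" for \<rho>
    proof -
      have r0: "\<rho> - s1 \<noteq> 0" using \<rho> by auto
      have f: "norm (s - \<rho>) \<ge> \<delta>" using \<rho> Re_le by (intro far) auto
      have "ml_term s1 s \<rho> = (s - s1) ^ n * ((\<rho> - s1) / (s - \<rho>)) * coef \<rho>"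
        using r0 by (simp add: ml_term_def coef_def n mult_ac)
      moreover have "norm ((\<rho> - s1) / (s - \<rho>)) \<le> 1 + q * y / \<delta>"
      proof -
        have "norm (\<rho> - s1) \<le> norm (s - \<rho>) + norm (s - s1)"
          using norm_triangle_ineq4[of "s - s1" "s - \<rho>"] by simp
        then have "norm (\<rho> - s1) / norm (s - \<rho>) \<le> 1 + norm (s - s1) / norm (s - \<rho>)"
          using divide_right_mono[of "norm (\<rho> - s1)" "norm (s - \<rho>) + norm (s - s1)" "norm (s - \<rho>)"] f \<delta>
          unfolding add_divide_distrib by (auto split: if_splits)
        also have "norm (s - s1) / norm (s - \<rho>) \<le> q * y / \<delta>"
          using f \<delta> ls q y by (intro frac_le) auto
        finally show ?thesis by (simp add: norm_divide)
      qed
      moreover have "norm ((s - s1) ^ n) \<le> (q * y) ^ n"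
        unfolding norm_power by (intro power_mono ls) simp
      ultimately have "norm ((s - s1) ^ n) * norm ((\<rho> - s1) / (s - \<rho>)) * norm (coef \<rho>)
          \<le> (q * y) ^ n * (1 + q * y / \<delta>) * norm (coef \<rho>)"
        using q y by (intro mult_right_mono mult_mono) (auto intro: zero_le_power)
      then show ?thesis
        unfolding \<open>ml_term s1 s \<rho> = _\<close> norm_mult .
    qed
    have "norm (\<Sum>\<^sub>\<infinity>\<rho>\<in>Z - {s1}. ml_term s1 s \<rho>) \<le> (\<Sum>\<^sub>\<infinity>\<rho>\<in>Z - {s1}. norm (ml_term s1 s \<rho>))"
      by (rule Infinite_Sum.norm_infsum_bound[OF ml_term_abs_summable]) auto
    also have "\<dots> \<le> (\<Sum>\<^sub>\<infinity>\<rho>\<in>Z - {s1}. (q * y) ^ n * (1 + q * y / \<delta>) * norm (coef \<rho>))"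
      by (rule infsum_mono[OF ml_term_abs_summable _ pt]) (auto intro: summable_on_cmult_right coef_abs_summable)
    also have "\<dots> = (q * y) ^ n * (1 + q * y / \<delta>) * A"
      unfolding A_def by (rule infsum_cmult_right')
    also have "\<dots> \<le> (q * y) ^ n * (y * (1 + q / \<delta>)) * A"
    proof (intro mult_right_mono mult_left_mono A)
      have "y * (1 + q / \<delta>) = y + q * y / \<delta>" by (simp add: distrib_left mult.commute)
      then show "1 + q * y / \<delta> \<le> y * (1 + q / \<delta>)" using y by linarith
      show "0 \<le> (q * y) ^ n" using q y by simp
    qed
    also have "\<dots> = A * q ^ n * (1 + q / \<delta>) * y ^ D"
      by (simp add: n power_mult_distrib mult_ac)
    finally have 1: "norm (\<Sum>\<^sub>\<infinity>\<rho>\<in>Z - {s1}. ml_term s1 s \<rho>) \<le> A * q ^ n * (1 + q / \<delta>) * y ^ D" .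
    have "norm (of_int (zorder f s1) / (s - s1)) \<le> N / \<delta>"
      unfolding norm_divide N_def using far[of "s1"] \<delta> by (intro frac_le) auto
    also have "N / \<delta> = N / \<delta> * 1" by simp
    also have "\<dots> \<le> N / \<delta> * y ^ D"
      using \<delta> by (intro mult_left_mono one_le_power y) (simp add: N_def)
    finally have 2: "norm (of_int (zorder f s1) / (s - s1)) \<le> N / \<delta> * y ^ D" .
    show ?thesis
      unfolding G_def y_def[symmetric] distrib_right by (rule norm_triangle_le) (use 1 2 in linarith)
  qed
  moreover have "N / \<delta> + A * q ^ n * (1 + q / \<delta>) \<ge> 0"
    using \<delta> A q by (simp add: N_def)
  ultimately show ?thesis using that by blast
qed

end

section \<open>The Laplace transform of the Newton-Cramer distribution\<close>
lemma poly_growth_bound: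
  fixes P :: "complex poly"
  obtains C where "C \<ge> 0" "\<And>s. norm (poly P s) \<le> C * (1 + norm s) ^ degree P"
proof -
  have "norm (poly P s) \<le> (\<Sum>j\<le>degree P. norm (coeff P j)) * (1 + norm s) ^ degree P" for s
  proof -
    have "norm (poly P s) \<le> (\<Sum>j\<le>degree P. norm (coeff P j) * (1 + norm s) ^ degree P)"
      unfolding poly_altdef
    proof (rule sum_norm_le)
      fix j assume "j \<in> {..degree P}"
      then have "norm s ^ j \<le> (1 + norm s) ^ degree P"
        by (intro order_trans[OF power_mono power_increasing]) auto
      then show "norm (coeff P j * s ^ j) \<le> norm (coeff P j) * (1 + norm s) ^ degree P"
        unfolding norm_mult norm_power by (rule mult_left_mono) simp
    qed
    then show ?thesis by (simp add: sum_distrib_right)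
  qed
  moreover have "(\<Sum>j\<le>degree P. norm (coeff P j)) \<ge> 0" by (rule sum_nonneg) simp
  ultimately show ?thesis using that by blast
qed

context left_half_plane_divisor
begin

lemma half_plane_avoids:
  assumes "Re s > \<sigma>"
  shows "s \<notin> Z" "s \<noteq> s1" "f s \<noteq> 0"
  using assms Re_le[of s] zeros_poles_iff[of s] by auto

lemma W_laplace_log_derivative:
  assumes "Re s > \<sigma>"
  shows "W_laplace s = deriv f s / f s + poly (discrepancy_poly f) s"
  using W_laplace_eq[OF assms] discrepancy_poly(1)[OF half_plane_avoids(1,2)[OF assms]]
  by (simp add: discrepancy_G_eq)

lemma log_derivative_polynomial_growth:
  assumes c: "c > \<sigma>"
  shows "\<exists>k. polynomial_growth (\<lambda>s. deriv f s / f s) c k"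
proof -
  let ?P = "discrepancy_poly f"
  obtain C1 where C1: "C1 \<ge> 0" "\<And>s. Re s \<ge> c \<Longrightarrow> norm (G s1 s) \<le> C1 * (1 + norm s) ^ D"
    using G_growth[OF c] by blast
  obtain C2 where C2: "C2 \<ge> 0" "\<And>s. norm (poly ?P s) \<le> C2 * (1 + norm s) ^ degree ?P"
    using poly_growth_bound by blast
  let ?k = "max D (degree ?P)"
  have "(\<lambda>s. deriv f s / f s) analytic_on {s}" if "Re s \<ge> c" for s
  proof -
    have s: "Re s > \<sigma>" using that c by simp
    then show ?thesis
      using half_plane_avoids[OF s] analytic_off_zeros_poles[of s] by (intro analytic_intros) auto
  qed
  then have "(\<lambda>s. deriv f s / f s) analytic_on {s. Re s \<ge> c}"
    using analytic_on_analytic_at by blast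
  then have "(\<lambda>s. deriv f s / f s) holomorphic_on {s. Re s \<ge> c}"
    by (rule analytic_imp_holomorphic)
  moreover have "norm (deriv f s / f s) \<le> (C1 + C2) * (1 + norm s) ^ ?k" if "Re s \<ge> c" for s
  proof -
    have s: "Re s > \<sigma>" using that c by simp
    have "deriv f s / f s = G s1 s - poly ?P s"
      using W_laplace_log_derivative[OF s] W_laplace_eq[OF s] by simp
    then have "norm (deriv f s / f s) \<le> norm (G s1 s) + norm (poly ?P s)"
      by (simp only: norm_triangle_ineq4)
    also have "\<dots> \<le> C1 * (1 + norm s) ^ D + C2 * (1 + norm s) ^ degree ?P"
      by (intro add_mono C1 C2 that)
    also have "\<dots> \<le> C1 * (1 + norm s) ^ ?k + C2 * (1 + norm s) ^ ?k"
      using C1(1) C2(1) by (intro add_mono mult_left_mono power_increasing) auto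
    finally show ?thesis by (simp only: distrib_right)
  qed
  ultimately show ?thesis unfolding polynomial_growth_def by blast
qed

text \<open>
  The identity \<open>G = f'/f + P\<close> integrated over \<open>Re s = c\<close> against the transform of the test function.
\<close>
lemma newton_cramer_inverse_laplace:
  assumes c: "c > max \<sigma> 0" and F: "polynomial_growth (\<lambda>s. deriv f s / f s) c k" and m: "m \<ge> k + 2"
    and \<phi>: "test_function \<phi>"
  shows "newton_cramer f \<phi> = (\<Sum>j<genus f. coeff (discrepancy_poly f) j * (distr_deriv ^^ j) dirac0 \<phi>)
      + inverse_laplace c m (\<lambda>s. deriv f s / f s) \<phi>"
proof -
  let ?P = "discrepancy_poly f"
  let ?F = "\<lambda>s. deriv f s / f s"
  have c': "c > 0" "c > \<sigma>" using c by auto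
  obtain C where cont: "continuous_on UNIV (\<lambda>v. ?F (Complex c v))"
    and C: "\<And>v. norm (?F (Complex c v)) \<le> C * norm (Complex c v) ^ k"
    using polynomial_growth_line[OF F c'(1)] by blast
  have F_int: "integrable lborel (\<lambda>v. ?F (Complex c v) * bilateral_laplace \<phi> (Complex c v))"
    by (rule integrable_times_bilateral_laplace[OF \<phi> c'(1) cont C])
  have P: "integrable lborel (\<lambda>v. poly ?P (Complex c v) * bilateral_laplace \<phi> (Complex c v))"
    "(LBINT v. poly ?P (Complex c v) * bilateral_laplace \<phi> (Complex c v))
      = of_real (2 * pi) * (\<Sum>j<genus f. coeff ?P j * (distr_deriv ^^ j) dirac0 \<phi>)"
    by (rule polynomial_delta_pairing[OF \<phi> c'(1), where N = "genus f"], rule discrepancy_poly(2), assumption)+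
  have "of_real (2 * pi) * newton_cramer f \<phi> = (LBINT v. W_laplace (Complex c v) * bilateral_laplace \<phi> (Complex c v))"
    using W_parseval[OF \<phi> c'] unfolding W_newton_cramer .
  also have "\<dots> = (LBINT v. ?F (Complex c v) * bilateral_laplace \<phi> (Complex c v) + poly ?P (Complex c v) * bilateral_laplace \<phi> (Complex c v))"
    using c'(2) by (intro Bochner_Integration.integral_cong refl) (simp add: W_laplace_log_derivative distrib_right)
  also have "\<dots> = (LBINT v. ?F (Complex c v) * bilateral_laplace \<phi> (Complex c v)) + (LBINT v. poly ?P (Complex c v) * bilateral_laplace \<phi> (Complex c v))"
    by (rule Bochner_Integration.integral_add[OF F_int P(1)])
  also have "\<dots> = of_real (2 * pi) * ((\<Sum>j<genus f. coeff ?P j * (distr_deriv ^^ j) dirac0 \<phi>) + inverse_laplace c m ?F \<phi>)"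
    unfolding P(2) inverse_laplace_pairing[OF \<phi> c'(1) F m, symmetric] by (simp only: distrib_left add.commute)
  finally show ?thesis by simp
qed

lemma newton_cramer_laplace:
  "has_laplace_transform (newton_cramer f) (\<lambda>s. deriv f s / f s + poly (discrepancy_poly f) s)"
  unfolding has_laplace_transform_def
proof (intro conjI exI allI impI)
  show "supported_nonneg (newton_cramer f)"
    using W_supported unfolding W_newton_cramer .
  fix s assume s: "\<sigma> < Re s"
  show "pairing_exp (newton_cramer f) s (deriv f s / f s + poly (discrepancy_poly f) s)"
    using W_pairing_exp[OF s] unfolding W_newton_cramer W_laplace_log_derivative[OF s] .
qed

end

lemma entire_finite_order_power_bound:
  assumes "entire_finite_order g"
  obtains m0 :: nat and R where "\<And>m z. m \<ge> m0 \<Longrightarrow> norm z \<ge> R \<Longrightarrow> norm (g z) \<le> exp (norm z ^ m)"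
proof -
  obtain r where "\<forall>\<^sub>F z in at_infinity. norm (g z) \<le> exp (norm z powr r)"
    using assms unfolding entire_finite_order_def by blast
  then obtain b where b: "\<And>z. norm z \<ge> b \<Longrightarrow> norm (g z) \<le> exp (norm z powr r)"
    unfolding eventually_at_infinity by blast
  have "norm (g z) \<le> exp (norm z ^ m)" if "m \<ge> nat \<lceil>r\<rceil>" "norm z \<ge> max b 1" for m z
  proof -
    have "r \<le> real m" using that(1) by linarith
    then have "norm z powr r \<le> norm z powr real m"
      using that(2) by (intro powr_mono) auto
    also have "\<dots> = norm z ^ m" using that(2) by (intro powr_realpow) auto
    finally show ?thesis using b[of z] that(2) by (simp add: order_trans)
  qed
  then show ?thesis using that by blast
qed

text \<open>
  A single exponent \<open>m\<close> has to dominate the orders of both entire functions; away from the zeros of \<open>f\<close>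
  and \<open>h\<close> the numerator cannot vanish.
\<close>
lemma left_half_plane_divisorI:
  assumes f: "f nicely_meromorphic_on UNIV" and nz: "\<exists>z. f z \<noteq> 0" and fo: "finite_order f"
    and D: "convergence_exponent f \<ge> 1" and bdd: "bdd_above (Re ` zeros_poles f)"
  shows "left_half_plane_divisor f"
proof -
  obtain g h where g: "entire_finite_order g" and h: "entire_finite_order h" "\<exists>z. h z \<noteq> 0"
    and quot: "\<And>z. h z \<noteq> 0 \<Longrightarrow> f z = g z / h z"
    using fo unfolding finite_order_def by blast
  have an: "g analytic_on UNIV" "h analytic_on UNIV"
    using g h(1) by (auto simp: entire_finite_order_def analytic_on_open)
  obtain m1 R1 where 1: "\<And>m z. m \<ge> m1 \<Longrightarrow> norm z \<ge> R1 \<Longrightarrow> norm (g z) \<le> exp (norm z ^ m)"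
    using entire_finite_order_power_bound[OF g] by blast
  obtain m2 R2 where 2: "\<And>m z. m \<ge> m2 \<Longrightarrow> norm z \<ge> R2 \<Longrightarrow> norm (h z) \<le> exp (norm z ^ m)"
    using entire_finite_order_power_bound[OF h(1)] by blast
  interpret f: nonzero_meromorphic f using f nz by unfold_locales
  interpret h: nonzero_meromorphic h
    using analytic_on_imp_nicely_meromorphic_on[OF an(2)] h(2) by unfold_locales
  have "\<forall>\<^sub>F z in at 0. g z \<noteq> 0"
    using f.eventually_nonzero h.eventually_nonzero by eventually_elim (use quot in force)
  then have "\<exists>z. g z \<noteq> 0" by (rule eventually_happens'[OF at_neq_bot])
  then interpret g: nonzero_meromorphic g
    using analytic_on_imp_nicely_meromorphic_on[OF an(1)] by unfold_locales
  interpret finite_order_quotient f g h "max 1 (max m1 m2)" "max R1 R2"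
    by unfold_locales (use an quot 1 2 in auto)
  interpret convergent_divisor f by (rule convergent_divisor[OF D])
  show ?thesis by unfold_locales (rule bdd)
qed

theorem theorem3p15:
  fixes f :: "complex \<Rightarrow> complex"
  assumes "f nicely_meromorphic_on UNIV"
    and "\<exists>z. f z \<noteq> 0"
    and "finite_order f"
    and "convergence_exponent f \<ge> 1"
    and "bdd_above (Re ` zeros_poles f)"
  shows
    "(\<forall>c > max (sigma1 f) 0.
        (\<exists>k. polynomial_growth (\<lambda>s. deriv f s / f s) c k) \<and>
        (\<forall>k m. polynomial_growth (\<lambda>s. deriv f s / f s) c k \<and> m \<ge> k + 2 \<longrightarrow>
           distr_eq (newton_cramer f)
             (\<lambda>\<phi>. (\<Sum>j<genus f. coeff (discrepancy_poly f) j * (distr_deriv ^^ j) dirac0 \<phi>)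
                  + inverse_laplace c m (\<lambda>s. deriv f s / f s) \<phi>))) \<and>
     has_laplace_transform (newton_cramer f)
       (\<lambda>s. deriv f s / f s + poly (discrepancy_poly f) s)"
proof -
  interpret left_half_plane_divisor f
    by (rule left_half_plane_divisorI[OF assms])
  show ?thesis
    unfolding distr_eq_def
    using log_derivative_polynomial_growth newton_cramer_inverse_laplace newton_cramer_laplace by auto
qed

end
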